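(* In a finitely generated bipolar Coxeter group $W$ any two Coxeter generating sets are reflection-compatible. In particular, every Coxeter generating set of $W$ consists of bipolar elements.
   Context: Two Coxeter generating sets $S_1,S_2$ of $W$ are reflection-compatible if every element of $S_1$ is conjugate in $W$ to an element of $S_2$ (this is an equivalence relation on the collection of all Coxeter generating sets). Bipolarity. Let $X$ be the Cayley graph of $W$ with respect to a finite generating set, with the path-metric in which edges have length $1$, and identify $W$ with the vertex set of $X$. For $H\subset X$ let $\mathcal N^X_k(H)=\{x\in X: d(x,H)\le k\}$. For a subset $H\subset W$, a pole of $(W,H)$ is a chain $U_1\supset U_2\supset\cdots$ where $U_k$ is a non-empty connected component of $X\setminus\mathcal N^X_k(H)$. The number of poles $\tilde e(W,H)$ does not depend on the chosen finite generating set. An element $s$ of a Coxeter generating set is bipolar if $\tilde e(W,\mathscr Z_W(s))=2$, where $\mathscr Z_W(s)$ is the centraliser of $s$ in $W$. $W$ is bipolar if it admits a Coxeter generating set all of whose elements are bipolar. *)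

theory Defs
  imports "HOL-Analysis.Analysis" "HOL-Algebra.Generated_Groups"
begin

section \<open>Group presentations and Coxeter generating sets\<close>

text \<open>A word in the letters of \<open>S\<close> and their formal inverses: \<open>(x, True)\<close> stands for \<open>x\<close>
  and \<open>(x, False)\<close> for the formal inverse of \<open>x\<close>.\<close>

type_synonym 'a word = "('a \<times> bool) list"

definition word_eval :: "('a, 'b) monoid_scheme \<Rightarrow> 'a word \<Rightarrow> 'a" where
  "word_eval G w = foldr (\<lambda>(x, b) g. (if b then x else inv\<^bsub>G\<^esub> x) \<otimes>\<^bsub>G\<^esub> g) w \<one>\<^bsub>G\<^esub>"

inductive word_delete :: "'a set \<Rightarrow> 'a word set \<Rightarrow> 'a word \<Rightarrow> 'a word \<Rightarrow> bool" for S R where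
  cancel: "x \<in> S \<Longrightarrow> word_delete S R (u @ [(x, b), (x, \<not> b)] @ v) (u @ v)"
| relator: "r \<in> R \<Longrightarrow> word_delete S R (u @ r @ v) (u @ v)"

text \<open>\<open>G = \<langle>S | R\<rangle>\<close>: the subset \<open>S\<close> generates \<open>G\<close>, and a word over \<open>S\<close> represents the identity
  exactly if it becomes empty after finitely many insertions and deletions of relators and of
  pairs of mutually inverse letters.\<close>

definition has_presentation :: "('a, 'b) monoid_scheme \<Rightarrow> 'a set \<Rightarrow> 'a word set \<Rightarrow> bool" where
  "has_presentation G S R \<longleftrightarrow>
     S \<subseteq> carrier G \<and> generate G S = carrier G \<and>
     (\<forall>w. set w \<subseteq> S \<times> UNIV \<longrightarrow>
        (word_eval G w = \<one>\<^bsub>G\<^esub> \<longleftrightarrow> equivclp (word_delete S R) w []))"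

text \<open>The value \<open>0\<close> encodes the entry \<open>\<infinity>\<close> of a Coxeter matrix.\<close>

definition coxeter_matrix :: "'a set \<Rightarrow> ('a \<Rightarrow> 'a \<Rightarrow> nat) \<Rightarrow> bool" where
  "coxeter_matrix S m \<longleftrightarrow>
     (\<forall>s\<in>S. m s s = 1) \<and>
     (\<forall>s\<in>S. \<forall>t\<in>S. m s t = m t s \<and> (s \<noteq> t \<longrightarrow> m s t = 0 \<or> m s t \<ge> 2))"

definition coxeter_relators :: "'a set \<Rightarrow> ('a \<Rightarrow> 'a \<Rightarrow> nat) \<Rightarrow> 'a word set" where
  "coxeter_relators S m =
     {concat (replicate (m s t) [(s, True), (t, True)]) | s t. s \<in> S \<and> t \<in> S \<and> m s t \<noteq> 0}"

definition coxeter_generating_set :: "('a, 'b) monoid_scheme \<Rightarrow> 'a set \<Rightarrow> bool" where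
  "coxeter_generating_set W S \<longleftrightarrow>
     (\<exists>m. coxeter_matrix S m \<and> has_presentation W S (coxeter_relators S m))"

definition reflection_compatible :: "('a, 'b) monoid_scheme \<Rightarrow> 'a set \<Rightarrow> 'a set \<Rightarrow> bool" where
  "reflection_compatible W S\<^sub>1 S\<^sub>2 \<longleftrightarrow>
     (\<forall>s\<in>S\<^sub>1. \<exists>t\<in>S\<^sub>2. \<exists>g\<in>carrier W. s = g \<otimes>\<^bsub>W\<^esub> t \<otimes>\<^bsub>W\<^esub> inv\<^bsub>W\<^esub> g)"

definition centraliser :: "('a, 'b) monoid_scheme \<Rightarrow> 'a \<Rightarrow> 'a set" where
  "centraliser W s = {g \<in> carrier W. g \<otimes>\<^bsub>W\<^esub> s = s \<otimes>\<^bsub>W\<^esub> g}"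


section \<open>Metric graphs\<close>

text \<open>A graph has a vertex set \<open>V\<close> and a set \<open>E\<close> of two-element subsets of \<open>V\<close>. The points of its
  geometric realization are given by their barycentric coordinates.\<close>

definition vertex_point :: "'v \<Rightarrow> 'v \<Rightarrow> real" where
  "vertex_point v = (\<lambda>w. if w = v then 1 else 0)"

definition closed_edge :: "'v set \<Rightarrow> ('v \<Rightarrow> real) set" where
  "closed_edge e = {p. (\<forall>v. 0 \<le> p v) \<and> (\<forall>v. v \<notin> e \<longrightarrow> p v = 0) \<and> (\<Sum>v\<in>e. p v) = 1}"

definition realization :: "'v set \<Rightarrow> 'v set set \<Rightarrow> ('v \<Rightarrow> real) set" where
  "realization V E = vertex_point ` V \<union> (\<Union>e\<in>E. closed_edge e)"

text \<open>\<open>polygonal_path V E p q l\<close>: there is a path of length \<open>l\<close> from \<open>p\<close> to \<open>q\<close> composed of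
  finitely many segments, each of which lies in one edge. On the edge \<open>{g, h}\<close> the length of the
  segment from \<open>q\<close> to \<open>r\<close> is \<open>\<bar>q g - r g\<bar> = \<bar>q h - r h\<bar>\<close>; so edges have length \<open>1\<close>.\<close>

inductive polygonal_path ::
  "'v set \<Rightarrow> 'v set set \<Rightarrow> ('v \<Rightarrow> real) \<Rightarrow> ('v \<Rightarrow> real) \<Rightarrow> real \<Rightarrow> bool" for V E where
  trivial: "p \<in> realization V E \<Longrightarrow> polygonal_path V E p p 0"
| segment: "polygonal_path V E p q l \<Longrightarrow> e \<in> E \<Longrightarrow> q \<in> closed_edge e \<Longrightarrow> r \<in> closed_edge e \<Longrightarrow>
    polygonal_path V E p r (l + (\<Sum>v\<in>e. \<bar>q v - r v\<bar>) / 2)"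

text \<open>The library's metric spaces require a total distance function; the value outside of the
  realization is irrelevant.\<close>

definition path_metric ::
  "'v set \<Rightarrow> 'v set set \<Rightarrow> ('v \<Rightarrow> real) \<Rightarrow> ('v \<Rightarrow> real) \<Rightarrow> real" where
  "path_metric V E p q =
     (if p \<in> realization V E \<and> q \<in> realization V E then Inf {l. polygonal_path V E p q l} else 0)"

text \<open>The distance to the empty set is infinite, so its neighbourhoods are empty.\<close>

definition graph_nbhd ::
  "'v set \<Rightarrow> 'v set set \<Rightarrow> nat \<Rightarrow> ('v \<Rightarrow> real) set \<Rightarrow> ('v \<Rightarrow> real) set" where
  "graph_nbhd V E k H =
     {x \<in> realization V E. H \<noteq> {} \<and> (INF h\<in>H. path_metric V E x h) \<le> real k}"


section \<open>Poles and bipolarity\<close>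

definition finite_generating_set :: "('a, 'b) monoid_scheme \<Rightarrow> 'a set \<Rightarrow> bool" where
  "finite_generating_set G A \<longleftrightarrow> finite A \<and> A \<subseteq> carrier G \<and> generate G A = carrier G"

definition finitely_generated :: "('a, 'b) monoid_scheme \<Rightarrow> bool" where
  "finitely_generated G \<longleftrightarrow> (\<exists>A. finite_generating_set G A)"

definition cayley_edges :: "('a, 'b) monoid_scheme \<Rightarrow> 'a set \<Rightarrow> 'a set set" where
  "cayley_edges G A = {{g, g \<otimes>\<^bsub>G\<^esub> a} | g a. g \<in> carrier G \<and> a \<in> A \<and> a \<noteq> \<one>\<^bsub>G\<^esub>}"

definition cayley_space :: "('a, 'b) monoid_scheme \<Rightarrow> 'a set \<Rightarrow> ('a \<Rightarrow> real) set" where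
  "cayley_space G A = realization (carrier G) (cayley_edges G A)"

definition cayley_dist ::
  "('a, 'b) monoid_scheme \<Rightarrow> 'a set \<Rightarrow> ('a \<Rightarrow> real) \<Rightarrow> ('a \<Rightarrow> real) \<Rightarrow> real" where
  "cayley_dist G A = path_metric (carrier G) (cayley_edges G A)"

definition cayley_topology :: "('a, 'b) monoid_scheme \<Rightarrow> 'a set \<Rightarrow> ('a \<Rightarrow> real) topology" where
  "cayley_topology G A = Metric_space.mtopology (cayley_space G A) (cayley_dist G A)"

definition cayley_nbhd ::
  "('a, 'b) monoid_scheme \<Rightarrow> 'a set \<Rightarrow> nat \<Rightarrow> ('a \<Rightarrow> real) set \<Rightarrow> ('a \<Rightarrow> real) set" where
  "cayley_nbhd G A = graph_nbhd (carrier G) (cayley_edges G A)"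

text \<open>A pole is a chain \<open>U\<^sub>1 \<supseteq> U\<^sub>2 \<supseteq> \<dots>\<close>, the set \<open>U\<^sub>k\<close> being represented by \<open>U (k - 1)\<close>. The
  members of \<^const>\<open>connected_components_of\<close> are non-empty.\<close>

definition poles ::
  "('a, 'b) monoid_scheme \<Rightarrow> 'a set \<Rightarrow> 'a set \<Rightarrow> (nat \<Rightarrow> ('a \<Rightarrow> real) set) set" where
  "poles G A H =
     {U. decseq U \<and>
         (\<forall>k. U k \<in> connected_components_of
                (subtopology (cayley_topology G A)
                  (cayley_space G A - cayley_nbhd G A (Suc k) (vertex_point ` H))))}"

text \<open>The number of poles does not depend on the finite generating set, hence the use of choice.
  An infinite set of poles is counted as \<open>0\<close>, which is harmless since the number is only ever
  compared with \<open>2\<close>.\<close>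

definition num_poles :: "('a, 'b) monoid_scheme \<Rightarrow> 'a set \<Rightarrow> nat" where
  "num_poles G H = card (poles G (SOME A. finite_generating_set G A) H)"

definition bipolar_element :: "('a, 'b) monoid_scheme \<Rightarrow> 'a \<Rightarrow> bool" where
  "bipolar_element W s \<longleftrightarrow> num_poles W (centraliser W s) = 2"

definition bipolar_group :: "('a, 'b) monoid_scheme \<Rightarrow> bool" where
  "bipolar_group W \<longleftrightarrow> (\<exists>S. coxeter_generating_set W S \<and> (\<forall>s\<in>S. bipolar_element W s))"


section \<open>The path metric of a Cayley graph is a metric\<close>

lemma closed_edge_subset_realization: "e \<in> E \<Longrightarrow> closed_edge e \<subseteq> realization V E"
  by (auto simp: realization_def)

lemma polygonal_path_mem:
  "polygonal_path V E p q l \<Longrightarrow> p \<in> realization V E \<and> q \<in> realization V E"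
  by (induction rule: polygonal_path.induct) (auto simp: realization_def)

lemma polygonal_path_trans:
  assumes "polygonal_path V E p q l" "polygonal_path V E q r l'"
  shows "polygonal_path V E p r (l + l')"
  using assms(2,1)
proof (induction rule: polygonal_path.induct)
  case (trivial q)
  then show ?case by simp
next
  case (segment q q' l' e r)
  from polygonal_path.segment[OF segment.IH[OF segment.prems] segment.hyps(2-4)]
  show ?case by (simp add: add.assoc)
qed

lemma polygonal_path_segment:
  assumes "e \<in> E" "q \<in> closed_edge e" "r \<in> closed_edge e"
  shows "polygonal_path V E q r ((\<Sum>v\<in>e. \<bar>q v - r v\<bar>) / 2)"
proof -
  have "q \<in> realization V E" using assms by (auto simp: realization_def)
  from polygonal_path.segment[OF polygonal_path.trivial[OF this] assms] show ?thesis by simp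
qed

lemma polygonal_path_sym: "polygonal_path V E p q l \<Longrightarrow> polygonal_path V E q p l"
proof (induction rule: polygonal_path.induct)
  case (trivial p)
  then show ?case by (rule polygonal_path.trivial)
next
  case (segment p q l e r)
  have "polygonal_path V E r p ((\<Sum>v\<in>e. \<bar>r v - q v\<bar>) / 2 + l)"
    by (rule polygonal_path_trans[OF polygonal_path_segment segment.IH]) (use segment in auto)
  then show ?case by (simp add: add.commute abs_minus_commute)
qed

lemma polygonal_path_ge:
  assumes "polygonal_path V E p q l" "\<forall>e\<in>E. finite e"
  shows "\<bar>p v - q v\<bar> \<le> 2 * l"
  using assms(1)
proof (induction rule: polygonal_path.induct)
  case (trivial p)
  then show ?case by simp
next
  case (segment p q l e r)
  have "\<bar>q v - r v\<bar> \<le> (\<Sum>v\<in>e. \<bar>q v - r v\<bar>)"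
  proof (cases "v \<in> e")
    case True
    then show ?thesis using assms(2) segment by (intro member_le_sum) auto
  next
    case False
    then show ?thesis using segment by (auto simp: closed_edge_def intro: sum_nonneg)
  qed
  moreover have "\<bar>p v - r v\<bar> \<le> \<bar>p v - q v\<bar> + \<bar>q v - r v\<bar>" by simp
  ultimately show ?case using segment.IH by (simp add: distrib_left)
qed

lemma Metric_space_path_metric:
  assumes fin: "\<forall>e\<in>E. finite e"
    and conn: "\<And>p q. p \<in> realization V E \<Longrightarrow> q \<in> realization V E \<Longrightarrow> \<exists>l. polygonal_path V E p q l"
  shows "Metric_space (realization V E) (path_metric V E)"
proof -
  have lb: "\<bar>p v - q v\<bar> / 2 \<le> l" if "polygonal_path V E p q l" for p q l v
    using polygonal_path_ge[OF that fin, of v] by simp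
  have bdd: "bdd_below {l. polygonal_path V E p q l}" for p q
    using lb by (intro bdd_belowI[of _ "\<bar>p undefined - q undefined\<bar> / 2"]) blast
  have lower: "path_metric V E p q \<le> l" if "polygonal_path V E p q l" for p q l
    using polygonal_path_mem[OF that] cInf_lower[OF _ bdd, of l p q] that
    by (simp add: path_metric_def)
  have greatest: "c \<le> path_metric V E p q"
    if pq: "p \<in> realization V E" "q \<in> realization V E"
      and c: "\<And>l. polygonal_path V E p q l \<Longrightarrow> c \<le> l" for p q c
  proof -
    have "c \<le> Inf {l. polygonal_path V E p q l}"
      by (rule cInf_greatest) (use conn[OF pq] c in blast)+
    then show ?thesis using pq by (simp add: path_metric_def)
  qed
  have ge: "\<bar>p v - q v\<bar> / 2 \<le> path_metric V E p q"
    if "p \<in> realization V E" "q \<in> realization V E" for p q v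
    by (rule greatest[OF that lb])
  have ge0: "0 \<le> path_metric V E p q"
    if "p \<in> realization V E" "q \<in> realization V E" for p q
    using order_trans[OF _ ge[OF that]] by simp
  show ?thesis
  proof
    fix p q
    show "0 \<le> path_metric V E p q"
      using ge0[of p q] by (cases "p \<in> realization V E \<and> q \<in> realization V E")
        (blast, simp only: path_metric_def if_False order_refl)
    have "polygonal_path V E p q = polygonal_path V E q p"
      using polygonal_path_sym by blast
    then show "path_metric V E p q = path_metric V E q p"
      by (auto simp: path_metric_def)
  next
    fix p q assume pq: "p \<in> realization V E" "q \<in> realization V E"
    show "path_metric V E p q = 0 \<longleftrightarrow> p = q"
    proof
      assume "path_metric V E p q = 0"
      then have "p v = q v" for v using ge[OF pq, of v] by simp
      then show "p = q" by auto
    next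
      assume "p = q"
      then have "path_metric V E p q \<le> 0"
        using lower[OF polygonal_path.trivial[OF pq(1)]] by simp
      then show "path_metric V E p q = 0" using ge0[OF pq] by linarith
    qed
  next
    fix p q r
    assume pqr: "p \<in> realization V E" "q \<in> realization V E" "r \<in> realization V E"
    have "path_metric V E p r - l \<le> l'"
      if "polygonal_path V E p q l" "polygonal_path V E q r l'" for l l'
      using lower[OF polygonal_path_trans[OF that]] by simp
    then have "path_metric V E p r - l \<le> path_metric V E q r"
      if "polygonal_path V E p q l" for l
      using that by (intro greatest pqr) blast
    then have "path_metric V E p r - path_metric V E q r \<le> l"
      if "polygonal_path V E p q l" for l
      using that by (simp add: algebra_simps)
    then have "path_metric V E p r - path_metric V E q r \<le> path_metric V E p q"
      by (intro greatest pqr)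
    then show "path_metric V E p r \<le> path_metric V E p q + path_metric V E q r" by simp
  qed
qed

lemma vertex_point_in_closed_edge: "finite e \<Longrightarrow> v \<in> e \<Longrightarrow> vertex_point v \<in> closed_edge e"
  by (auto simp: vertex_point_def closed_edge_def)

lemma (in group) Metric_space_cayley:
  assumes "A \<subseteq> carrier G" "generate G A = carrier G"
  shows "Metric_space (cayley_space G A) (cayley_dist G A)"
  unfolding cayley_space_def cayley_dist_def
proof (rule Metric_space_path_metric)
  let ?V = "carrier G" and ?E = "cayley_edges G A"
  show fin: "\<forall>e\<in>?E. finite e" by (auto simp: cayley_edges_def)
  define J where "J p q \<longleftrightarrow> (\<exists>l. polygonal_path ?V ?E p q l)" for p q
  have J_sym: "J p q \<Longrightarrow> J q p" for p q
    unfolding J_def using polygonal_path_sym by blast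
  have J_trans: "J p q \<Longrightarrow> J q r \<Longrightarrow> J p r" for p q r
    unfolding J_def using polygonal_path_trans by blast
  have J_edge: "J p q" if "e \<in> ?E" "p \<in> closed_edge e" "q \<in> closed_edge e" for p q e
    unfolding J_def using polygonal_path_segment[OF that] by blast
  have J_refl: "J p p" if "p \<in> realization ?V ?E" for p
    unfolding J_def using that polygonal_path.trivial by blast
  have J_gen: "J (vertex_point g) (vertex_point (g \<otimes> a))" if "g \<in> ?V" "a \<in> A" for g a
  proof (cases "a = \<one>")
    case True
    then show ?thesis using that J_refl by (auto simp: realization_def)
  next
    case False
    then have "{g, g \<otimes> a} \<in> ?E" using that by (auto simp: cayley_edges_def)
    then show ?thesis by (rule J_edge) (auto intro: vertex_point_in_closed_edge)
  qed
  have J_one: "J (vertex_point g) (vertex_point (g \<otimes> h))" if "h \<in> generate G A" "g \<in> ?V" for g h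
    using that
  proof (induction arbitrary: g rule: generate.induct)
    case one
    then show ?case using J_refl by (auto simp: realization_def)
  next
    case (incl h)
    then show ?case by (rule J_gen[rotated])
  next
    case (inv h)
    then have h: "h \<in> ?V" using assms by auto
    have "J (vertex_point (g \<otimes> inv h)) (vertex_point (g \<otimes> inv h \<otimes> h))"
      using inv h by (intro J_gen) auto
    then show ?case using inv.prems h by (simp add: m_assoc J_sym)
  next
    case (eng h1 h2)
    have h: "h1 \<in> ?V" "h2 \<in> ?V" using eng.hyps assms by auto
    have "J (vertex_point (g \<otimes> h1)) (vertex_point (g \<otimes> h1 \<otimes> h2))"
      using eng h by auto
    then show ?case using J_trans[OF eng.IH(1)[OF eng.prems]] h eng.prems by (simp add: m_assoc)
  qed
  have J_vertices: "J (vertex_point g) (vertex_point h)" if "g \<in> ?V" "h \<in> ?V" for g h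
    using J_one[of "inv g \<otimes> h" g] that assms by (simp add: m_assoc[symmetric])
  have J_vertex: "\<exists>g\<in>?V. J p (vertex_point g)" if p: "p \<in> realization ?V ?E" for p
  proof -
    from p consider g where "g \<in> ?V" "p = vertex_point g"
      | e where "e \<in> ?E" "p \<in> closed_edge e"
      by (auto simp: realization_def)
    then show ?thesis
    proof cases
      case 1
      then show ?thesis using J_refl[OF p] by auto
    next
      case (2 e)
      then obtain g a where "g \<in> ?V" "e = {g, g \<otimes> a}" by (auto simp: cayley_edges_def)
      then show ?thesis using 2 J_edge[OF 2(1)] by (auto intro!: bexI[of _ g] vertex_point_in_closed_edge)
    qed
  qed
  show "\<exists>l. polygonal_path ?V ?E p q l"
    if p: "p \<in> realization ?V ?E" and q: "q \<in> realization ?V ?E" for p q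
  proof -
    obtain g where g: "g \<in> ?V" "J p (vertex_point g)" using J_vertex[OF p] by blast
    obtain h where h: "h \<in> ?V" "J q (vertex_point h)" using J_vertex[OF q] by blast
    have "J p q"
      by (rule J_trans[OF g(2) J_trans[OF J_vertices[OF g(1) h(1)] J_sym[OF h(2)]]])
    then show ?thesis by (simp add: J_def)
  qed
qed

end

theory Submission
  imports Defs
begin

text \<open>The number of poles enters only through a Boolean algebra. Let \<open>H\<close> be a subgroup of \<open>G\<close>. Call a
set \<open>H\<close>-finite if finitely many cosets \<open>H x\<close> cover it, and almost invariant if each of its right
translates differs from it by an \<open>H\<close>-finite set. A pole of \<open>(G, H)\<close> ends up on one side of every
almost invariant set, two different poles are separated by such a set, and every almost invariant
set which is not \<open>H\<close>-finite contains a pole. Hence there are exactly two poles iff the almost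
invariant sets, taken modulo the \<open>H\<close>-finite ones, form an algebra with four elements
(\<open>num_poles_two_iff\<close>). This description mentions neither a generating set nor a topology, it is
visibly invariant under conjugation, and it allows to compare subgroups: if \<open>K\<close> is \<open>H\<close>-finite, then
every set that is almost invariant for \<open>K\<close> is almost invariant for \<open>H\<close>.

A Coxeter generating set provides almost invariant sets: the half-space \<open>A\<^sub>t\<close> of a reflection \<open>t\<close> is
almost invariant for the centraliser \<open>Z(t)\<close>, because \<open>w\<close> and \<open>w a\<close> lie on different sides only if
\<open>w\<^sup>-\<^sup>1 t w\<close> belongs to the finite set of reflections separating \<open>\<one>\<close> from \<open>a\<close>. If \<open>t\<close> is bipolar, then
\<open>A\<^sub>t\<close> and its complement represent the two nontrivial classes, and \<open>t\<close> exchanges them.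

Now let all reflections of \<open>S\<^sub>1\<close> be bipolar, and let \<open>r\<close> be one of them. An involution is, with
respect to \<open>S\<^sub>2\<close>, a product of reflections which commute with it and whose half-spaces it inverts
(\<open>involution_in_generate_inverted\<close>, a weak form of Richardson's theorem). As \<open>r\<close> inverts \<open>A\<^sub>r\<close>, so
does one of these reflections, say \<open>t\<close>. An element of \<open>Z(t)\<close> then lies close to the wall of \<open>r\<close>, so
\<open>Z(t)\<close> is \<open>Z(r)\<close>-finite, and the half-space of \<open>t\<close> represents one of the classes of the half-spaces
of \<open>r\<close>. The error is contained in a set that is invariant under \<open>Z(r)\<close>; hence two points far away
from it are separated by all conjugates of \<open>t\<close> under \<open>Z(r)\<close>. So these are finitely many, and
\<open>Z(r) \<inter> Z(t)\<close> has finite index in \<open>Z(r)\<close>.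

Suppose \<open>r \<noteq> t\<close>. Then \<open>f = r t\<close> is an involution, it preserves \<open>A\<^sub>r\<close>, and a subgroup of finite index
in \<open>Z(r)\<close> centralises it. By the result on involutions, applied to \<open>S\<^sub>1\<close>, there is a reflection \<open>q\<close> of
\<open>S\<^sub>1\<close> whose half-space is inverted by \<open>f\<close>, and up to finite index \<open>Z(r)\<close> is contained in \<open>Z(q)\<close>. Therefore
\<open>A\<^sub>r\<close> is almost invariant for \<open>Z(q)\<close>. It is not equivalent to a half-space of \<open>q\<close>, since \<open>f\<close> fixes the
one and inverts the other, so \<open>A\<^sub>r\<close> or its complement \<open>r A\<^sub>r\<close> is \<open>Z(q)\<close>-finite. But then finitely many
cosets of \<open>Z(q)\<close> and of \<open>Z(r q r)\<close> cover the group, which forces one of these conjugate subgroups to have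
finite index and contradicts bipolarity of \<open>q\<close> (\<open>no_fixing_involution\<close>).

So \<open>r = t\<close>, and all reflections of \<open>S\<^sub>1\<close> are reflections of \<open>S\<^sub>2\<close>. A parity argument shows that a set
of reflections of \<open>S\<^sub>2\<close> which generates the group meets every conjugacy class of \<open>S\<^sub>2\<close>
(\<open>generating_reflections\<close>); this gives the converse inclusion.\<close>

section \<open>Reflections and half-spaces of a Coxeter generating set\<close>

text \<open>The two counting lemmas compute how often a relator \<open>(s t)\<^sup>m\<close> crosses a wall: the crossed walls belong to
\<open>(s t)\<^sup>i s\<close> for \<open>i < 2 m\<close>, and this sequence has period \<open>m\<close>.\<close>

lemma odd_card_shift_two:
  fixes P :: "nat \<Rightarrow> bool"
  shows "odd (card {i. i < 2 * Suc k \<and> P i})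
      \<longleftrightarrow> ((P 0 \<noteq> P 1) \<noteq> odd (card {i. i < 2 * k \<and> P (i + 2)}))"
proof -
  let ?A = "{i::nat. i = 0 \<and> P 0}" and ?B = "{i::nat. i = 1 \<and> P 1}"
    and ?C = "(\<lambda>i. i + 2) ` {i. i < 2 * k \<and> P (i + 2)}"
  have eq: "{i. i < 2 * Suc k \<and> P i} = ?A \<union> ?B \<union> ?C"
  proof (rule Set.set_eqI)
    fix i :: nat
    consider "i = 0" | "i = 1" | j where "i = j + 2"
      using le_Suc_ex[of 2 i] by (metis add.commute less_2_cases not_le_imp_less One_nat_def)
    then show "i \<in> {i. i < 2 * Suc k \<and> P i} \<longleftrightarrow> i \<in> ?A \<union> ?B \<union> ?C"
      by cases (simp_all add: image_iff)
  qed
  have 1: "card (?A \<union> ?B) = card ?A + card ?B"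
    by (rule card_Un_disjoint) auto
  have 2: "card (?A \<union> ?B \<union> ?C) = card (?A \<union> ?B) + card ?C"
    by (rule card_Un_disjoint) auto
  have 3: "card ?A = (if P 0 then 1 else 0)" "card ?B = (if P 1 then 1 else 0)" by simp_all
  have 4: "card ?C = card {i. i < 2 * k \<and> P (i + 2)}"
    by (rule card_image) (simp add: inj_on_def)
  show ?thesis unfolding eq 2 1 3 4 by (cases "P 0"; cases "P 1") simp_all
qed

lemma even_card_periodic:
  fixes P :: "nat \<Rightarrow> bool"
  assumes P: "\<And>i. P (i + m) = P i"
  shows "even (card {i. i < 2 * m \<and> P i})"
proof -
  let ?A = "{i. i < m \<and> P i}" and ?B = "(\<lambda>i. i + m) ` {i. i < m \<and> P i}"
  have eq: "{i. i < 2 * m \<and> P i} = ?A \<union> ?B"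
  proof (rule Set.set_eqI)
    fix i :: nat
    consider "i < m" | j where "i = j + m"
      by (metis add.commute le_Suc_ex not_le_imp_less)
    then show "i \<in> {i. i < 2 * m \<and> P i} \<longleftrightarrow> i \<in> ?A \<union> ?B"
      by cases (auto simp: P image_iff)
  qed
  have 1: "card (?A \<union> ?B) = card ?A + card ?B"
    by (rule card_Un_disjoint) auto
  have 2: "card ?B = card ?A"
    by (rule card_image) (simp add: inj_on_def)
  show ?thesis unfolding eq 1 2 by simp
qed

lemma (in group) inv_cancel_left:
  assumes "x \<in> carrier G" "y \<in> carrier G"
  shows "inv x \<otimes> (x \<otimes> y) = y" "x \<otimes> (inv x \<otimes> y) = y"
  using assms by (simp_all add: m_assoc[symmetric])

lemma (in group) cancel_both:
  assumes "a \<in> carrier G" "b \<in> carrier G" "x \<in> carrier G" "y \<in> carrier G"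
  shows "a \<otimes> x \<otimes> b = a \<otimes> y \<otimes> b \<longleftrightarrow> x = y"
  using assms by simp

locale coxeter_system = group G for G :: "('a, 'b) monoid_scheme" (structure) +
  fixes S :: "'a set"
  assumes coxeter: "coxeter_generating_set G S"
begin

definition val :: "'a list \<Rightarrow> 'a" where
  "val xs = foldr (\<otimes>) xs \<one>"

text \<open>The parity of the number of times that the path from \<open>\<one>\<close> with labels \<open>xs\<close> crosses the wall of \<open>t\<close>,
that is, the parity of the number of indices \<open>i\<close> with \<open>t = x\<^sub>1 \<dots> x\<^sub>i \<dots> x\<^sub>1\<close>. The first step crosses
the wall of its label; translating the rest of the path back to \<open>\<one>\<close> conjugates \<open>t\<close> by that label.\<close>

primrec crosses :: "'a list \<Rightarrow> 'a \<Rightarrow> bool" where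
  "crosses [] t = False"
| "crosses (s # xs) t = ((t = s) \<noteq> crosses xs (s \<otimes> t \<otimes> s))"

lemma S_carrier: "S \<subseteq> carrier G" and gen_S: "generate G S = carrier G"
  using coxeter by (auto simp: coxeter_generating_set_def has_presentation_def)

lemma S_closed [simp]: "s \<in> S \<Longrightarrow> s \<in> carrier G"
  using S_carrier by auto

lemma val_simps [simp]: "val [] = \<one>" "val (x # xs) = x \<otimes> val xs"
  by (simp_all add: val_def)

lemma val_closed [simp]: "set xs \<subseteq> S \<Longrightarrow> val xs \<in> carrier G"
  by (induction xs) auto

lemma val_append: "set xs \<subseteq> S \<Longrightarrow> set ys \<subseteq> S \<Longrightarrow> val (xs @ ys) = val xs \<otimes> val ys"
  by (induction xs) (auto simp: m_assoc)

lemma relator_trivial: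
  assumes "has_presentation G S R" "r \<in> R" "set r \<subseteq> S \<times> UNIV"
  shows "word_eval G r = \<one>"
proof -
  have "word_delete S R ([] @ r @ []) ([] @ [])"
    using assms(2) by (rule word_delete.relator)
  then have "equivclp (word_delete S R) r []"
    by (metis append.left_neutral append.right_neutral r_into_equivclp)
  then show ?thesis using assms by (auto simp: has_presentation_def)
qed

lemma S_square [simp]: "s \<in> S \<Longrightarrow> s \<otimes> s = \<one>"
proof -
  assume s: "s \<in> S"
  obtain m where m: "coxeter_matrix S m" and p: "has_presentation G S (coxeter_relators S m)"
    using coxeter by (auto simp: coxeter_generating_set_def)
  have "m s s = 1" using m s by (auto simp: coxeter_matrix_def)
  then have "[(s, True), (s, True)] \<in> coxeter_relators S m"
    using s by (force simp: coxeter_relators_def)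
  from relator_trivial[OF p this] s show ?thesis by (simp add: word_eval_def)
qed

lemma S_inv [simp]: "s \<in> S \<Longrightarrow> inv s = s"
  by (simp add: inv_equality)

lemma S_cancel [simp]: "s \<in> S \<Longrightarrow> x \<in> carrier G \<Longrightarrow> s \<otimes> (s \<otimes> x) = x"
  by (simp add: m_assoc[symmetric])

lemma word_eval_val:
  "set w \<subseteq> S \<times> UNIV \<Longrightarrow> word_eval G w = val (map fst w)"
  by (induction w) (auto simp: word_eval_def val_def)

lemma val_rev: "set xs \<subseteq> S \<Longrightarrow> val (rev xs) = inv (val xs)"
  by (induction xs) (auto simp: val_append inv_mult_group)

lemma ex_word: "w \<in> carrier G \<Longrightarrow> \<exists>xs. set xs \<subseteq> S \<and> val xs = w"
proof -
  assume "w \<in> carrier G"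
  then have "w \<in> generate G S" by (simp add: gen_S)
  then show ?thesis
  proof (induction rule: generate.induct)
    case one
    show ?case by (rule exI[of _ "[]"]) simp
  next
    case (incl h)
    then show ?case by (intro exI[of _ "[h]"]) simp
  next
    case (inv h)
    then show ?case by (intro exI[of _ "[h]"]) simp
  next
    case (eng h1 h2)
    then obtain xs ys where "set xs \<subseteq> S" "val xs = h1" "set ys \<subseteq> S" "val ys = h2" by blast
    then show ?case by (intro exI[of _ "xs @ ys"]) (simp add: val_append)
  qed
qed

lemma crosses_append:
  "set xs \<subseteq> S \<Longrightarrow> set ys \<subseteq> S \<Longrightarrow> t \<in> carrier G \<Longrightarrow>
    crosses (xs @ ys) t = (crosses xs t \<noteq> crosses ys (inv (val xs) \<otimes> t \<otimes> val xs))"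
proof (induction xs arbitrary: t)
  case (Cons s xs)
  have "inv (s \<otimes> val xs) \<otimes> t \<otimes> (s \<otimes> val xs) = inv (val xs) \<otimes> (s \<otimes> t \<otimes> s) \<otimes> val xs"
    using Cons.prems by (simp add: inv_mult_group m_assoc)
  with Cons show ?case by auto
qed simp

lemma crosses_dihedral:
  assumes "s \<in> S" "t \<in> S" "x \<in> carrier G"
  shows "crosses (concat (replicate k [s, t])) x
      = odd (card {i. i < 2 * k \<and> x = (s \<otimes> t) [^] i \<otimes> s})"
  using assms(3)
proof (induction k arbitrary: x)
  case (Suc k)
  let ?c = "s \<otimes> t" and ?y = "t \<otimes> (s \<otimes> x \<otimes> s) \<otimes> t"
  have c: "?c \<in> carrier G" using assms by simp
  have shift: "?y = ?c [^] i \<otimes> s \<longleftrightarrow> x = ?c [^] (i + 2) \<otimes> s" for i :: nat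
  proof -
    have "?y = ?c [^] i \<otimes> s \<longleftrightarrow> ?c \<otimes> ?y \<otimes> (t \<otimes> s) = ?c \<otimes> (?c [^] i \<otimes> s) \<otimes> (t \<otimes> s)"
      using assms Suc.prems c by (intro cancel_both[symmetric]) auto
    also have "?c \<otimes> ?y \<otimes> (t \<otimes> s) = x"
      using assms Suc.prems by (simp add: m_assoc)
    also have "?c \<otimes> (?c [^] i \<otimes> s) \<otimes> (t \<otimes> s) = (?c \<otimes> ?c [^] i) \<otimes> ?c \<otimes> s"
      using assms by (simp add: m_assoc)
    also have "\<dots> = ?c [^] (i + 2) \<otimes> s"
      using nat_pow_Suc2[OF c, of i] by simp
    finally show ?thesis .
  qed
  have one: "(s \<otimes> x \<otimes> s = t) = (x = ?c [^] (1::nat) \<otimes> s)"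
  proof -
    have "s \<otimes> x \<otimes> s = t \<longleftrightarrow> s \<otimes> (s \<otimes> x \<otimes> s) \<otimes> s = s \<otimes> t \<otimes> s"
      using assms Suc.prems by (intro cancel_both[symmetric]) auto
    also have "s \<otimes> (s \<otimes> x \<otimes> s) \<otimes> s = x" using assms Suc.prems by (simp add: m_assoc)
    finally show ?thesis using c by simp
  qed
  have zero: "(x = s) = (x = ?c [^] (0::nat) \<otimes> s)" using assms by simp
  have IH: "crosses (concat (replicate k [s, t])) ?y
      = odd (card {i. i < 2 * k \<and> x = ?c [^] (i + 2) \<otimes> s})"
    using Suc.IH[of ?y] assms Suc.prems by (simp only: shift) simp
  have "crosses (concat (replicate (Suc k) [s, t])) x
      = ((x = s) \<noteq> ((s \<otimes> x \<otimes> s = t) \<noteq> crosses (concat (replicate k [s, t])) ?y))"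
    by simp
  also have "\<dots> = odd (card {i. i < 2 * Suc k \<and> x = ?c [^] i \<otimes> s})"
    unfolding odd_card_shift_two IH one zero by blast
  finally show ?case .
qed simp


lemma val_dihedral:
  assumes "s \<in> S" "t \<in> S"
  shows "val (concat (replicate k [s, t])) = (s \<otimes> t) [^] k"
proof (induction k)
  case (Suc k)
  then show ?case using assms nat_pow_Suc2[of "s \<otimes> t" k]
    by (simp add: m_assoc del: nat_pow_Suc)
qed simp

lemma crosses_relator:
  assumes "s \<in> S" "t \<in> S" "x \<in> carrier G" "(s \<otimes> t) [^] m = \<one>"
  shows "\<not> crosses (concat (replicate m [s, t])) x"
proof -
  let ?c = "s \<otimes> t" and ?P = "\<lambda>i::nat. x = (s \<otimes> t) [^] i \<otimes> s"
  have c: "?c \<in> carrier G" using assms by simp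
  have "?P (i + m) = ?P i" for i
    using nat_pow_mult[OF c, of i m, symmetric] assms by simp
  then show ?thesis
    using even_card_periodic[of ?P m] assms by (simp add: crosses_dihedral)
qed

lemma crosses_insert_trivial:
  assumes "set u \<subseteq> S" "set r \<subseteq> S" "set v \<subseteq> S" "t \<in> carrier G"
    and "val r = \<one>" "\<And>x. x \<in> carrier G \<Longrightarrow> \<not> crosses r x"
  shows "crosses (u @ r @ v) t = crosses (u @ v) t"
  using assms by (simp add: crosses_append)

lemma crosses_word_delete:
  assumes p: "has_presentation G S (coxeter_relators S m)"
    and del: "word_delete S (coxeter_relators S m) w w'"
    and t: "t \<in> carrier G" and w: "set w \<subseteq> S \<times> UNIV"
  shows "crosses (map fst w) t = crosses (map fst w') t"
  using del w
proof cases
  case (cancel x u b v)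
  have sub: "set (map fst u) \<subseteq> S" "set (map fst v) \<subseteq> S" using w cancel by auto
  have "\<not> crosses [x, x] y" if y: "y \<in> carrier G" for y
  proof -
    have "x \<otimes> y \<otimes> x = x \<longleftrightarrow> x \<otimes> y \<otimes> x = x \<otimes> x \<otimes> x" using cancel by simp
    also have "\<dots> \<longleftrightarrow> y = x" using cancel y by (intro cancel_both) auto
    finally show ?thesis by simp
  qed
  with crosses_insert_trivial[OF sub(1) _ sub(2) t, of "[x, x]"] cancel show ?thesis by simp
next
  case (relator r u v)
  have sub: "set (map fst u) \<subseteq> S" "set (map fst v) \<subseteq> S" using w relator by auto
  obtain s s' where ss: "s \<in> S" "s' \<in> S"
    and r: "r = concat (replicate (m s s') [(s, True), (s', True)])"
    using relator by (auto simp: coxeter_relators_def)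
  have mr: "map fst r = concat (replicate (m s s') [s, s'])"
    unfolding r by (simp add: map_concat)
  have sr: "set r \<subseteq> S \<times> UNIV" using w relator by auto
  have "val (map fst r) = \<one>"
    using relator_trivial[OF p relator(3) sr] word_eval_val[OF sr] by simp
  moreover from this have "(s \<otimes> s') [^] m s s' = \<one>"
    using val_dihedral[OF ss] by (simp add: mr)
  ultimately show ?thesis
    using crosses_insert_trivial[OF sub(1) _ sub(2) t, of "map fst r"] sr relator ss
      crosses_relator[OF ss] by (auto simp: mr)
qed

lemma word_delete_letters:
  assumes "word_delete S (coxeter_relators S m) w w'"
  shows "set w \<subseteq> S \<times> UNIV \<longleftrightarrow> set w' \<subseteq> S \<times> UNIV"
  using assms by cases (auto simp: coxeter_relators_def)

text \<open>The parity of crossings is an invariant of the group element since a relator and a cancelling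
pair cross each wall an even number of times. This step uses that all
relations of the group follow from the Coxeter relators.\<close>

lemma crosses_trivial:
  assumes xs: "set xs \<subseteq> S" "val xs = \<one>" and t: "t \<in> carrier G"
  shows "\<not> crosses xs t"
proof -
  obtain m where p: "has_presentation G S (coxeter_relators S m)"
    using coxeter by (auto simp: coxeter_generating_set_def)
  define w where "w = map (\<lambda>x. (x, True)) xs"
  have w: "set w \<subseteq> S \<times> UNIV" "map fst w = xs"
    using xs(1) by (auto simp: w_def comp_def)
  have "word_eval G w = \<one>" unfolding word_eval_val[OF w(1)] w(2) by (rule xs(2))
  then have w_null: "equivclp (word_delete S (coxeter_relators S m)) w []"
    using p w(1) by (simp add: has_presentation_def)
  have inv: "set y \<subseteq> S \<times> UNIV \<and> crosses (map fst y) t = crosses xs t"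
    if "equivclp (word_delete S (coxeter_relators S m)) w y" for y
    using that
  proof (induction rule: equivclp_induct)
    case base
    show ?case unfolding w(2) using w(1) by blast
  next
    case (step y z)
    from step(2) show ?case
    proof
      assume "word_delete S (coxeter_relators S m) y z"
      then show ?thesis
        using step(3) crosses_word_delete[OF p _ t, of y z] word_delete_letters[of m y z] by blast
    next
      assume "word_delete S (coxeter_relators S m) z y"
      then show ?thesis
        using step(3) crosses_word_delete[OF p _ t, of z y] word_delete_letters[of m z y] by blast
    qed
  qed
  show ?thesis using inv[OF w_null] by simp
qed

lemma crosses_cong:
  assumes "set xs \<subseteq> S" "set ys \<subseteq> S" "val xs = val ys" "t \<in> carrier G"
  shows "crosses xs t = crosses ys t"
proof -
  have "\<not> crosses (xs @ rev ys) t" "\<not> crosses (ys @ rev ys) t"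
    by (rule crosses_trivial; use assms in \<open>simp add: val_append val_rev\<close>)+
  then show ?thesis using assms by (simp add: crosses_append)
qed

text \<open>For a reflection \<open>t\<close> this says that the wall of \<open>t\<close> separates \<open>\<one>\<close> from \<open>w\<close> in the Cayley graph. By
  \<open>crosses_cong\<close> the choice of the word does not matter.\<close>

definition sep :: "'a \<Rightarrow> 'a \<Rightarrow> bool" where
  "sep w t \<longleftrightarrow> (\<exists>xs. set xs \<subseteq> S \<and> val xs = w \<and> crosses xs t)"

lemma sep_val: "set xs \<subseteq> S \<Longrightarrow> t \<in> carrier G \<Longrightarrow> sep (val xs) t = crosses xs t"
  unfolding sep_def using crosses_cong by blast

lemma sep_one [simp]: "t \<in> carrier G \<Longrightarrow> \<not> sep \<one> t"
  using sep_val[of "[]"] by simp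

lemma sep_S: "s \<in> S \<Longrightarrow> t \<in> carrier G \<Longrightarrow> sep s t \<longleftrightarrow> t = s"
  using sep_val[of "[s]"] by simp

text \<open>A path to \<open>u v\<close> is a path to \<open>u\<close> followed by the translate under \<open>u\<close> of a path to \<open>v\<close>. All further
properties of half-spaces come from this cocycle identity.\<close>

lemma sep_mult:
  assumes "u \<in> carrier G" "v \<in> carrier G" "t \<in> carrier G"
  shows "sep (u \<otimes> v) t = (sep u t \<noteq> sep v (inv u \<otimes> t \<otimes> u))"
proof -
  obtain xs ys where "set xs \<subseteq> S" "val xs = u" "set ys \<subseteq> S" "val ys = v"
    using ex_word assms by metis
  then show ?thesis
    using sep_val[of "xs @ ys" t] sep_val[of xs t] sep_val[of ys "inv u \<otimes> t \<otimes> u"] assms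
    by (simp add: val_append crosses_append)
qed

lemma finite_sep:
  assumes "w \<in> carrier G"
  shows "finite {t \<in> carrier G. sep w t}"
proof -
  have fin: "finite {t \<in> carrier G. crosses xs t}" if "set xs \<subseteq> S" for xs
    using that
  proof (induction xs)
    case (Cons s xs)
    have "{t \<in> carrier G. crosses (s # xs) t}
        \<subseteq> insert s ((\<lambda>t. s \<otimes> t \<otimes> s) ` {t \<in> carrier G. crosses xs t})" (is "?L \<subseteq> ?R")
    proof
      fix t assume t: "t \<in> ?L"
      then have "s \<otimes> (s \<otimes> t \<otimes> s) \<otimes> s = t" using Cons.prems by (simp add: m_assoc)
      moreover have "t = s \<or> crosses xs (s \<otimes> t \<otimes> s)" using t by auto
      ultimately show "t \<in> ?R"
        using t Cons.prems by (auto intro!: image_eqI[of _ _ "s \<otimes> t \<otimes> s"])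
    qed
    then show ?case using Cons by (auto intro: finite_subset)
  qed simp
  obtain xs where "set xs \<subseteq> S" "val xs = w" using ex_word assms by blast
  then show ?thesis using fin[of xs] sep_val[of xs] by (metis (mono_tags, lifting) Collect_cong)
qed

definition reflections :: "'a set" where
  "reflections = {g \<otimes> s \<otimes> inv g | g s. g \<in> carrier G \<and> s \<in> S}"

lemma reflectionsE:
  assumes "t \<in> reflections"
  obtains g s where "t = g \<otimes> s \<otimes> inv g" "g \<in> carrier G" "s \<in> S"
  using assms unfolding reflections_def by blast

lemma reflectionsI: "g \<in> carrier G \<Longrightarrow> s \<in> S \<Longrightarrow> g \<otimes> s \<otimes> inv g \<in> reflections"
  unfolding reflections_def by blast

lemma reflections_closed [simp]: "t \<in> reflections \<Longrightarrow> t \<in> carrier G"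
  by (elim reflectionsE) simp

lemma S_reflections: "s \<in> S \<Longrightarrow> s \<in> reflections"
  using reflectionsI[of "\<one>" s] by simp

lemma reflections_square [simp]: "t \<in> reflections \<Longrightarrow> t \<otimes> t = \<one>"
  by (elim reflectionsE) (simp add: m_assoc inv_cancel_left)

lemma reflections_conj:
  assumes "t \<in> reflections" "g \<in> carrier G"
  shows "g \<otimes> t \<otimes> inv g \<in> reflections"
  using assms(1)
proof (rule reflectionsE)
  fix h s assume hs: "t = h \<otimes> s \<otimes> inv h" "h \<in> carrier G" "s \<in> S"
  then have "g \<otimes> t \<otimes> inv g = (g \<otimes> h) \<otimes> s \<otimes> inv (g \<otimes> h)"
    using assms(2) by (simp add: m_assoc inv_mult_group)
  then show ?thesis using reflectionsI[of "g \<otimes> h" s] hs assms(2) by simp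
qed

text \<open>If the reflection \<open>t\<close> commutes with \<open>f\<close>, then \<open>f\<close> permutes the two half-spaces of \<open>t\<close>, and \<open>sep f t\<close> says that it
exchanges them. In this form the condition is invariant under conjugation.\<close>

lemma sep_conj_commute:
  assumes "f \<in> carrier G" "g \<in> carrier G" "t \<in> carrier G" "t \<otimes> f = f \<otimes> t"
  shows "sep (g \<otimes> f \<otimes> inv g) (g \<otimes> t \<otimes> inv g) = sep f t"
proof -
  let ?t = "g \<otimes> t \<otimes> inv g"
  have 1: "inv g \<otimes> ?t \<otimes> g = t" using assms by (simp add: m_assoc inv_cancel_left)
  have 2: "inv f \<otimes> t \<otimes> f = t" using assms by (simp add: m_assoc inv_cancel_left)
  have "sep (g \<otimes> (f \<otimes> inv g)) ?t = (sep g ?t \<noteq> (sep f t \<noteq> sep (inv g) t))"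
    using assms by (simp add: sep_mult 1 2)
  moreover have "sep (g \<otimes> inv g) ?t = (sep g ?t \<noteq> sep (inv g) t)"
    using assms 1 sep_mult[of g "inv g" ?t] by simp
  ultimately show ?thesis using assms by (auto simp: m_assoc)
qed

lemma sep_reflection_self:
  assumes "t \<in> reflections" shows "sep t t"
  using assms
proof (rule reflectionsE)
  fix g s assume gs: "t = g \<otimes> s \<otimes> inv g" "g \<in> carrier G" "s \<in> S"
  then show ?thesis using sep_conj_commute[of s g s] sep_S[of s s] by simp
qed

lemma sep_reflection_mult:
  assumes "t \<in> reflections" "w \<in> carrier G"
  shows "sep (t \<otimes> w) t = (\<not> sep w t)"
  using assms sep_reflection_self[OF assms(1)]
  by (simp add: sep_mult)

definition len :: "'a \<Rightarrow> nat" where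
  "len w = (LEAST n. \<exists>xs. set xs \<subseteq> S \<and> val xs = w \<and> length xs = n)"

lemma len_le:
  assumes "set xs \<subseteq> S" shows "len (val xs) \<le> length xs"
  unfolding len_def
proof (rule Least_le)
  show "\<exists>ys. set ys \<subseteq> S \<and> val ys = val xs \<and> length ys = length xs"
    using assms by (intro exI[of _ xs]) simp
qed

lemma ex_reduced:
  assumes "w \<in> carrier G"
  shows "\<exists>xs. set xs \<subseteq> S \<and> val xs = w \<and> length xs = len w"
proof -
  obtain xs where "set xs \<subseteq> S" "val xs = w" using ex_word[OF assms] by blast
  then have "\<exists>n. \<exists>xs. set xs \<subseteq> S \<and> val xs = w \<and> length xs = n" by blast
  from LeastI_ex[OF this] show ?thesis unfolding len_def .
qed

lemma len_inv:
  assumes "w \<in> carrier G" shows "len (inv w) = len w"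
proof (rule antisym)
  have le: "len (inv u) \<le> len u" if u: "u \<in> carrier G" for u
  proof -
    obtain xs where xs: "set xs \<subseteq> S" "val xs = u" "length xs = len u" using ex_reduced[OF u] by blast
    show ?thesis using len_le[of "rev xs"] xs(1) by (simp add: val_rev xs(2,3))
  qed
  show "len (inv w) \<le> len w" by (rule le[OF assms])
  show "len w \<le> len (inv w)" using le[of "inv w"] assms by simp
qed

text \<open>The exchange condition: reflecting the part of the path beyond a crossing with the wall of \<open>t\<close> gives
a path to \<open>t w\<close> in which one letter is omitted.\<close>

lemma crosses_exchange:
  "set xs \<subseteq> S \<Longrightarrow> t \<in> carrier G \<Longrightarrow> crosses xs t \<Longrightarrow>
    \<exists>ys. set ys \<subseteq> S \<and> length ys < length xs \<and> val ys = t \<otimes> val xs"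
proof (induction xs arbitrary: t)
  case (Cons s xs)
  show ?case
  proof (cases "t = s")
    case True
    then show ?thesis using Cons.prems by (intro exI[of _ xs]) auto
  next
    case False
    then have "crosses xs (s \<otimes> t \<otimes> s)" using Cons.prems by auto
    then obtain ys where "set ys \<subseteq> S" "length ys < length xs" "val ys = s \<otimes> t \<otimes> s \<otimes> val xs"
      using Cons.IH[of "s \<otimes> t \<otimes> s"] Cons.prems by auto
    then show ?thesis using Cons.prems by (intro exI[of _ "s # ys"]) (auto simp: m_assoc)
  qed
qed simp

lemma sep_len:
  assumes "w \<in> carrier G" "t \<in> carrier G" "sep w t"
  shows "len (t \<otimes> w) < len w"
proof -
  obtain xs where xs: "set xs \<subseteq> S" "val xs = w" "length xs = len w"
    using ex_reduced[OF assms(1)] by blast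
  have "crosses xs t" using sep_val[OF xs(1) assms(2)] assms(3) unfolding xs(2) by blast
  from crosses_exchange[OF xs(1) assms(2) this]
  obtain ys where ys: "set ys \<subseteq> S" "length ys < length xs" "val ys = t \<otimes> val xs" by blast
  show ?thesis using len_le[OF ys(1)] ys(2) unfolding ys(3) xs(2,3) by linarith
qed

lemma not_sep_len:
  assumes "w \<in> carrier G" "t \<in> reflections" "\<not> sep w t"
  shows "len w < len (t \<otimes> w)"
proof -
  have "sep (t \<otimes> w) t" using sep_reflection_mult[OF assms(2,1)] assms(3) by blast
  from sep_len[OF _ _ this] have "len (t \<otimes> (t \<otimes> w)) < len (t \<otimes> w)" using assms by simp
  also have "t \<otimes> (t \<otimes> w) = w" using assms by (simp flip: m_assoc)
  finally show ?thesis .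
qed

section \<open>Involutions and generating sets of reflections\<close>

text \<open>In terms of the geometric representation these are the reflections whose roots \<open>f\<close> maps to their
negatives.\<close>

definition inverted :: "'a \<Rightarrow> 'a set" where
  "inverted f = {t \<in> reflections. t \<otimes> f = f \<otimes> t \<and> sep f t}"

lemma inverted_conj:
  assumes "f \<in> carrier G" "g \<in> carrier G" "t \<in> inverted f"
  shows "g \<otimes> t \<otimes> inv g \<in> inverted (g \<otimes> f \<otimes> inv g)"
proof -
  have t: "t \<in> reflections" "t \<otimes> f = f \<otimes> t" "sep f t" using assms by (auto simp: inverted_def)
  have "(g \<otimes> t \<otimes> inv g) \<otimes> (g \<otimes> f \<otimes> inv g) = g \<otimes> (t \<otimes> f) \<otimes> inv g"
    using assms t(1) by (simp add: m_assoc inv_cancel_left)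
  also have "\<dots> = (g \<otimes> f \<otimes> inv g) \<otimes> (g \<otimes> t \<otimes> inv g)"
    unfolding t(2) using assms t(1) by (simp add: m_assoc inv_cancel_left)
  finally show ?thesis
    using assms t sep_conj_commute[of f g t] reflections_conj[of t g] by (simp add: inverted_def)
qed

text \<open>If \<open>s\<close> did not commute with \<open>f\<close>, then the wall of \<open>s\<close> would separate \<open>\<one>\<close> also from \<open>f s\<close>, and conjugating
by \<open>s\<close> would remove two letters from a reduced word of \<open>f\<close>.\<close>

lemma descent_commutes:
  assumes f: "f \<in> carrier G" "f \<otimes> f = \<one>" and s: "s \<in> S" "sep f s"
    and len: "len f \<le> len (s \<otimes> f \<otimes> s)"
  shows "s \<otimes> f = f \<otimes> s"
proof (rule ccontr)
  assume neq: "s \<otimes> f \<noteq> f \<otimes> s"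
  have inv_f: "inv f = f" using f by (simp add: inv_equality)
  have "inv f \<otimes> s \<otimes> f \<noteq> s"
  proof
    assume "inv f \<otimes> s \<otimes> f = s"
    then have "f \<otimes> (inv f \<otimes> s \<otimes> f) = f \<otimes> s" by simp
    then show False using neq f s by (simp add: m_assoc inv_cancel_left)
  qed
  then have "sep (f \<otimes> s) s" using f s by (simp add: sep_mult sep_S)
  then have "len (s \<otimes> (f \<otimes> s)) < len (f \<otimes> s)" using f s by (intro sep_len) auto
  also have "len (f \<otimes> s) = len (inv (f \<otimes> s))" using f s by (simp add: len_inv del: inv_mult_group)
  also have "inv (f \<otimes> s) = s \<otimes> f" using f s inv_f by (simp add: inv_mult_group)
  also have "len (s \<otimes> f) < len f" using f s by (intro sep_len) auto
  finally show False using len f s by (simp add: m_assoc)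
qed

lemma crosses_in_generate:
  assumes "J \<subseteq> S"
  shows "set xs \<subseteq> J \<Longrightarrow> t \<in> carrier G \<Longrightarrow> crosses xs t \<Longrightarrow> t \<in> generate G J"
proof (induction xs arbitrary: t)
  case (Cons s xs)
  have s: "s \<in> generate G J" "s \<in> S" using Cons.prems assms by (auto intro: generate.incl)
  show ?case
  proof (cases "t = s")
    case False
    then have "s \<otimes> t \<otimes> s \<in> generate G J"
      using Cons.IH[of "s \<otimes> t \<otimes> s"] Cons.prems s by simp
    from generate.eng[OF generate.eng[OF s(1) this] s(1)]
    have "s \<otimes> (s \<otimes> t \<otimes> s) \<otimes> s \<in> generate G J" .
    also have "s \<otimes> (s \<otimes> t \<otimes> s) \<otimes> s = t"
      using s(2) Cons.prems(2) by (simp add: m_assoc)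
    finally show ?thesis .
  qed (use s in simp)
qed simp

lemma ex_word_generate:
  assumes "J \<subseteq> S" "w \<in> generate G J"
  shows "\<exists>xs. set xs \<subseteq> J \<and> val xs = w"
  using assms(2)
proof (induction rule: generate.induct)
  case one
  show ?case by (rule exI[of _ "[]"]) simp
next
  case (incl h)
  then show ?case using assms by (intro exI[of _ "[h]"]) auto
next
  case (inv h)
  then show ?case using assms by (intro exI[of _ "[h]"]) auto
next
  case (eng h1 h2)
  then obtain xs ys where "set xs \<subseteq> J" "val xs = h1" "set ys \<subseteq> J" "val ys = h2" by blast
  then show ?case using assms by (intro exI[of _ "xs @ ys"]) (auto simp: val_append)
qed

lemma generate_commutes:
  assumes "J \<subseteq> carrier G" "f \<in> carrier G" "\<And>s. s \<in> J \<Longrightarrow> s \<otimes> f = f \<otimes> s" "a \<in> generate G J"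
  shows "a \<otimes> f = f \<otimes> a"
  using assms(4)
proof (induction rule: generate.induct)
  case (inv h)
  then have h: "h \<in> carrier G" "h \<otimes> f = f \<otimes> h" using assms by auto
  then have "inv h \<otimes> (h \<otimes> f) \<otimes> inv h = inv h \<otimes> (f \<otimes> h) \<otimes> inv h" by simp
  then show ?case using h(1) assms(2) by (simp add: m_assoc inv_cancel_left)
next
  case (eng h1 h2)
  then have h: "h1 \<in> carrier G" "h2 \<in> carrier G" using generate_in_carrier[OF assms(1)] by auto
  have "h1 \<otimes> h2 \<otimes> f = h1 \<otimes> (h2 \<otimes> f)" using h assms(2) by (simp add: m_assoc)
  also have "\<dots> = (h1 \<otimes> f) \<otimes> h2" unfolding eng.IH(2) using h assms(2) by (simp add: m_assoc)
  also have "\<dots> = f \<otimes> (h1 \<otimes> h2)" unfolding eng.IH(1) using h assms(2) by (simp add: m_assoc)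
  finally show ?case .
qed (use assms in auto)

text \<open>Let \<open>J\<close> be the set of left descents of \<open>f\<close>. All of them commute with \<open>f\<close>, so they are inverted, and it
remains to see that \<open>f\<close> lies in the subgroup \<open>\<langle>J\<rangle>\<close>. Take an element \<open>b\<close> of minimal length in the coset
\<open>\<langle>J\<rangle> f\<close>. A left descent \<open>s\<close> of \<open>b\<close> cannot be in \<open>J\<close>, so it is not a descent of \<open>f\<close>. Hence the
second part of a path through \<open>b\<close> to \<open>f\<close> crosses the wall of \<open>s\<close> again, and then \<open>s b\<close> is a shorter
element of the same coset. So \<open>b\<close> is trivial.\<close>

lemma conj_minimal_involution:
  assumes f: "f \<in> carrier G" "f \<otimes> f = \<one>"
    and min: "\<And>s. s \<in> S \<Longrightarrow> len f \<le> len (s \<otimes> f \<otimes> s)"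
  shows "f \<in> generate G (inverted f)"
proof -
  define J where "J = {s \<in> S. sep f s}"
  have JS: "J \<subseteq> S" by (auto simp: J_def)
  then have JG: "J \<subseteq> carrier G" by auto
  have Jf: "s \<otimes> f = f \<otimes> s" if "s \<in> J" for s
    using that descent_commutes[OF f _ _ min] by (auto simp: J_def)
  have Jinv: "J \<subseteq> inverted f" using Jf S_reflections by (auto simp: inverted_def J_def)
  note gen_closed [simp] = generate_in_carrier[OF JG]
  have comm: "x \<otimes> f = f \<otimes> x" if "x \<in> generate G J" for x
    by (rule generate_commutes[OF JG f(1) _ that]) (rule Jf)
  have "\<exists>a. a \<in> generate G J \<and> (\<forall>a'. a' \<in> generate G J \<longrightarrow> len (a \<otimes> f) \<le> len (a' \<otimes> f))"
    using ex_has_least_nat[of "\<lambda>a. a \<in> generate G J" \<one> "\<lambda>a. len (a \<otimes> f)"] generate.one by blast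
  then obtain a where a: "a \<in> generate G J"
    and amin: "\<And>a'. a' \<in> generate G J \<Longrightarrow> len (a \<otimes> f) \<le> len (a' \<otimes> f)" by blast
  define b where "b = a \<otimes> f"
  have b: "b \<in> carrier G" using a f by (simp add: b_def)
  have inv_a: "inv a \<in> generate G J" using generate_m_inv_closed[OF JG a] .
  have "b = \<one>"
  proof (rule ccontr)
    assume "b \<noteq> \<one>"
    obtain ys where ys: "set ys \<subseteq> S" "val ys = b" "length ys = len b" using ex_reduced b by blast
    then obtain s zs where s: "ys = s # zs" using \<open>b \<noteq> \<one>\<close> by (cases ys) auto
    have sS: "s \<in> S" using s ys by auto
    have "len (s \<otimes> b) < len b" using len_le[of zs] ys s by auto
    then have sb: "sep b s" using not_sep_len[of b s] b sS S_reflections by force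
    have "s \<notin> J"
    proof
      assume "s \<in> J"
      then have "s \<otimes> a \<in> generate G J" using generate.eng[OF generate.incl a] by blast
      from amin[OF this] \<open>len (s \<otimes> b) < len b\<close> show False
        using a f sS by (simp add: b_def m_assoc)
    qed
    then have "\<not> sep f s" using sS by (simp add: J_def)
    moreover have "f = b \<otimes> inv a"
      using a f comm[OF a] by (simp add: b_def m_assoc)
    ultimately have sep: "sep (inv a) (inv b \<otimes> s \<otimes> b)"
      using sep_mult[of b "inv a" s] sb a b sS by simp
    \<comment> \<open>The reflection crossed by the second part, translated back to \<open>\<one>\<close>; it lies in \<open>\<langle>J\<rangle>\<close>.\<close>
    define x where "x = inv b \<otimes> s \<otimes> b"
    have xG: "x \<in> carrier G" using b sS by (simp add: x_def)
    obtain xs where xs: "set xs \<subseteq> J" "val xs = inv a" using ex_word_generate[OF JS inv_a] by blast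
    have "crosses xs x"
      using sep sep_val[OF subset_trans[OF xs(1) JS] xG] unfolding xs(2) x_def[symmetric] by blast
    then have x: "x \<in> generate G J"
      using crosses_in_generate[OF JS xs(1) xG] by blast
    have "s \<otimes> b = b \<otimes> x" using b sS by (simp add: x_def m_assoc inv_cancel_left)
    also have "\<dots> = (a \<otimes> x) \<otimes> f"
      using a x f comm[OF x] by (simp add: b_def m_assoc)
    finally have "len (s \<otimes> b) = len ((a \<otimes> x) \<otimes> f)" by simp
    moreover have "len b \<le> len ((a \<otimes> x) \<otimes> f)"
      unfolding b_def by (rule amin) (use a x in \<open>rule generate.eng\<close>)
    ultimately show False using \<open>len (s \<otimes> b) < len b\<close> by simp
  qed
  then have "inv f = a" using a f(1) by (intro inv_equality) (simp_all add: b_def)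
  then have "f = inv a" using f(1) by (metis inv_inv)
  then have "f \<in> generate G J" using inv_a by simp
  then show ?thesis using mono_generate[OF Jinv] by blast
qed

text \<open>Richardson's theorem says that an involution is conjugate to the longest element of a finite standard
parabolic subgroup in which it is central. The weaker statement needed here follows by conjugating \<open>f\<close>
to an element whose length cannot be reduced by conjugation with a generator.\<close>

lemma involution_in_generate_inverted:
  assumes "f \<in> carrier G" "f \<otimes> f = \<one>"
  shows "f \<in> generate G (inverted f)"
  using assms
proof (induction "len f" arbitrary: f rule: less_induct)
  case less
  show ?case
  proof (cases "\<exists>s\<in>S. len (s \<otimes> f \<otimes> s) < len f")
    case True
    then obtain s where s: "s \<in> S" "len (s \<otimes> f \<otimes> s) < len f" by blast
    define f' where "f' = s \<otimes> f \<otimes> s"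
    have f': "f' \<in> carrier G" "f' \<otimes> f' = \<one>"
    proof -
      have *: "f' \<otimes> f' = s \<otimes> (f \<otimes> f) \<otimes> s" using s less.prems(1) by (simp add: f'_def m_assoc)
      then show "f' \<otimes> f' = \<one>" using s less.prems by simp
    qed (use s less in \<open>simp add: f'_def\<close>)
    have IH: "f' \<in> generate G (inverted f')" using less.hyps[of f'] s f' by (simp add: f'_def)
    have f_eq: "s \<otimes> f' \<otimes> s = f" using s less.prems(1) by (simp add: f'_def m_assoc)
    have inv_carrier: "inverted h \<subseteq> carrier G" for h by (auto simp: inverted_def)
    have "s \<otimes> a \<otimes> s \<in> generate G (inverted f)" if "a \<in> generate G (inverted f')" for a
      using that
    proof (induction rule: generate.induct)
      case one
      then show ?case using s by (simp add: generate.one)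
    next
      case (incl h)
      then show ?case using inverted_conj[OF f'(1) _ incl, of s] s f_eq by (auto intro: generate.incl)
    next
      case (inv h)
      have "inv (s \<otimes> h \<otimes> s) \<in> generate G (inverted f)"
        using inverted_conj[OF f'(1) _ inv, of s] s f_eq by (auto intro: generate.inv)
      moreover have "h \<in> carrier G" using inv inv_carrier by blast
      ultimately show ?case using s(1) by (simp add: inv_mult_group m_assoc)
    next
      case (eng h1 h2)
      have "h1 \<in> carrier G" "h2 \<in> carrier G" using eng generate_in_carrier[OF inv_carrier] by auto
      then have "s \<otimes> (h1 \<otimes> h2) \<otimes> s = (s \<otimes> h1 \<otimes> s) \<otimes> (s \<otimes> h2 \<otimes> s)"
        using s by (simp add: m_assoc)
      then show ?case using eng by (simp add: generate.eng)
    qed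
    from this[OF IH] show ?thesis by (simp add: f_eq)
  next
    case False
    then show ?thesis using less.prems by (intro conj_minimal_involution) (auto simp: not_less)
  qed
qed

lemma inverted_nonempty:
  assumes "f \<in> carrier G" "f \<otimes> f = \<one>" "f \<noteq> \<one>"
  shows "inverted f \<noteq> {}"
  using involution_in_generate_inverted[OF assms(1,2)] assms(3) generate_empty by auto

lemma separated_eq:
  assumes "w \<in> carrier G" "a \<in> carrier G" "t \<in> carrier G"
  shows "(sep w t \<noteq> sep (w \<otimes> a) t) \<longleftrightarrow> sep a (inv w \<otimes> t \<otimes> w)"
  using assms by (auto simp: sep_mult)

text \<open>The parity of the number of walls that belong to the conjugacy class of \<open>s\<close> and separate \<open>\<one>\<close> from \<open>w\<close>
is a homomorphism to \<open>\<int>/2\<close>. It vanishes on all reflections outside of this class, but not on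
\<open>s\<close>. So a generating set of reflections must meet the class.\<close>

lemma generating_reflections:
  assumes T: "T \<subseteq> reflections" "generate G T = carrier G" and s: "s \<in> S"
  shows "\<exists>t\<in>T. \<exists>g\<in>carrier G. s = g \<otimes> t \<otimes> inv g"
proof (rule ccontr)
  assume none: "\<not> ?thesis"
  define C where "C = {g \<otimes> s \<otimes> inv g | g. g \<in> carrier G}"
  have CG: "C \<subseteq> carrier G" using s by (auto simp: C_def)
  have C_conj: "g \<otimes> x \<otimes> inv g \<in> C" if xg: "x \<in> C" "g \<in> carrier G" for x g
  proof -
    obtain h where "x = h \<otimes> s \<otimes> inv h" "h \<in> carrier G" using xg(1) unfolding C_def by blast
    then have "g \<otimes> x \<otimes> inv g = (g \<otimes> h) \<otimes> s \<otimes> inv (g \<otimes> h)" "g \<otimes> h \<in> carrier G"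
      using s xg(2) by (simp_all add: m_assoc inv_mult_group)
    then show ?thesis unfolding C_def by blast
  qed
  define N where "N w = {t \<in> C. sep w t}" for w
  define odd_C where "odd_C w = odd (card (N w))" for w
  have finN: "finite (N w)" if "w \<in> carrier G" for w
    by (rule finite_subset[OF _ finite_sep[OF that]]) (use CG in \<open>auto simp: N_def\<close>)
  have mult: "odd_C (u \<otimes> v) = (odd_C u \<noteq> odd_C v)" if uv: "u \<in> carrier G" "v \<in> carrier G" for u v
  proof -
    let ?c = "\<lambda>x. u \<otimes> x \<otimes> inv u"
    have "N (u \<otimes> v) = sym_diff (N u) (?c ` N v)"
    proof (rule Set.set_eqI)
      fix t
      have "t \<in> ?c ` N v \<longleftrightarrow> t \<in> C \<and> sep v (inv u \<otimes> t \<otimes> u)"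
      proof
        assume "t \<in> ?c ` N v"
        then obtain x where x: "t = ?c x" "x \<in> C" "sep v x" by (auto simp: N_def)
        then have "inv u \<otimes> t \<otimes> u = x" using uv CG by (auto simp: m_assoc inv_cancel_left)
        then show "t \<in> C \<and> sep v (inv u \<otimes> t \<otimes> u)" using x C_conj[OF x(2) uv(1)] by simp
      next
        assume t: "t \<in> C \<and> sep v (inv u \<otimes> t \<otimes> u)"
        then have tG: "t \<in> carrier G" using CG by blast
        have "inv u \<otimes> t \<otimes> u \<in> N v" using C_conj[of t "inv u"] uv t by (simp add: N_def)
        moreover have "t = ?c (inv u \<otimes> t \<otimes> u)"
          using uv tG by (simp add: m_assoc inv_cancel_left)
        ultimately show "t \<in> ?c ` N v" by blast
      qed
      then show "t \<in> N (u \<otimes> v) \<longleftrightarrow> t \<in> sym_diff (N u) (?c ` N v)"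
        using uv CG by (cases "t \<in> C") (auto simp: N_def sep_mult)
    qed
    moreover have "card (?c ` N v) = card (N v)"
    proof (rule card_image, rule inj_onI)
      fix x y assume "x \<in> N v" "y \<in> N v" "?c x = ?c y"
      then show "x = y" using uv CG cancel_both[of u "inv u" x y] by (auto simp: N_def)
    qed
    moreover have "odd (card (sym_diff A B)) = (odd (card A) \<noteq> odd (card B))"
      if "finite A" "finite B" for A B :: "'a set"
    proof -
      have "card (sym_diff A B) = card (A - B) + card (B - A)"
        using that by (intro card_Un_disjoint) auto
      moreover have "card A = card (A \<inter> B) + card (A - B)" "card B = card (A \<inter> B) + card (B - A)"
        using that card_Int_Diff[of A B] card_Int_Diff[of B A] by (auto simp: Int_commute)
      ultimately show ?thesis by auto
    qed
    ultimately show ?thesis using finN uv by (simp add: odd_C_def)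
  qed
  have "N \<one> = {}" using CG by (auto simp: N_def)
  then have one: "\<not> odd_C \<one>" by (simp add: odd_C_def)
  have S: "odd_C x \<longleftrightarrow> x \<in> C" if "x \<in> S" for x
  proof -
    have "N x = (if x \<in> C then {x} else {})" using that CG by (auto simp: N_def sep_S)
    then show ?thesis by (simp add: odd_C_def)
  qed
  have T_even: "\<not> odd_C t" if "t \<in> T" for t
  proof -
    have "t \<in> reflections" using that T(1) by blast
    then obtain g x where gx: "t = g \<otimes> x \<otimes> inv g" "g \<in> carrier G" "x \<in> S"
      by (rule reflectionsE)
    have "x \<notin> C"
    proof
      assume "x \<in> C"
      then obtain h where h: "x = h \<otimes> s \<otimes> inv h" "h \<in> carrier G" unfolding C_def by blast
      have "s = inv (g \<otimes> h) \<otimes> t \<otimes> inv (inv (g \<otimes> h))"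
        unfolding gx(1) h(1) using h(2) gx(2) s by (simp add: m_assoc inv_mult_group inv_cancel_left)
      moreover have "inv (g \<otimes> h) \<in> carrier G" using h(2) gx(2) by simp
      ultimately show False using none that by blast
    qed
    moreover have "odd_C t = odd_C x"
      using mult[of g x] mult[of "g \<otimes> x" "inv g"] mult[of g "inv g"] gx(2,3) one
      unfolding gx(1) by auto
    ultimately show ?thesis using S[OF gx(3)] by simp
  qed
  have TG: "T \<subseteq> carrier G" using T by auto
  have "\<not> odd_C w" if "w \<in> generate G T" for w
    using that
  proof (induction rule: generate.induct)
    case (inv h)
    then show ?case using T_even[of h] mult[of h "inv h"] one TG by auto
  next
    case (eng h1 h2)
    then show ?case using mult[of h1 h2] generate_in_carrier[OF TG] by auto
  qed (use one T_even in auto)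
  moreover have "s \<in> C" unfolding C_def using s by (intro CollectI exI[of _ "\<one>"]) simp
  ultimately show False using S[OF s] s T(2) by simp
qed

end

section \<open>Almost invariant sets\<close>

context group begin

text \<open>For subgroups \<open>H \<subseteq> P\<close> this means that \<open>H\<close> has finite index in \<open>P\<close>; for
arbitrary subsets of the group it is a transitive relation. In the Cayley graph of a finite generating
set it says that \<open>P\<close> lies in a bounded neighbourhood of \<open>H\<close>.\<close>

definition finite_over :: "'a set \<Rightarrow> 'a set \<Rightarrow> bool" where
  "finite_over H P \<longleftrightarrow> (\<exists>F. finite F \<and> F \<subseteq> carrier G \<and> (\<forall>p\<in>P. \<exists>h\<in>H. \<exists>x\<in>F. p = h \<otimes> x))"

definition boundary :: "'a set \<Rightarrow> 'a \<Rightarrow> 'a set" where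
  "boundary P a = {w \<in> carrier G. (w \<in> P) \<noteq> (w \<otimes> a \<in> P)}"

definition almost_invariant :: "'a set \<Rightarrow> 'a set \<Rightarrow> bool" where
  "almost_invariant H P \<longleftrightarrow> P \<subseteq> carrier G \<and> (\<forall>a\<in>carrier G. finite_over H (boundary P a))"

text \<open>The classes of almost invariant sets modulo \<open>H\<close>-finite sets are exactly those of the empty set, the
whole group, \<open>P\<close> and its complement, and these four are different.\<close>

definition two_ended :: "'a set \<Rightarrow> bool" where
  "two_ended H \<longleftrightarrow> (\<exists>P. almost_invariant H P \<and> \<not> finite_over H P \<and> \<not> finite_over H (carrier G - P) \<and>
     (\<forall>Q. almost_invariant H Q \<longrightarrow> finite_over H Q \<or> finite_over H (carrier G - Q) \<or>
        finite_over H (sym_diff P Q) \<or> finite_over H (sym_diff P (carrier G - Q))))"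

lemma finite_overI:
  assumes "finite F" "F \<subseteq> carrier G" "\<And>p. p \<in> P \<Longrightarrow> \<exists>h\<in>H. \<exists>x\<in>F. p = h \<otimes> x"
  shows "finite_over H P"
  unfolding finite_over_def using assms by blast

lemma finite_overE:
  assumes "finite_over H P"
  obtains F where "finite F" "F \<subseteq> carrier G" "\<And>p. p \<in> P \<Longrightarrow> \<exists>h\<in>H. \<exists>x\<in>F. p = h \<otimes> x"
  using assms unfolding finite_over_def by blast

lemma finite_over_subset: "finite_over H P \<Longrightarrow> Q \<subseteq> P \<Longrightarrow> finite_over H Q"
  unfolding finite_over_def by (meson subsetD)

lemma finite_over_empty [simp]: "finite_over H {}"
  by (rule finite_overI[of "{}"]) auto

lemma finite_over_Un:
  assumes "finite_over H P" "finite_over H Q"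
  shows "finite_over H (P \<union> Q)"
proof -
  from assms(1) obtain F where F: "finite F" "F \<subseteq> carrier G"
    "\<And>p. p \<in> P \<Longrightarrow> \<exists>h\<in>H. \<exists>x\<in>F. p = h \<otimes> x" by (rule finite_overE) blast
  from assms(2) obtain F' where F': "finite F'" "F' \<subseteq> carrier G"
    "\<And>p. p \<in> Q \<Longrightarrow> \<exists>h\<in>H. \<exists>x\<in>F'. p = h \<otimes> x" by (rule finite_overE) blast
  show ?thesis
  proof (rule finite_overI[of "F \<union> F'"])
    show "\<exists>h\<in>H. \<exists>x\<in>F \<union> F'. p = h \<otimes> x" if "p \<in> P \<union> Q" for p
      using that F(3)[of p] F'(3)[of p] by blast
  qed (use F F' in auto)
qed

lemma finite_over_UN:
  assumes "finite I" "\<And>i. i \<in> I \<Longrightarrow> finite_over H (P i)"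
  shows "finite_over H (\<Union>i\<in>I. P i)"
  using assms
proof (induction I rule: finite_induct)
  case (insert i I)
  then show ?case using finite_over_Un[of H "P i" "\<Union>i\<in>I. P i"] by simp
qed simp

lemma finite_over_self: "H \<subseteq> carrier G \<Longrightarrow> finite_over H H"
  using r_one by (intro finite_overI[of "{\<one>}"]) (auto simp: subset_iff intro!: bexI)

lemma finite_over_trans:
  assumes H: "H \<subseteq> carrier G" and HK: "finite_over H K" and KP: "finite_over K P"
  shows "finite_over H P"
proof -
  from HK obtain F where F: "finite F" "F \<subseteq> carrier G"
    "\<And>p. p \<in> K \<Longrightarrow> \<exists>h\<in>H. \<exists>x\<in>F. p = h \<otimes> x" by (rule finite_overE) blast
  from KP obtain F' where F': "finite F'" "F' \<subseteq> carrier G"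
    "\<And>p. p \<in> P \<Longrightarrow> \<exists>h\<in>K. \<exists>x\<in>F'. p = h \<otimes> x" by (rule finite_overE) blast
  show ?thesis
  proof (rule finite_overI[of "(\<lambda>(x, y). x \<otimes> y) ` (F \<times> F')"])
    fix p assume "p \<in> P"
    then obtain k y where k: "k \<in> K" "y \<in> F'" "p = k \<otimes> y" using F'(3) by blast
    then obtain h x where h: "h \<in> H" "x \<in> F" "k = h \<otimes> x" using F(3) by blast
    have "p = h \<otimes> (x \<otimes> y)"
      unfolding k(3) h(3) using H F(2) F'(2) h(1,2) k(2) by (intro m_assoc) auto
    then show "\<exists>h\<in>H. \<exists>x\<in>(\<lambda>(x, y). x \<otimes> y) ` (F \<times> F'). p = h \<otimes> x"
      using h k by (intro bexI[of _ h] bexI[of _ "x \<otimes> y"]) auto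
  qed (use F F' in auto)
qed

lemma finite_over_mono:
  assumes "K \<subseteq> carrier G" "finite_over H P" "H \<subseteq> K"
  shows "finite_over K P"
  using assms unfolding finite_over_def by (meson subsetD)

lemma finite_over_right:
  assumes H: "H \<subseteq> carrier G" and P: "finite_over H P" and a: "a \<in> carrier G"
  shows "finite_over H ((\<lambda>p. p \<otimes> a) ` P)"
proof -
  have "finite_over P ((\<lambda>p. p \<otimes> a) ` P)"
    by (rule finite_overI[of "{a}"]) (use a in auto)
  with finite_over_trans[OF H P] show ?thesis .
qed

lemma finite_over_conj:
  assumes H: "H \<subseteq> carrier G" and P: "finite_over H P" and g: "g \<in> carrier G"
  shows "finite_over ((\<lambda>h. g \<otimes> h \<otimes> inv g) ` H) ((\<otimes>) g ` P)"
proof -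
  from P obtain F where F: "finite F" "F \<subseteq> carrier G"
    "\<And>p. p \<in> P \<Longrightarrow> \<exists>h\<in>H. \<exists>x\<in>F. p = h \<otimes> x" by (rule finite_overE) blast
  show ?thesis
  proof (rule finite_overI[of "(\<otimes>) g ` F"])
    fix p' assume "p' \<in> (\<otimes>) g ` P"
    then obtain p where p: "p' = g \<otimes> p" "p \<in> P" by blast
    then obtain h x where h: "h \<in> H" "x \<in> F" "p = h \<otimes> x" using F(3) by blast
    have "p' = (g \<otimes> h \<otimes> inv g) \<otimes> (g \<otimes> x)"
      unfolding p(1) h(3) using H F(2) h(1,2) g by (simp add: m_assoc inv_cancel_left subset_iff)
    then show "\<exists>h\<in>(\<lambda>h. g \<otimes> h \<otimes> inv g) ` H. \<exists>x\<in>(\<otimes>) g ` F. p' = h \<otimes> x"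
      using h by blast
  qed (use F g in auto)
qed

lemma finite_over_left:
  assumes H: "subgroup H G" and P: "finite_over H P" and g: "g \<in> H"
  shows "finite_over H ((\<otimes>) g ` P)"
proof -
  have HG: "H \<subseteq> carrier G" using H by (rule subgroup.subset)
  from finite_over_conj[OF HG P] g HG
  have "finite_over ((\<lambda>h. g \<otimes> h \<otimes> inv g) ` H) ((\<otimes>) g ` P)" by blast
  moreover have "(\<lambda>h. g \<otimes> h \<otimes> inv g) ` H \<subseteq> H"
    using H g by (auto intro: subgroup.m_closed subgroup.m_inv_closed)
  ultimately show ?thesis using finite_over_mono[OF HG] by blast
qed

text \<open>This is how finiteness over a centraliser is proved: a conjugation map \<open>g \<mapsto> g\<^sup>-\<^sup>1 t g\<close> is constant
precisely on the right cosets of \<open>Z(t)\<close>.\<close>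

lemma finite_over_fibres:
  assumes fin: "finite (f ` P)" and P: "P \<subseteq> carrier G" 
    and K: "\<And>x y. x \<in> P \<Longrightarrow> y \<in> P \<Longrightarrow> f x = f y \<Longrightarrow> x \<otimes> inv y \<in> K"
  shows "finite_over K P"
proof (rule finite_overI[of "inv_into P f ` (f ` P)"])
  show "finite (inv_into P f ` (f ` P))" using fin by (rule finite_imageI)
  show "inv_into P f ` (f ` P) \<subseteq> carrier G" using P inv_into_into[of _ f P] by blast
  fix p assume p: "p \<in> P"
  let ?y = "inv_into P f (f p)"
  have y: "?y \<in> P" "f ?y = f p"
    using inv_into_into[of "f p" f P] f_inv_into_f[of "f p" f P] p by simp_all
  have "p = (p \<otimes> inv ?y) \<otimes> ?y" using p y(1) P by (simp add: m_assoc subset_iff)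
  then show "\<exists>h\<in>K. \<exists>x\<in>inv_into P f ` (f ` P). p = h \<otimes> x"
    using K[OF p y(1) y(2)[symmetric]] p by (intro bexI[of _ "p \<otimes> inv ?y"] bexI[of _ ?y]) blast+
qed

text \<open>The case of two subgroups of B. H. Neumann's theorem on coverings by cosets. If a coset of \<open>K\<close> is not
used in the covering, then finitely many cosets of \<open>L\<close> cover it. So they cover a translate of
\<open>K\<close>, and every other coset of \<open>K\<close> can be replaced by cosets of \<open>L\<close>.\<close>

lemma two_subgroups_cover:
  assumes K: "subgroup K G" and L: "subgroup L G"
    and cov: "carrier G = P \<union> Q" "finite_over K P" "finite_over L Q"
  shows "finite_over K (carrier G) \<or> finite_over L (carrier G)"
proof (rule disjCI)
  note KG = subgroup.subset[OF K] and LG = subgroup.subset[OF L]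
  assume notL: "\<not> finite_over L (carrier G)"
  show "finite_over K (carrier G)"
  proof (rule ccontr)
    assume notK: "\<not> finite_over K (carrier G)"
    from cov(2) obtain F where F: "finite F" "F \<subseteq> carrier G"
      "\<And>p. p \<in> P \<Longrightarrow> \<exists>h\<in>K. \<exists>x\<in>F. p = h \<otimes> x" by (rule finite_overE) blast
    have "\<exists>x\<in>carrier G. \<not> (\<exists>k\<in>K. \<exists>y\<in>F. x = k \<otimes> y)"
    proof (rule ccontr)
      assume "\<not> ?thesis"
      then have "finite_over K (carrier G)" by (intro finite_overI[OF F(1,2)]) blast
      then show False using notK by contradiction
    qed
    then obtain x where x: "x \<in> carrier G" "\<And>k y. k \<in> K \<Longrightarrow> y \<in> F \<Longrightarrow> x \<noteq> k \<otimes> y"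
      by blast
    have "k \<otimes> x \<in> Q" if k: "k \<in> K" for k
    proof (rule ccontr)
      assume "k \<otimes> x \<notin> Q"
      moreover have kG: "k \<in> carrier G" using k KG by blast
      ultimately have "k \<otimes> x \<in> P" using cov(1) x(1) by blast
      then obtain h y where hy: "h \<in> K" "y \<in> F" "k \<otimes> x = h \<otimes> y" using F(3) by blast
      then have hG: "h \<in> carrier G" "y \<in> carrier G" using KG F(2) by auto
      have "x = inv k \<otimes> (k \<otimes> x)" using kG x(1) by (simp add: inv_cancel_left)
      also have "\<dots> = (inv k \<otimes> h) \<otimes> y" unfolding hy(3) using kG hG by (simp add: m_assoc)
      finally show False
        using x(2)[OF _ hy(2)] subgroup.m_closed[OF K subgroup.m_inv_closed[OF K k] hy(1)] by blast
    qed
    then have "(\<lambda>k. k \<otimes> x) ` K \<subseteq> Q" by blast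
    with cov(3) have "finite_over L ((\<lambda>k. k \<otimes> x) ` K)" by (rule finite_over_subset)
    from finite_over_right[OF LG this inv_closed[OF x(1)]]
    have "finite_over L ((\<lambda>k. k \<otimes> x \<otimes> inv x) ` K)" unfolding image_image .
    moreover have "(\<lambda>k. k \<otimes> x \<otimes> inv x) ` K = (\<lambda>k. k) ` K"
      using KG x(1) by (intro image_cong refl) (simp add: m_assoc subset_iff)
    ultimately have "finite_over L K" by simp
    then have "finite_over L (P \<union> Q)"
      using finite_over_trans[OF LG _ cov(2)] cov(3) by (intro finite_over_Un)
    then show False using notL cov(1) by simp
  qed
qed

lemma almost_invariant_subset: "almost_invariant H P \<Longrightarrow> P \<subseteq> carrier G"
  by (simp add: almost_invariant_def)

lemma almost_invariantI:
  assumes "P \<subseteq> carrier G" "\<And>a. a \<in> carrier G \<Longrightarrow> finite_over H (boundary P a)"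
  shows "almost_invariant H P"
  unfolding almost_invariant_def using assms by blast

lemma almost_invariantD:
  "almost_invariant H P \<Longrightarrow> a \<in> carrier G \<Longrightarrow> finite_over H (boundary P a)"
  unfolding almost_invariant_def by blast

lemma almost_invariant_compl:
  assumes "almost_invariant H P" shows "almost_invariant H (carrier G - P)"
proof (rule almost_invariantI)
  fix a assume a: "a \<in> carrier G"
  have "boundary (carrier G - P) a \<subseteq> boundary P a"
    using a by (auto simp: boundary_def)
  with almost_invariantD[OF assms a] show "finite_over H (boundary (carrier G - P) a)"
    by (rule finite_over_subset)
qed blast

lemma almost_invariant_Int:
  assumes P: "almost_invariant H P" and Q: "almost_invariant H Q"
  shows "almost_invariant H (P \<inter> Q)"
proof (rule almost_invariantI)
  fix a assume a: "a \<in> carrier G"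
  have "boundary (P \<inter> Q) a \<subseteq> boundary P a \<union> boundary Q a"
    by (auto simp: boundary_def)
  with finite_over_Un[OF almost_invariantD[OF P a] almost_invariantD[OF Q a]]
  show "finite_over H (boundary (P \<inter> Q) a)" by (rule finite_over_subset)
qed (use almost_invariant_subset[OF P] in blast)

lemma almost_invariant_trans:
  assumes "H \<subseteq> carrier G" "finite_over H K" "almost_invariant K P"
  shows "almost_invariant H P"
  by (rule almost_invariantI[OF almost_invariant_subset[OF assms(3)]])
    (rule finite_over_trans[OF assms(1,2) almost_invariantD[OF assms(3)]])

lemma almost_invariant_conj:
  assumes H: "H \<subseteq> carrier G" and P: "almost_invariant H P" and g: "g \<in> carrier G"
  shows "almost_invariant ((\<lambda>h. g \<otimes> h \<otimes> inv g) ` H) ((\<otimes>) g ` P)"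
proof -
  have PG: "P \<subseteq> carrier G" using P by (rule almost_invariant_subset)
  have mem: "w \<in> (\<otimes>) g ` P \<longleftrightarrow> inv g \<otimes> w \<in> P" if "w \<in> carrier G" for w
  proof
    assume "w \<in> (\<otimes>) g ` P"
    then show "inv g \<otimes> w \<in> P" using g PG by (auto simp: inv_cancel_left subset_iff)
  next
    assume "inv g \<otimes> w \<in> P"
    moreover have "w = g \<otimes> (inv g \<otimes> w)" using that g by (simp add: inv_cancel_left)
    ultimately show "w \<in> (\<otimes>) g ` P" by blast
  qed
  have "finite_over ((\<lambda>h. g \<otimes> h \<otimes> inv g) ` H) (boundary ((\<otimes>) g ` P) a)" if a: "a \<in> carrier G" for a
  proof -
    have "boundary ((\<otimes>) g ` P) a \<subseteq> (\<otimes>) g ` boundary P a"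
    proof
      fix w assume w: "w \<in> boundary ((\<otimes>) g ` P) a"
      then have wG: "w \<in> carrier G" by (simp add: boundary_def)
      then have "inv g \<otimes> w \<in> boundary P a"
        using w mem[OF wG] mem[of "w \<otimes> a"] a g by (simp add: boundary_def m_assoc)
      moreover have "w = g \<otimes> (inv g \<otimes> w)" using wG g by (simp add: inv_cancel_left)
      ultimately show "w \<in> (\<otimes>) g ` boundary P a" by blast
    qed
    with finite_over_conj[OF H almost_invariantD[OF P a] g] show ?thesis
      by (rule finite_over_subset)
  qed
  moreover have "(\<otimes>) g ` P \<subseteq> carrier G" using PG g by auto
  ultimately show ?thesis by (intro almost_invariantI)
qed

text \<open>Any nontrivial class may serve as \<open>P\<close> in the definition of \<open>two_ended\<close>: being equivalent up to
  \<open>H\<close>-finite sets is transitive, and compatible with complements. In applications \<open>A\<close> is a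
  half-space.\<close>

lemma two_ended_cases:
  assumes H: "two_ended H" and A: "almost_invariant H A" "\<not> finite_over H A" "\<not> finite_over H (carrier G - A)"
    and Q: "almost_invariant H Q"
  shows "finite_over H Q \<or> finite_over H (carrier G - Q) \<or>
        finite_over H (sym_diff A Q) \<or> finite_over H (sym_diff A (carrier G - Q))"
proof -
  obtain P where P: "\<And>Q. almost_invariant H Q \<Longrightarrow> finite_over H Q \<or> finite_over H (carrier G - Q) \<or>
        finite_over H (sym_diff P Q) \<or> finite_over H (sym_diff P (carrier G - Q))"
    and PG: "P \<subseteq> carrier G"
    using H unfolding two_ended_def almost_invariant_def by blast
  have sub: "A \<subseteq> carrier G" "Q \<subseteq> carrier G" using A Q almost_invariant_subset by auto
  have tri: "finite_over H (sym_diff X Z)"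
    if "finite_over H (sym_diff Y X)" "finite_over H (sym_diff Y Z)" for X Y Z
    by (rule finite_over_subset[OF finite_over_Un[OF that]]) blast
  have co: "sym_diff (carrier G - X) (carrier G - Z) = sym_diff X Z"
    if "X \<subseteq> carrier G" "Z \<subseteq> carrier G" for X Z using that by blast
  have co2: "sym_diff (carrier G - X) Z = sym_diff X (carrier G - Z)"
    if "X \<subseteq> carrier G" "Z \<subseteq> carrier G" for X Z using that by blast
  consider "finite_over H (sym_diff P A)" | "finite_over H (sym_diff P (carrier G - A))"
    using P[OF A(1)] A(2,3) by blast
  then show ?thesis
  proof cases
    case 1
    then show ?thesis using P[OF Q] tri[of P A Q] tri[of P A "carrier G - Q"] by blast
  next
    case 2
    then show ?thesis
      using P[OF Q] tri[of P "carrier G - A" Q] tri[of P "carrier G - A" "carrier G - Q"]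
      unfolding co[OF sub] co2[OF sub] by blast
  qed
qed

lemma two_ended_conj:
  assumes H: "H \<subseteq> carrier G" "two_ended H" and g: "g \<in> carrier G"
  shows "two_ended ((\<lambda>h. g \<otimes> h \<otimes> inv g) ` H)" (is "two_ended ?H")
proof -
  obtain P where P: "almost_invariant H P" "\<not> finite_over H P" "\<not> finite_over H (carrier G - P)"
    and cases: "\<And>Q. almost_invariant H Q \<Longrightarrow> finite_over H Q \<or> finite_over H (carrier G - Q) \<or>
        finite_over H (sym_diff P Q) \<or> finite_over H (sym_diff P (carrier G - Q))"
    using H(2) unfolding two_ended_def by blast
  have PG: "P \<subseteq> carrier G" using P(1) by (rule almost_invariant_subset)
  have H': "?H \<subseteq> carrier G" using H g by auto
  have conj_inv: "(\<lambda>h. inv g \<otimes> h \<otimes> inv (inv g)) ` ?H = H"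
  proof -
    have "inv g \<otimes> (g \<otimes> h \<otimes> inv g) \<otimes> inv (inv g) = h" if "h \<in> H" for h
      using that H g by (simp add: m_assoc inv_cancel_left subset_iff)
    then show ?thesis by (simp add: image_image)
  qed
  have left_inv: "(\<otimes>) (inv g) ` (\<otimes>) g ` X = X" "(\<otimes>) g ` (\<otimes>) (inv g) ` X = X" if "X \<subseteq> carrier G" for X
  proof -
    have "inv g \<otimes> (g \<otimes> x) = x" "g \<otimes> (inv g \<otimes> x) = x" if "x \<in> X" for x
      using that \<open>X \<subseteq> carrier G\<close> g by (simp_all add: inv_cancel_left subset_iff)
    then show "(\<otimes>) (inv g) ` (\<otimes>) g ` X = X" "(\<otimes>) g ` (\<otimes>) (inv g) ` X = X"
      by (simp_all add: image_image)
  qed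
  have fo: "finite_over ?H ((\<otimes>) g ` X) \<longleftrightarrow> finite_over H X" if "X \<subseteq> carrier G" for X
    using finite_over_conj[OF H(1) _ g, of X] finite_over_conj[OF H' _ inv_closed[OF g], of "(\<otimes>) g ` X"]
    unfolding conj_inv left_inv[OF that] by blast
  have inj: "inj_on ((\<otimes>) g) (carrier G)" using g by (simp add: inj_on_def)
  have img: "(\<otimes>) g ` carrier G = carrier G"
  proof
    show "(\<otimes>) g ` carrier G \<subseteq> carrier G" using g by auto
    have "(\<otimes>) (inv g) ` carrier G \<subseteq> carrier G" using g by auto
    from image_mono[OF this, of "(\<otimes>) g"] show "carrier G \<subseteq> (\<otimes>) g ` carrier G"
      unfolding left_inv(2)[OF subset_refl] .
  qed
  have diff: "(\<otimes>) g ` (X - Y) = (\<otimes>) g ` X - (\<otimes>) g ` Y" if "X \<subseteq> carrier G" "Y \<subseteq> carrier G" for X Y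
    using inj_on_image_set_diff[OF inj, of X Y] that by blast
  have compl: "carrier G - (\<otimes>) g ` X = (\<otimes>) g ` (carrier G - X)" if "X \<subseteq> carrier G" for X
    using diff[OF subset_refl that] unfolding img by simp
  have sd: "sym_diff ((\<otimes>) g ` X) ((\<otimes>) g ` Y) = (\<otimes>) g ` sym_diff X Y"
    if "X \<subseteq> carrier G" "Y \<subseteq> carrier G" for X Y
    using diff[OF that] diff[OF that(2,1)] by (simp add: image_Un)
  have "finite_over ?H Q \<or> finite_over ?H (carrier G - Q) \<or> finite_over ?H (sym_diff ((\<otimes>) g ` P) Q) \<or>
      finite_over ?H (sym_diff ((\<otimes>) g ` P) (carrier G - Q))" if Q: "almost_invariant ?H Q" for Q
  proof -
    define Q' where "Q' = (\<otimes>) (inv g) ` Q"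
    have QG: "Q \<subseteq> carrier G" using Q by (rule almost_invariant_subset)
    have Q': "almost_invariant H Q'"
      using almost_invariant_conj[OF H' Q inv_closed[OF g]] unfolding conj_inv Q'_def .
    have Q'G: "Q' \<subseteq> carrier G" using Q' by (rule almost_invariant_subset)
    have Q_eq: "Q = (\<otimes>) g ` Q'" using left_inv(2)[OF QG] by (simp add: Q'_def)
    have c: "carrier G - Q' \<subseteq> carrier G" by blast
    have s: "sym_diff P Q' \<subseteq> carrier G" "sym_diff P (carrier G - Q') \<subseteq> carrier G" using PG Q'G by blast+
    show ?thesis
      using cases[OF Q'] unfolding Q_eq compl[OF Q'G] sd[OF PG Q'G] sd[OF PG c]
        fo[OF Q'G] fo[OF c] fo[OF s(1)] fo[OF s(2)] .
  qed
  moreover have "\<not> finite_over ?H ((\<otimes>) g ` P)" "\<not> finite_over ?H (carrier G - (\<otimes>) g ` P)"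
    using P(2,3) fo[OF PG] fo[of "carrier G - P"] compl[OF PG] by auto
  ultimately show ?thesis
    using almost_invariant_conj[OF H(1) P(1) g] unfolding two_ended_def by blast
qed

lemma subgroup_centraliser: "s \<in> carrier G \<Longrightarrow> subgroup (centraliser G s) G"
proof (rule subgroupI)
  assume s: "s \<in> carrier G"
  show "centraliser G s \<subseteq> carrier G" by (auto simp: centraliser_def)
  show "centraliser G s \<noteq> {}" using s by (auto simp: centraliser_def intro!: exI[of _ \<one>])
  show "inv g \<in> centraliser G s" if "g \<in> centraliser G s" for g
  proof -
    have g: "g \<in> carrier G" "g \<otimes> s = s \<otimes> g" using that by (auto simp: centraliser_def)
    have "inv g \<otimes> (g \<otimes> s) \<otimes> inv g = inv g \<otimes> (s \<otimes> g) \<otimes> inv g" by (simp only: g(2))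
    then have "s \<otimes> inv g = inv g \<otimes> s" using g(1) s by (simp add: m_assoc inv_cancel_left)
    then show ?thesis using g(1) by (simp add: centraliser_def)
  qed
  show "g \<otimes> h \<in> centraliser G s" if "g \<in> centraliser G s" "h \<in> centraliser G s" for g h
  proof -
    have g: "g \<in> carrier G" "g \<otimes> s = s \<otimes> g" and h: "h \<in> carrier G" "h \<otimes> s = s \<otimes> h"
      using that by (auto simp: centraliser_def)
    have "g \<otimes> h \<otimes> s = g \<otimes> (h \<otimes> s)" using g(1) h(1) s by (simp add: m_assoc)
    also have "\<dots> = (g \<otimes> s) \<otimes> h" unfolding h(2) using g(1) h(1) s by (simp add: m_assoc)
    also have "\<dots> = s \<otimes> (g \<otimes> h)" unfolding g(2) using g(1) h(1) s by (simp add: m_assoc)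
    finally show ?thesis using g(1) h(1) by (simp add: centraliser_def)
  qed
qed

lemma centraliser_conj:
  assumes "s \<in> carrier G" "g \<in> carrier G"
  shows "centraliser G (g \<otimes> s \<otimes> inv g) = (\<lambda>h. g \<otimes> h \<otimes> inv g) ` centraliser G s"
proof -
  have sub: "(\<lambda>h. g \<otimes> h \<otimes> inv g) ` centraliser G s \<subseteq> centraliser G (g \<otimes> s \<otimes> inv g)"
    if s: "s \<in> carrier G" and g: "g \<in> carrier G" for s g
  proof
    fix x assume "x \<in> (\<lambda>h. g \<otimes> h \<otimes> inv g) ` centraliser G s"
    then obtain h where h: "x = g \<otimes> h \<otimes> inv g" "h \<in> carrier G" "h \<otimes> s = s \<otimes> h"
      by (auto simp: centraliser_def)
    have "x \<otimes> (g \<otimes> s \<otimes> inv g) = g \<otimes> (h \<otimes> s) \<otimes> inv g"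
      unfolding h(1) using h(2) s g by (simp add: m_assoc inv_cancel_left)
    also have "\<dots> = (g \<otimes> s \<otimes> inv g) \<otimes> x"
      unfolding h(1,3) using h(2) s g by (simp add: m_assoc inv_cancel_left)
    finally show "x \<in> centraliser G (g \<otimes> s \<otimes> inv g)" using h g by (simp add: centraliser_def)
  qed
  have "x \<in> (\<lambda>h. g \<otimes> h \<otimes> inv g) ` centraliser G s" if x: "x \<in> centraliser G (g \<otimes> s \<otimes> inv g)" for x
  proof -
    have xG: "x \<in> carrier G" using x by (simp add: centraliser_def)
    have "inv g \<otimes> x \<otimes> inv (inv g) \<in> centraliser G (inv g \<otimes> (g \<otimes> s \<otimes> inv g) \<otimes> inv (inv g))"
      using sub[of "g \<otimes> s \<otimes> inv g" "inv g"] assms x by auto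
    also have "inv g \<otimes> (g \<otimes> s \<otimes> inv g) \<otimes> inv (inv g) = s"
      using assms by (simp add: m_assoc inv_cancel_left)
    finally have "inv g \<otimes> x \<otimes> inv (inv g) \<in> centraliser G s" .
    moreover have "x = g \<otimes> (inv g \<otimes> x \<otimes> inv (inv g)) \<otimes> inv g"
      using assms xG by (simp add: m_assoc inv_cancel_left)
    ultimately show ?thesis by blast
  qed
  then show ?thesis using sub[OF assms] by blast
qed

end

section \<open>Reflections with two-ended centralisers\<close>

context group begin

lemma centraliserI: "g \<in> carrier G \<Longrightarrow> g \<otimes> s = s \<otimes> g \<Longrightarrow> g \<in> centraliser G s"
  by (simp add: centraliser_def)

lemma centraliserD:
  assumes "g \<in> centraliser G s" shows "g \<in> carrier G" "g \<otimes> s = s \<otimes> g"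
  using assms by (auto simp: centraliser_def)

lemma centraliser_subset: "centraliser G s \<subseteq> carrier G"
  by (auto simp: centraliser_def)

lemma conj_eq_imp_centraliser:
  assumes "x \<in> carrier G" "y \<in> carrier G" "t \<in> carrier G"
    and eq: "inv x \<otimes> t \<otimes> x = inv y \<otimes> t \<otimes> y"
  shows "x \<otimes> inv y \<in> centraliser G t"
proof (rule centraliserI)
  show "x \<otimes> inv y \<in> carrier G" using assms by simp
  have "x \<otimes> inv y \<otimes> t = x \<otimes> (inv y \<otimes> t \<otimes> y) \<otimes> inv y"
    using assms(1-3) by (simp add: m_assoc inv_cancel_left)
  also have "\<dots> = t \<otimes> (x \<otimes> inv y)"
    unfolding eq[symmetric] using assms(1-3) by (simp add: m_assoc inv_cancel_left)
  finally show "x \<otimes> inv y \<otimes> t = t \<otimes> (x \<otimes> inv y)" .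
qed

lemma conj_commuting: "g \<in> carrier G \<Longrightarrow> t \<in> carrier G \<Longrightarrow> g \<otimes> t = t \<otimes> g \<Longrightarrow> inv g \<otimes> t \<otimes> g = t"
  by (metis inv_closed inv_cancel_left(1) m_assoc)

end

context coxeter_system begin

definition half :: "'a \<Rightarrow> 'a set" where
  "half t = {w \<in> carrier G. \<not> sep w t}"

lemma half_subset: "half t \<subseteq> carrier G"
  by (auto simp: half_def)

lemma sep_left_commuting:
  assumes "t \<in> carrier G" "g \<in> centraliser G t" "w \<in> carrier G"
  shows "sep (g \<otimes> w) t = (sep g t \<noteq> sep w t)"
proof -
  note g = centraliserD[OF assms(2)]
  show ?thesis using sep_mult[OF g(1) assms(3,1)] unfolding conj_commuting[OF g(1) assms(1) g(2)] .
qed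

lemma half_swap:
  assumes "t \<in> carrier G" "g \<in> centraliser G t" "sep g t"
  shows "(\<otimes>) g ` half t = carrier G - half t"
    and "(\<otimes>) g ` (carrier G - half t) = half t"
proof -
  note g = centraliserD[OF assms(2)]
  note sep = sep_left_commuting[OF assms(1,2)]
  have inv_g: "inv g \<in> centraliser G t"
    by (rule subgroup.m_inv_closed[OF subgroup_centraliser[OF assms(1)] assms(2)])
  have "sep (inv g) t" using sep[of "inv g"] g(1) assms by simp
  note sep' = sep_left_commuting[OF assms(1) inv_g, simplified this]
  have ex: "\<exists>x\<in>carrier G. w = g \<otimes> x \<and> sep x t = (\<not> sep w t)" if "w \<in> carrier G" for w
    using that g(1) sep'[OF that] by (intro bexI[of _ "inv g \<otimes> w"]) (auto simp: inv_cancel_left)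
  show "(\<otimes>) g ` half t = carrier G - half t"
  proof (intro equalityI subsetI)
    fix w assume "w \<in> (\<otimes>) g ` half t"
    then show "w \<in> carrier G - half t" using g(1) assms(3) sep by (auto simp: half_def)
  next
    fix w assume "w \<in> carrier G - half t"
    then show "w \<in> (\<otimes>) g ` half t" using ex[of w] by (auto simp: half_def)
  qed
  show "(\<otimes>) g ` (carrier G - half t) = half t"
  proof (intro equalityI subsetI)
    fix w assume "w \<in> (\<otimes>) g ` (carrier G - half t)"
    then show "w \<in> half t" using g(1) assms(3) sep by (auto simp: half_def)
  next
    fix w assume "w \<in> half t"
    then show "w \<in> (\<otimes>) g ` (carrier G - half t)" using ex[of w] by (auto simp: half_def)
  qed
qed

text \<open>If \<open>w\<close> and \<open>w a\<close> lie on different sides of the wall of \<open>t\<close>, then \<open>w\<^sup>-\<^sup>1 t w\<close> is one of the finitely many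
reflections separating \<open>\<one>\<close> from \<open>a\<close>.\<close>

lemma half_almost_invariant:
  assumes t: "t \<in> carrier G"
  shows "almost_invariant (centraliser G t) (half t)"
proof (rule almost_invariantI[OF half_subset])
  fix a assume a: "a \<in> carrier G"
  show "finite_over (centraliser G t) (boundary (half t) a)"
  proof (rule finite_over_fibres[where f = "\<lambda>w. inv w \<otimes> t \<otimes> w"])
    have "(\<lambda>w. inv w \<otimes> t \<otimes> w) ` boundary (half t) a \<subseteq> {x \<in> carrier G. sep a x}"
    proof
      fix x assume "x \<in> (\<lambda>w. inv w \<otimes> t \<otimes> w) ` boundary (half t) a"
      then obtain w where w: "x = inv w \<otimes> t \<otimes> w" "w \<in> carrier G" "(w \<in> half t) \<noteq> (w \<otimes> a \<in> half t)"
        by (auto simp: boundary_def)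
      then have "sep w t \<noteq> sep (w \<otimes> a) t" using a by (simp add: half_def)
      then show "x \<in> {x \<in> carrier G. sep a x}" using separated_eq[OF w(2) a t] w(1,2) t by simp
    qed
    then show "finite ((\<lambda>w. inv w \<otimes> t \<otimes> w) ` boundary (half t) a)"
      using finite_sep[OF a] by (rule finite_subset)
    show "boundary (half t) a \<subseteq> carrier G" by (auto simp: boundary_def)
    show "x \<otimes> inv y \<in> centraliser G t"
      if "x \<in> boundary (half t) a" "y \<in> boundary (half t) a" "inv x \<otimes> t \<otimes> x = inv y \<otimes> t \<otimes> y" for x y
      using that t by (intro conj_eq_imp_centraliser) (auto simp: boundary_def)
  qed
qed

text \<open>An element of \<open>H\<close> maps \<open>H\<close>-finite sets to \<open>H\<close>-finite sets. If it exchanges a half-space with its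
  complement, then both or none of the two are \<open>H\<close>-finite, and together they cover the group.\<close>

lemma swapped_nontrivial:
  assumes H: "subgroup H G" "\<not> finite_over H (carrier G)" and t: "t \<in> carrier G"
    and g: "g \<in> centraliser G t" "g \<in> H" "sep g t"
  shows "\<not> finite_over H (half t)" "\<not> finite_over H (carrier G - half t)"
proof -
  have whole: "half t \<union> (carrier G - half t) = carrier G" using half_subset by blast
  have iff: "finite_over H (half t) \<longleftrightarrow> finite_over H (carrier G - half t)"
    using finite_over_left[OF H(1) _ g(2), of "half t"] finite_over_left[OF H(1) _ g(2), of "carrier G - half t"]
    unfolding half_swap[OF t g(1,3)] by blast
  then show "\<not> finite_over H (half t)" "\<not> finite_over H (carrier G - half t)"
    using finite_over_Un[of H "half t" "carrier G - half t"] H(2) unfolding whole by blast+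
qed

text \<open>The centraliser of \<open>f\<close> permutes the reflections inverted by \<open>f\<close>, and there are finitely many of them
because they all separate \<open>\<one>\<close> from \<open>f\<close>.\<close>

lemma centraliser_inverted:
  assumes f: "f \<in> carrier G" and q: "q \<in> inverted f"
  shows "finite_over (centraliser G q) (centraliser G f)"
proof (rule finite_over_fibres[where f = "\<lambda>g. inv g \<otimes> q \<otimes> g"])
  have q': "q \<in> carrier G" using q by (simp add: inverted_def)
  have "(\<lambda>g. inv g \<otimes> q \<otimes> g) ` centraliser G f \<subseteq> {t \<in> carrier G. sep f t}"
  proof
    fix x assume "x \<in> (\<lambda>g. inv g \<otimes> q \<otimes> g) ` centraliser G f"
    then obtain g where g: "x = inv g \<otimes> q \<otimes> g" "g \<in> centraliser G f" by blast
    note g' = centraliserD[OF g(2)]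
    have "inv g \<otimes> q \<otimes> inv (inv g) \<in> inverted (inv g \<otimes> f \<otimes> inv (inv g))"
      using f g' q by (intro inverted_conj) auto
    then have "x \<in> inverted f"
      using g'(1) conj_commuting[OF g'(1) f g'(2)] by (simp add: g(1))
    then show "x \<in> {t \<in> carrier G. sep f t}" by (simp add: inverted_def)
  qed
  then show "finite ((\<lambda>g. inv g \<otimes> q \<otimes> g) ` centraliser G f)"
    using finite_sep[OF f] by (rule finite_subset)
  show "centraliser G f \<subseteq> carrier G" by (rule centraliser_subset)
  show "x \<otimes> inv y \<in> centraliser G q"
    if "x \<in> centraliser G f" "y \<in> centraliser G f" "inv x \<otimes> q \<otimes> x = inv y \<otimes> q \<otimes> y" for x y
    using that q' centraliser_subset by (intro conj_eq_imp_centraliser) auto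
qed

end

lemma (in group) two_ended_not_finite:
  assumes "two_ended H" shows "\<not> finite_over H (carrier G)"
proof -
  obtain P where "P \<subseteq> carrier G" "\<not> finite_over H P"
    using assms unfolding two_ended_def almost_invariant_def by blast
  then show ?thesis using finite_over_subset by blast
qed

text \<open>Bipolarity of \<open>r\<close> alone does not exclude such an \<open>f\<close>: in \<open>D\<^sub>\<infinity> \<times> \<int>/2\<close> let \<open>r\<close> be a reflection of the
infinite dihedral factor and \<open>f\<close> the generator of the other factor. The contradiction comes from the
bipolarity of a reflection \<open>q\<close> inverted by \<open>f\<close>. In the example \<open>q = f\<close>, whose centraliser is the
whole group.\<close>

lemma (in group) no_fixing_involution:
  assumes C: "coxeter_system G S"
    and two: "\<And>q. q \<in> coxeter_system.reflections G S \<Longrightarrow> two_ended (centraliser G q)"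
    and r: "r \<in> coxeter_system.reflections G S"
    and f: "f \<in> carrier G" "f \<otimes> f = \<one>" "f \<noteq> \<one>" "f \<in> centraliser G r"
    and fix_half: "\<not> coxeter_system.sep G S f r"
    and fin: "finite_over (centraliser G f) (centraliser G r)"
  shows False
proof -
  interpret coxeter_system G S by (rule C)
  have rG: "r \<in> carrier G" and rr: "r \<otimes> r = \<one>" and rZ: "r \<in> centraliser G r"
    using r by (auto intro: centraliserI)
  obtain q where q: "q \<in> inverted f" using inverted_nonempty[OF f(1-3)] by blast
  then have q': "q \<in> reflections" "q \<otimes> f = f \<otimes> q" "sep f q" by (auto simp: inverted_def)
  have qG: "q \<in> carrier G" using q'(1) by simp
  let ?Z = "centraliser G q" and ?A = "half r" and ?B = "half q"
  have Z: "subgroup ?Z G" using qG by (rule subgroup_centraliser)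
  have fZ: "f \<in> ?Z" by (rule centraliserI[OF f(1) q'(2)[symmetric]])
  have notW: "\<not> finite_over ?Z (carrier G)" using two_ended_not_finite two[OF q'(1)] by blast
  note B = swapped_nontrivial[OF Z notW qG fZ fZ q'(3)]
  have "finite_over ?Z (centraliser G r)"
    using finite_over_trans[OF centraliser_subset centraliser_inverted[OF f(1) q] fin] .
  from almost_invariant_trans[OF centraliser_subset this half_almost_invariant[OF rG]]
  have A: "almost_invariant ?Z ?A" .
  have fA: "w \<in> carrier G \<Longrightarrow> f \<otimes> w \<in> ?A \<longleftrightarrow> w \<in> ?A" for w
    using sep_left_commuting[OF rG f(4)] fix_half f(1) by (simp add: half_def)
  have fB: "w \<in> carrier G \<Longrightarrow> f \<otimes> w \<in> ?B \<longleftrightarrow> w \<notin> ?B" for w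
    using sep_left_commuting[OF qG fZ] q'(3) f(1) by (simp add: half_def)
  have ff: "f \<otimes> (f \<otimes> w) = w" if "w \<in> carrier G" for w
    using that f(1,2) by (simp flip: m_assoc)
  \<comment> \<open>Two complementary sets \<open>B\<close> and \<open>f B\<close> cannot both be close to the same \<open>f\<close>-invariant set.\<close>
  have no_sd: False if sd: "finite_over ?Z (sym_diff ?B X)" and X: "X = ?A \<or> X = carrier G - ?A" for X
  proof -
    have fX: "w \<in> carrier G \<Longrightarrow> f \<otimes> w \<in> X \<longleftrightarrow> w \<in> X" for w
      using X fA f(1) by auto
    have "carrier G \<subseteq> sym_diff ?B X \<union> (\<otimes>) f ` sym_diff ?B X"
    proof
      fix w assume w: "w \<in> carrier G"
      show "w \<in> sym_diff ?B X \<union> (\<otimes>) f ` sym_diff ?B X"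
      proof (cases "w \<in> sym_diff ?B X")
        case False
        then have "f \<otimes> w \<in> sym_diff ?B X" using fB[OF w] fX[OF w] by blast
        then have "f \<otimes> (f \<otimes> w) \<in> (\<otimes>) f ` sym_diff ?B X" by blast
        then show ?thesis unfolding ff[OF w] by blast
      qed blast
    qed
    then show False
      using finite_over_subset finite_over_Un[OF sd finite_over_left[OF Z sd fZ]] notW by blast
  qed
  \<comment> \<open>A \<open>Z(q)\<close>-finite side of \<open>r\<close> makes the other side \<open>Z(r q r)\<close>-finite.\<close>
  have no_half: False
    if P: "finite_over ?Z P" "P = ?A \<or> P = carrier G - ?A" for P
  proof -
    have "sep r r" using r by (rule sep_reflection_self)
    note swap = half_swap[OF rG rZ this]
    have cov: "carrier G = P \<union> (\<otimes>) r ` P" using P(2) swap half_subset by auto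
    let ?L = "(\<lambda>h. r \<otimes> h \<otimes> inv r) ` ?Z"
    have L_eq: "?L = centraliser G (r \<otimes> q \<otimes> inv r)" using centraliser_conj[OF qG rG] by simp
    have L: "subgroup ?L G" unfolding L_eq using qG rG by (intro subgroup_centraliser) simp
    have "finite_over ?L ((\<otimes>) r ` P)" by (rule finite_over_conj[OF centraliser_subset P(1) rG])
    from two_subgroups_cover[OF Z L cov P(1) this] have "finite_over ?L (carrier G)" using notW by blast
    moreover have "r \<otimes> q \<otimes> inv r \<in> reflections" using q'(1) rG by (rule reflections_conj)
    ultimately show False using two_ended_not_finite[OF two] unfolding L_eq by blast
  qed
  show False
    using two_ended_cases[OF two[OF q'(1)] half_almost_invariant[OF qG] B A] no_sd no_half by blast
qed

text \<open>The proof finds a reflection \<open>t\<close> of \<open>S\<^sub>2\<close> whose centraliser is commensurable with that of \<open>r\<close>, and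
applies \<open>no_fixing_involution\<close> to \<open>r t\<close>.\<close>

lemma (in group) bipolar_reflection_compatible:
  assumes C1: "coxeter_system G S\<^sub>1" and C2: "coxeter_system G S\<^sub>2"
    and two: "\<And>q. q \<in> coxeter_system.reflections G S\<^sub>1 \<Longrightarrow> two_ended (centraliser G q)"
    and r: "r \<in> coxeter_system.reflections G S\<^sub>1"
  shows "r \<in> coxeter_system.reflections G S\<^sub>2"
proof (rule ccontr)
  assume notin: "r \<notin> coxeter_system.reflections G S\<^sub>2"
  interpret C1: coxeter_system G S\<^sub>1 by (rule C1)
  interpret C2: coxeter_system G S\<^sub>2 by (rule C2)
  have rG: "r \<in> carrier G" and rr: "r \<otimes> r = \<one>" using r by auto
  have rZ: "r \<in> centraliser G r" using rG by (intro centraliserI) simp_all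
  let ?Z = "centraliser G r" and ?A = "C1.half r"
  have Z: "subgroup ?Z G" using rG by (rule subgroup_centraliser)
  have notW: "\<not> finite_over ?Z (carrier G)" using two_ended_not_finite two[OF r] by blast
  have sep_rr: "C1.sep r r" using r by (rule C1.sep_reflection_self)
  note A = C1.swapped_nontrivial[OF Z notW rG rZ rZ sep_rr]
  have A_ai: "almost_invariant ?Z ?A" by (rule C1.half_almost_invariant[OF rG])
  have sepZ: "C1.sep (g \<otimes> w) r = (C1.sep g r \<noteq> C1.sep w r)" if "g \<in> ?Z" "w \<in> carrier G" for g w
    using C1.sep_left_commuting[OF rG that] .

  \<comment> \<open>On \<open>Z(r)\<close>, being separated from \<open>\<one>\<close> by \<open>r\<close> is a homomorphism to \<open>\<int>/2\<close> which is nontrivial at \<open>r\<close>.\<close>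
  have "\<exists>t\<in>C2.inverted r. C1.sep t r"
  proof (rule ccontr)
    assume none: "\<not> ?thesis"
    have "g \<in> ?Z \<and> \<not> C1.sep g r" if "g \<in> generate G (C2.inverted r)" for g
      using that
    proof (induction rule: generate.induct)
      case one
      then show ?case using rG by (auto intro: centraliserI)
    next
      case (incl h)
      then show ?case using none by (auto simp: C2.inverted_def intro: centraliserI)
    next
      case (inv h)
      then have "h \<in> ?Z" "\<not> C1.sep h r"
        using none by (auto simp: C2.inverted_def intro: centraliserI)
      moreover from this have "h \<in> carrier G" by (simp add: centraliserD(1))
      ultimately show ?case
        using subgroup.m_inv_closed[OF Z, of h] sepZ[of h "inv h"] rG by simp
    next
      case (eng h1 h2)
      then show ?case using subgroup.m_closed[OF Z, of h1 h2] sepZ[of h1 h2] centraliserD(1)[of h2 r] by blast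
    qed
    from this[OF C2.involution_in_generate_inverted[OF rG rr]] show False using sep_rr by blast
  qed
  then obtain t where t: "t \<in> C2.reflections" "t \<otimes> r = r \<otimes> t" "C1.sep t r"
    by (auto simp: C2.inverted_def)
  have tG: "t \<in> carrier G" and tt: "t \<otimes> t = \<one>" using t(1) by auto
  have tZ: "t \<in> ?Z" using tG t(2) by (rule centraliserI)

  \<comment> \<open>For \<open>z\<close> in \<open>Z(t)\<close> the elements \<open>z\<close> and \<open>z t = t z\<close> are on different sides of the wall of \<open>r\<close>.\<close>
  have "centraliser G t \<subseteq> boundary ?A t"
  proof
    fix z assume z: "z \<in> centraliser G t"
    note z' = centraliserD[OF z]
    have "C1.sep (z \<otimes> t) r \<longleftrightarrow> \<not> C1.sep z r" unfolding z'(2) using sepZ[OF tZ z'(1)] t(3) by simp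
    then show "z \<in> boundary ?A t" using z'(1) tG by (simp add: boundary_def C1.half_def)
  qed
  with almost_invariantD[OF A_ai tG] have Zt: "finite_over ?Z (centraliser G t)"
    by (rule finite_over_subset)

  let ?B = "C2.half t"
  have ZG: "?Z \<subseteq> carrier G" by (rule centraliser_subset)
  have ttZ: "t \<in> centraliser G t" using tG by (intro centraliserI) simp_all
  have sep_tt: "C2.sep t t" using t(1) by (rule C2.sep_reflection_self)
  have B_ai: "almost_invariant ?Z ?B"
    using almost_invariant_trans[OF ZG Zt C2.half_almost_invariant[OF tG]] .
  note B = C2.swapped_nontrivial[OF Z notW tG ttZ tZ sep_tt]
  obtain D where D: "finite_over ?Z D" "D = sym_diff ?A ?B \<or> D = sym_diff ?A (carrier G - ?B)"
    using two_ended_cases[OF two[OF r] A_ai A B_ai] B by blast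
  from D(1) obtain F where F: "finite F" "F \<subseteq> carrier G"
    "\<And>p. p \<in> D \<Longrightarrow> \<exists>h\<in>?Z. \<exists>x\<in>F. p = h \<otimes> x" by (rule finite_overE) blast
  \<comment> \<open>The error set \<open>D\<close> is enlarged to a union of right cosets of \<open>Z(r)\<close>, so that translates by \<open>Z(r)\<close> avoid it as well.\<close>
  define E where "E = {h \<otimes> x | h x. h \<in> ?Z \<and> x \<in> F}"
  have DE: "D \<subseteq> E"
  proof
    fix p assume "p \<in> D"
    from F(3)[OF this] show "p \<in> E" unfolding E_def by blast
  qed
  have E_fin: "finite_over ?Z E" by (rule finite_overI[OF F(1,2)]) (auto simp: E_def)
  have E_inv: "w \<in> E" if g: "g \<in> ?Z" and w: "w \<in> carrier G" and gw: "inv g \<otimes> w \<in> E" for g w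
  proof -
    obtain h x where h: "inv g \<otimes> w = h \<otimes> x" "h \<in> ?Z" "x \<in> F" using gw by (auto simp: E_def)
    have gG: "g \<in> carrier G" "h \<in> carrier G" "x \<in> carrier G"
      using g h(2,3) ZG F(2) by auto
    have "w = g \<otimes> (inv g \<otimes> w)" using gG w by (simp add: inv_cancel_left)
    also have "\<dots> = (g \<otimes> h) \<otimes> x" unfolding h(1) using gG by (simp add: m_assoc)
    finally show ?thesis using subgroup.m_closed[OF Z g h(2)] h(3) unfolding E_def by blast
  qed
  have "\<exists>u\<in>?A. u \<notin> E" "\<exists>v\<in>carrier G - ?A. v \<notin> E"
    using A finite_over_subset[OF E_fin] by blast+
  then obtain u v where uv: "u \<in> ?A" "u \<notin> E" "v \<in> carrier G - ?A" "v \<notin> E" by blast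
  have uG: "u \<in> carrier G" and vG: "v \<in> carrier G" using uv(1,3) C1.half_subset by auto
  have su: "\<not> C1.sep u r" and sv: "C1.sep v r" using uv(1,3) by (auto simp: C1.half_def)

  have conj_sep: "C2.sep (inv u \<otimes> v) (inv u \<otimes> (g \<otimes> t \<otimes> inv g) \<otimes> u)" if g: "g \<in> ?Z" for g
  proof -
    have gG: "g \<in> carrier G" and ig: "inv g \<in> ?Z"
      using g ZG subgroup.m_inv_closed[OF Z g] by auto
    have "inv g \<otimes> u \<notin> D" "inv g \<otimes> v \<notin> D"
      using E_inv[OF g uG] E_inv[OF g vG] uv(2,4) DE by auto
    moreover have "inv g \<otimes> u \<in> ?A \<longleftrightarrow> inv g \<otimes> v \<notin> ?A"
      using sepZ[OF ig uG] sepZ[OF ig vG] su sv gG uG vG by (auto simp: C1.half_def)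
    moreover have "inv g \<otimes> u \<in> carrier G" "inv g \<otimes> v \<in> carrier G" using gG uG vG by auto
    ultimately have "inv g \<otimes> u \<in> ?B \<longleftrightarrow> inv g \<otimes> v \<notin> ?B" using D(2) by blast
    then have "C2.sep (inv g \<otimes> u) t \<noteq> C2.sep (inv g \<otimes> v) t"
      using gG uG vG by (simp add: C2.half_def) blast
    also have "inv g \<otimes> v = (inv g \<otimes> u) \<otimes> (inv u \<otimes> v)"
      using gG uG vG by (simp add: m_assoc inv_cancel_left)
    finally have "C2.sep (inv u \<otimes> v) (inv (inv g \<otimes> u) \<otimes> t \<otimes> (inv g \<otimes> u))"
      using C2.separated_eq[of "inv g \<otimes> u" "inv u \<otimes> v" t] gG uG vG tG by simp
    also have "inv (inv g \<otimes> u) \<otimes> t \<otimes> (inv g \<otimes> u) = inv u \<otimes> (g \<otimes> t \<otimes> inv g) \<otimes> u"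
      using gG uG tG by (simp add: inv_mult_group m_assoc)
    finally show ?thesis .
  qed

  let ?f = "r \<otimes> t"
  have fG: "?f \<in> carrier G" using rG tG by simp
  have r_eq: "r \<otimes> (r \<otimes> x) = x" if "x \<in> carrier G" for x using that rG rr by (simp flip: m_assoc)
  have fin: "finite_over (centraliser G ?f) ?Z"
  proof (rule finite_over_fibres[where f = "\<lambda>g. inv g \<otimes> t \<otimes> g"])
    have "(\<lambda>g. inv g \<otimes> t \<otimes> g) ` ?Z \<subseteq> (\<lambda>x. u \<otimes> x \<otimes> inv u) ` {x \<in> carrier G. C2.sep (inv u \<otimes> v) x}"
    proof
      fix x assume "x \<in> (\<lambda>g. inv g \<otimes> t \<otimes> g) ` ?Z"
      then obtain g where g: "x = inv g \<otimes> t \<otimes> g" "g \<in> ?Z" by blast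
      have gG: "g \<in> carrier G" using g(2) ZG by auto
      have "inv u \<otimes> x \<otimes> u \<in> {x \<in> carrier G. C2.sep (inv u \<otimes> v) x}"
        using conj_sep[OF subgroup.m_inv_closed[OF Z g(2)]] gG uG tG by (simp add: g(1))
      moreover have "x = u \<otimes> (inv u \<otimes> x \<otimes> u) \<otimes> inv u"
        unfolding g(1) using gG uG tG by (simp add: m_assoc inv_cancel_left)
      ultimately show "x \<in> (\<lambda>x. u \<otimes> x \<otimes> inv u) ` {x \<in> carrier G. C2.sep (inv u \<otimes> v) x}" by blast
    qed
    moreover have "finite {x \<in> carrier G. C2.sep (inv u \<otimes> v) x}"
      using uG vG by (intro C2.finite_sep) simp
    ultimately show "finite ((\<lambda>g. inv g \<otimes> t \<otimes> g) ` ?Z)"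
      using finite_subset finite_imageI by blast
    show "?Z \<subseteq> carrier G" by (rule ZG)
    show "x \<otimes> inv y \<in> centraliser G ?f"
      if xy: "x \<in> ?Z" "y \<in> ?Z" "inv x \<otimes> t \<otimes> x = inv y \<otimes> t \<otimes> y" for x y
    proof (rule centraliserI)
      have xyG: "x \<in> carrier G" "y \<in> carrier G" using xy ZG by auto
      note zt = centraliserD[OF conj_eq_imp_centraliser[OF xyG tG xy(3)]]
      have zr: "(x \<otimes> inv y) \<otimes> r = r \<otimes> (x \<otimes> inv y)"
        using centraliserD(2) subgroup.m_closed[OF Z xy(1) subgroup.m_inv_closed[OF Z xy(2)]] by blast
      show "x \<otimes> inv y \<in> carrier G" by (rule zt(1))
      have "(x \<otimes> inv y) \<otimes> (r \<otimes> t) = ((x \<otimes> inv y) \<otimes> r) \<otimes> t" using zt(1) rG tG by (intro m_assoc[symmetric])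
      also have "\<dots> = r \<otimes> ((x \<otimes> inv y) \<otimes> t)" unfolding zr using zt(1) rG tG by (intro m_assoc)
      also have "\<dots> = (r \<otimes> t) \<otimes> (x \<otimes> inv y)" unfolding zt(2) using zt(1) rG tG by (intro m_assoc[symmetric])
      finally show "(x \<otimes> inv y) \<otimes> (r \<otimes> t) = (r \<otimes> t) \<otimes> (x \<otimes> inv y)" .
    qed
  qed
  have "?f \<otimes> ?f = r \<otimes> (t \<otimes> r) \<otimes> t" using rG tG by (simp add: m_assoc)
  also have "\<dots> = \<one>" unfolding t(2) using rG tG tt rr r_eq by simp
  finally have ff: "?f \<otimes> ?f = \<one>" .
  have f1: "?f \<noteq> \<one>"
  proof
    assume "?f = \<one>"
    then have "r \<otimes> (r \<otimes> t) = r" using rG by simp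
    then have "t = r" using r_eq[OF tG] by simp
    then show False using notin t(1) by simp
  qed
  have fZ: "?f \<in> ?Z" by (rule subgroup.m_closed[OF Z rZ tZ])
  have "\<not> C1.sep ?f r" using sepZ[OF rZ tG] sep_rr t(3) by simp
  from no_fixing_involution[OF C1 two r fG ff f1 fZ this fin] show False .
qed

section \<open>Complements of neighbourhoods of a subgroup in a Cayley graph\<close>

locale cayley_pair = group G for G :: "('a, 'b) monoid_scheme" (structure) +
  fixes A H :: "'a set"
  assumes gens: "finite_generating_set G A" and H: "subgroup H G"
begin

lemma finite_A: "finite A" and A_carrier: "A \<subseteq> carrier G" and gen_A: "generate G A = carrier G"
  using gens by (auto simp: finite_generating_set_def)

lemma A_closed [simp]: "a \<in> A \<Longrightarrow> a \<in> carrier G"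
  using A_carrier by auto

lemma H_carrier: "H \<subseteq> carrier G"
  using H by (rule subgroup.subset)

definition adj :: "'a \<Rightarrow> 'a \<Rightarrow> bool" where
  "adj g h \<longleftrightarrow> {g, h} \<in> cayley_edges G A"

lemma adj_sym: "adj g h \<Longrightarrow> adj h g"
  by (simp add: adj_def insert_commute)

lemma adj_gen: "g \<in> carrier G \<Longrightarrow> a \<in> A \<Longrightarrow> a \<noteq> \<one> \<Longrightarrow> adj g (g \<otimes> a)"
  unfolding adj_def cayley_edges_def by blast

lemma adj_cases:
  assumes "adj g h"
  obtains a where "a \<in> A" "a \<noteq> \<one>" "g \<in> carrier G" "h = g \<otimes> a"
    | a where "a \<in> A" "a \<noteq> \<one>" "h \<in> carrier G" "g = h \<otimes> a"
proof -
  obtain x a where x: "{g, h} = {x, x \<otimes> a}" "x \<in> carrier G" "a \<in> A" "a \<noteq> \<one>"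
    using assms unfolding adj_def cayley_edges_def by blast
  then have "g = x \<and> h = x \<otimes> a \<or> h = x \<and> g = x \<otimes> a" by (auto simp: doubleton_eq_iff)
  then show thesis using x that by blast
qed

lemma adj_carrier: "adj g h \<Longrightarrow> g \<in> carrier G" "adj g h \<Longrightarrow> h \<in> carrier G"
  by (auto elim!: adj_cases)

lemma adj_neq: "adj g h \<Longrightarrow> g \<noteq> h"
  by (auto elim!: adj_cases)

lemma adj_left:
  assumes "adj g h" "x \<in> carrier G" shows "adj (x \<otimes> g) (x \<otimes> h)"
  using assms(1)
proof (cases rule: adj_cases)
  case (1 a)
  then show ?thesis using adj_gen[of "x \<otimes> g" a] assms(2) by (simp add: m_assoc)
next
  case (2 a)
  then have "adj (x \<otimes> h) (x \<otimes> g)" using adj_gen[of "x \<otimes> h" a] assms(2) by (simp add: m_assoc)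
  then show ?thesis by (rule adj_sym)
qed

text \<open>The vertices at distance at most \<open>n\<close> from \<open>H\<close> in the Cayley graph.\<close>

primrec level :: "nat \<Rightarrow> 'a set" where
  "level 0 = H"
| "level (Suc n) = level n \<union> {h. \<exists>g\<in>level n. adj g h}"

lemma level_carrier: "level n \<subseteq> carrier G"
  by (induction n) (use H_carrier adj_carrier in auto)

lemma level_mono: "m \<le> n \<Longrightarrow> level m \<subseteq> level n"
  by (rule lift_Suc_mono_le[of level]) auto

lemma level_adj: "g \<in> level n \<Longrightarrow> adj g h \<Longrightarrow> h \<in> level (Suc n)"
  by auto

lemma level_left: "h \<in> H \<Longrightarrow> g \<in> level n \<Longrightarrow> h \<otimes> g \<in> level n"
proof (induction n arbitrary: g)
  case 0
  then show ?case using subgroup.m_closed[OF H] by simp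
next
  case (Suc n)
  show ?case
  proof (cases "g \<in> level n")
    case False
    then obtain g' where "g' \<in> level n" "adj g' g" using Suc.prems by auto
    then show ?thesis using Suc.IH[of g'] Suc.prems(1) H_carrier adj_left[of g' g h] by auto
  qed (use Suc in auto)
qed

lemma level_right:
  assumes "w \<in> carrier G"
  shows "\<exists>m. \<forall>g\<in>level n. g \<otimes> w \<in> level m"
proof -
  have "w \<in> generate G A" using assms by (simp add: gen_A)
  then show ?thesis
  proof (induction arbitrary: n rule: generate.induct)
    case one
    have "\<forall>g\<in>level n. g \<otimes> \<one> \<in> level n" using level_carrier[of n] by (auto simp: subset_iff)
    then show ?case by blast
  next
    case (incl a)
    have "g \<otimes> a \<in> level (Suc n)" if g: "g \<in> level n" for g
    proof (cases "a = \<one>")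
      case True
      then show ?thesis using g level_carrier[of n] by (auto simp: subset_iff)
    next
      case False
      then show ?thesis using adj_gen[of g a] incl g level_carrier by (intro level_adj[OF g]) auto
    qed
    then show ?case by blast
  next
    case (inv a)
    have "g \<otimes> inv a \<in> level (Suc n)" if g: "g \<in> level n" for g
    proof (cases "a = \<one>")
      case True
      then show ?thesis using g level_carrier[of n] by (auto simp: subset_iff)
    next
      case False
      have gG: "g \<in> carrier G" using g level_carrier by auto
      have "adj (g \<otimes> inv a) (g \<otimes> inv a \<otimes> a)" using inv gG False by (intro adj_gen) auto
      then have "adj g (g \<otimes> inv a)" using inv gG by (simp add: m_assoc adj_sym)
      then show ?thesis by (rule level_adj[OF g])
    qed
    then show ?case by blast
  next
    case (eng w1 w2)
    obtain m where m: "\<forall>g\<in>level n. g \<otimes> w1 \<in> level m" using eng.IH(1) by blast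
    obtain l where l: "\<forall>g\<in>level m. g \<otimes> w2 \<in> level l" using eng.IH(2) by blast
    have w: "w1 \<in> carrier G" "w2 \<in> carrier G" using eng.hyps gen_A by auto
    have "g \<otimes> (w1 \<otimes> w2) \<in> level l" if g: "g \<in> level n" for g
    proof -
      have "g \<otimes> w1 \<otimes> w2 \<in> level l" using g m l by blast
      then show ?thesis using g level_carrier[of n] w by (simp add: m_assoc subset_iff)
    qed
    then show ?case by blast
  qed
qed

lemma ex_level:
  assumes "g \<in> carrier G" shows "\<exists>n. g \<in> level n"
proof -
  obtain m where "\<forall>h\<in>level 0. h \<otimes> g \<in> level m" using level_right[OF assms] by blast
  then have "\<one> \<otimes> g \<in> level m" using subgroup.one_closed[OF H] by simp
  then show ?thesis using assms by auto
qed

lemma finite_over_level: "finite_over H (level n)"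
proof (induction n)
  case 0
  show ?case using finite_over_self[OF H_carrier] by simp
next
  case (Suc n)
  have sub: "level (Suc n) \<subseteq> level n \<union> (\<Union>a\<in>A. (\<lambda>g. g \<otimes> a) ` level n \<union> (\<lambda>g. g \<otimes> inv a) ` level n)"
    (is "_ \<subseteq> ?R")
  proof
    fix h assume h: "h \<in> level (Suc n)"
    show "h \<in> ?R"
    proof (cases "h \<in> level n")
      case False
      then obtain g where g: "g \<in> level n" "adj g h" using h by auto
      from g(2) show ?thesis
      proof (cases rule: adj_cases)
        case (1 a)
        then show ?thesis using g(1) by blast
      next
        case (2 a)
        then have "h = g \<otimes> inv a" by (simp add: m_assoc)
        then show ?thesis using g(1) 2(1) by blast
      qed
    qed blast
  qed
  have "finite_over H ?R"
    by (intro finite_over_Un finite_over_UN finite_A finite_over_right H_carrier Suc.IH) auto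
  then show ?case using sub by (rule finite_over_subset)
qed

lemma finite_over_iff_level:
  "finite_over H P \<longleftrightarrow> (\<exists>n. P \<subseteq> level n)"
proof
  assume "finite_over H P"
  then obtain F where F: "finite F" "F \<subseteq> carrier G"
    "\<And>p. p \<in> P \<Longrightarrow> \<exists>h\<in>H. \<exists>x\<in>F. p = h \<otimes> x" by (rule finite_overE) blast
  have "\<forall>x\<in>F. \<exists>m. \<forall>h\<in>H. h \<otimes> x \<in> level m"
    using level_right[of _ 0] F(2) by auto
  then obtain m where m: "\<And>x h. x \<in> F \<Longrightarrow> h \<in> H \<Longrightarrow> h \<otimes> x \<in> level (m x)" by metis
  have "P \<subseteq> level (Max (m ` F))"
  proof
    fix p assume "p \<in> P"
    then obtain h x where hx: "h \<in> H" "x \<in> F" "p = h \<otimes> x" using F(3) by blast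
    have "m x \<le> Max (m ` F)" using F(1) hx(2) by simp
    then show "p \<in> level (Max (m ` F))" using m[OF hx(2,1)] level_mono hx(3) by blast
  qed
  then show "\<exists>n. P \<subseteq> level n" by blast
next
  assume "\<exists>n. P \<subseteq> level n"
  then show "finite_over H P" using finite_over_subset[OF finite_over_level] by blast
qed

definition beyond :: "nat \<Rightarrow> 'a set" where
  "beyond k = carrier G - level k"

lemma beyond_mono: "k \<le> m \<Longrightarrow> beyond m \<subseteq> beyond k"
  using level_mono[of k m] by (auto simp: beyond_def)

lemma beyond_carrier: "g \<in> beyond k \<Longrightarrow> g \<in> carrier G"
  by (simp add: beyond_def)

definition locally_constant :: "nat \<Rightarrow> 'a set \<Rightarrow> bool" where
  "locally_constant k P \<longleftrightarrow> (\<forall>g h. adj g h \<longrightarrow> g \<in> beyond k \<longrightarrow> h \<in> beyond k \<longrightarrow> (g \<in> P \<longleftrightarrow> h \<in> P))"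

lemma locally_constant_mono: "locally_constant k P \<Longrightarrow> k \<le> m \<Longrightarrow> locally_constant m P"
  unfolding locally_constant_def using beyond_mono by blast

text \<open>If \<open>P\<close> does not separate neighbours outside of a neighbourhood of \<open>H\<close>, then its boundary with respect
to a generator lies in a neighbourhood of \<open>H\<close>. The boundaries for products and inverses of generators
are covered by translates of these.\<close>

lemma locally_constant_almost_invariant:
  assumes P: "P \<subseteq> carrier G" "locally_constant k P"
  shows "almost_invariant H P"
proof (rule almost_invariantI[OF P(1)])
  have gen: "finite_over H (boundary P a)" if a: "a \<in> A" for a
  proof -
    have "boundary P a \<subseteq> level (Suc k)"
    proof
      fix w assume w: "w \<in> boundary P a"
      then have wG: "w \<in> carrier G" and neq: "(w \<in> P) \<noteq> (w \<otimes> a \<in> P)" by (auto simp: boundary_def)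
      then have "a \<noteq> \<one>" by auto
      then have adj: "adj w (w \<otimes> a)" using adj_gen wG a by blast
      then have "w \<in> level k \<or> w \<otimes> a \<in> level k"
        using neq P(2) wG adj_carrier(2)[OF adj] unfolding locally_constant_def beyond_def by blast
      then show "w \<in> level (Suc k)" using level_adj[OF _ adj_sym[OF adj]] by auto
    qed
    then show ?thesis using finite_over_iff_level by blast
  qed
  fix a assume "a \<in> carrier G"
  then have "a \<in> generate G A" by (simp add: gen_A)
  then show "finite_over H (boundary P a)"
  proof (induction rule: generate.induct)
    case one
    have "boundary P \<one> = {}" by (auto simp: boundary_def)
    then show ?case by simp
  next
    case (incl a)
    then show ?case by (rule gen)
  next
    case (inv a)
    have "boundary P (inv a) \<subseteq> (\<lambda>w. w \<otimes> a) ` boundary P a"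
    proof
      fix w assume "w \<in> boundary P (inv a)"
      then have w: "w \<in> carrier G" "(w \<in> P) \<noteq> (w \<otimes> inv a \<in> P)" by (auto simp: boundary_def)
      then have "w = (w \<otimes> inv a) \<otimes> a" "w \<otimes> inv a \<in> boundary P a"
        using inv by (auto simp: boundary_def m_assoc)
      then show "w \<in> (\<lambda>w. w \<otimes> a) ` boundary P a" by blast
    qed
    moreover have "finite_over H ((\<lambda>w. w \<otimes> a) ` boundary P a)"
      by (rule finite_over_right[OF H_carrier gen[OF inv]]) (use inv in simp)
    ultimately show ?case using finite_over_subset by blast
  next
    case (eng a b)
    have ab: "a \<in> carrier G" "b \<in> carrier G" using eng.hyps gen_A by auto
    have "boundary P (a \<otimes> b) \<subseteq> boundary P a \<union> (\<lambda>w. w \<otimes> inv a) ` boundary P b"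
    proof
      fix w assume "w \<in> boundary P (a \<otimes> b)"
      then have w: "w \<in> carrier G" "(w \<in> P) \<noteq> (w \<otimes> a \<otimes> b \<in> P)"
        using ab by (auto simp: boundary_def m_assoc)
      show "w \<in> boundary P a \<union> (\<lambda>w. w \<otimes> inv a) ` boundary P b"
      proof (cases "w \<in> boundary P a")
        case False
        then have "w \<otimes> a \<in> boundary P b" using w ab by (auto simp: boundary_def)
        moreover have "w = (w \<otimes> a) \<otimes> inv a" using w(1) ab by (simp add: m_assoc)
        ultimately show ?thesis by blast
      qed blast
    qed
    moreover have "finite_over H (boundary P a \<union> (\<lambda>w. w \<otimes> inv a) ` boundary P b)"
      using ab by (intro finite_over_Un finite_over_right H_carrier eng.IH) auto
    ultimately show ?case using finite_over_subset by blast
  qed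
qed

lemma almost_invariant_locally_constant:
  assumes P: "almost_invariant H P"
  shows "\<exists>k. locally_constant k P"
proof -
  have "\<forall>a\<in>A. \<exists>n. boundary P a \<subseteq> level n"
    using almost_invariantD[OF P] finite_over_iff_level by auto
  then obtain n where n: "\<And>a. a \<in> A \<Longrightarrow> boundary P a \<subseteq> level (n a)" by metis
  let ?k = "Max (n ` A)"
  have k: "boundary P a \<subseteq> level ?k" if "a \<in> A" for a
  proof -
    have "n a \<le> ?k" using finite_A that by simp
    then show ?thesis using n[OF that] level_mono by blast
  qed
  have *: "g \<in> P \<longleftrightarrow> g \<otimes> a \<in> P" if "a \<in> A" "g \<in> beyond ?k" for g a
    using k[OF that(1)] that(2) by (auto simp: beyond_def boundary_def)
  have "locally_constant ?k P"
    unfolding locally_constant_def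
  proof (intro allI impI)
    fix g h assume "adj g h" and b: "g \<in> beyond ?k" "h \<in> beyond ?k"
    then show "g \<in> P \<longleftrightarrow> h \<in> P"
      by (cases rule: adj_cases) (use *[OF _ b(1)] *[OF _ b(2)] in blast)+
  qed
  then show ?thesis by blast
qed

definition link :: "nat \<Rightarrow> ('a \<times> 'a) set" where
  "link k = {(g, h). g \<in> beyond k \<and> h \<in> beyond k \<and> adj g h}"

text \<open>For \<open>g\<close> outside of the \<open>k\<close>-neighbourhood of \<open>H\<close>, the connected component of \<open>g\<close> in the subgraph spanned by
the vertices outside of this neighbourhood.\<close>

definition cluster :: "nat \<Rightarrow> 'a \<Rightarrow> 'a set" where
  "cluster k g = (link k)\<^sup>* `` {g}"

lemma link_sym: "sym (link k)"
  by (auto simp: sym_def link_def adj_sym)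

lemma cluster_refl: "g \<in> cluster k g"
  by (simp add: cluster_def)

lemma cluster_eq: "h \<in> cluster k g \<Longrightarrow> cluster k h = cluster k g"
proof -
  assume "h \<in> cluster k g"
  then have gh: "(g, h) \<in> (link k)\<^sup>*" by (simp add: cluster_def)
  then have hg: "(h, g) \<in> (link k)\<^sup>*" using sym_rtrancl[OF link_sym] by (rule symD[rotated])
  show ?thesis unfolding cluster_def using rtrancl_trans[OF gh] rtrancl_trans[OF hg] by blast
qed

lemma cluster_step: "h \<in> cluster k g \<Longrightarrow> adj h h' \<Longrightarrow> h \<in> beyond k \<Longrightarrow> h' \<in> beyond k \<Longrightarrow> h' \<in> cluster k g"
  unfolding cluster_def link_def by (auto intro: rtrancl_into_rtrancl)

lemma cluster_induct [consumes 1, case_names refl step]: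
  assumes "h \<in> cluster k g" "Q g"
    and "\<And>x y. x \<in> cluster k g \<Longrightarrow> x \<in> beyond k \<Longrightarrow> y \<in> beyond k \<Longrightarrow> adj x y \<Longrightarrow> Q x \<Longrightarrow> Q y"
  shows "Q h"
proof -
  have "(g, h) \<in> (link k)\<^sup>*" using assms(1) by (simp add: cluster_def)
  then show ?thesis
  proof (induction rule: rtrancl_induct)
    case (step y z)
    then show ?case using assms(3)[of y z] by (auto simp: cluster_def link_def)
  qed (rule assms(2))
qed

lemma cluster_beyond: "g \<in> beyond k \<Longrightarrow> cluster k g \<subseteq> beyond k"
proof
  fix h assume "h \<in> cluster k g" "g \<in> beyond k"
  then show "h \<in> beyond k" by (induction rule: cluster_induct)
qed

lemma cluster_mono: "k \<le> m \<Longrightarrow> cluster m g \<subseteq> cluster k g"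
proof
  fix h assume "h \<in> cluster m g" "k \<le> m"
  then show "h \<in> cluster k g"
  proof (induction rule: cluster_induct)
    case refl
    show ?case by (rule cluster_refl)
  next
    case (step x y)
    then show ?case using cluster_step[of x k g y] beyond_mono[of k m] by blast
  qed
qed

lemma cluster_constant:
  assumes "locally_constant k P" "h \<in> cluster k g"
  shows "h \<in> P \<longleftrightarrow> g \<in> P"
  using assms(2)
proof (induction rule: cluster_induct)
  case (step x y)
  then show ?case using assms(1) unfolding locally_constant_def by blast
qed simp

lemma cluster_almost_invariant:
  assumes "g \<in> beyond k" shows "almost_invariant H (cluster k g)"
proof (rule locally_constant_almost_invariant)
  show "cluster k g \<subseteq> carrier G" using cluster_beyond[OF assms] beyond_carrier by blast
  show "locally_constant k (cluster k g)"
    unfolding locally_constant_def using cluster_step adj_sym by blast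
qed

lemma cluster_left:
  assumes x: "x \<in> H" and y: "y \<in> cluster k g" shows "x \<otimes> y \<in> cluster k (x \<otimes> g)"
  using y
proof (induction rule: cluster_induct)
  case refl
  show ?case by (rule cluster_refl)
next
  case (step y z)
  have xG: "x \<in> carrier G" using x H_carrier by blast
  have "x \<otimes> w \<in> beyond k" if w: "w \<in> beyond k" for w
  proof -
    have wG: "w \<in> carrier G" using w by (rule beyond_carrier)
    have "inv x \<otimes> (x \<otimes> w) = w" using xG wG by (simp add: inv_cancel_left)
    then have "x \<otimes> w \<notin> level k"
      using level_left[OF subgroup.m_inv_closed[OF H x], of "x \<otimes> w" k] w by (auto simp: beyond_def)
    then show ?thesis using xG wG by (simp add: beyond_def)
  qed
  then show ?case using cluster_step[OF step(5) adj_left[OF step(4) xG]] step(2,3) by blast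
qed

text \<open>A shortest path from \<open>g\<close> to \<open>H\<close> passes a vertex at distance \<open>k + 1\<close> from \<open>H\<close>, and up to there it
stays outside of the \<open>k\<close>-neighbourhood.\<close>

lemma cluster_meets_level:
  assumes "g \<in> beyond k"
  shows "\<exists>b\<in>cluster k g. b \<in> level (Suc k)"
proof -
  obtain n where "g \<in> level n" using ex_level[OF beyond_carrier[OF assms]] by blast
  then show ?thesis using assms
  proof (induction n arbitrary: g)
    case 0
    then have "g \<in> level k" using level_mono[of 0 k] by auto
    then show ?case using 0 by (simp add: beyond_def)
  next
    case (Suc n)
    show ?case
    proof (cases "g \<in> level (Suc k)")
      case True
      then show ?thesis using cluster_refl by blast
    next
      case False
      show ?thesis
      proof (cases "g \<in> level n")
        case True
        then show ?thesis using Suc by blast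
      next
        case notn: False
        then obtain h where h: "h \<in> level n" "adj h g" using Suc.prems(1) by auto
        have "h \<notin> level k" using False level_adj[OF _ h(2)] by blast
        then have hb: "h \<in> beyond k" using adj_carrier(1)[OF h(2)] by (simp add: beyond_def)
        then have "h \<in> cluster k g"
          using cluster_step[OF cluster_refl adj_sym[OF h(2)] Suc.prems(2)] by blast
        then show ?thesis using Suc.IH[OF h(1) hb] cluster_eq by blast
      qed
    qed
  qed
qed

text \<open>For large \<open>m\<close>, the set \<open>Q\<close> is outside of the \<open>m\<close>-neighbourhood a union of components. Up to the action
of \<open>H\<close> there are only finitely many components, since each of them meets the level \<open>m + 1\<close>, which is
\<open>H\<close>-finite. So if all components in \<open>Q\<close> were \<open>H\<close>-finite, they would lie in a common neighbourhood
of \<open>H\<close>.\<close>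

lemma ex_deep_cluster:
  assumes Q: "almost_invariant H Q" "\<not> finite_over H Q"
  shows "\<exists>g\<in>beyond k. \<not> finite_over H (cluster k g \<inter> Q)"
proof -
  obtain m0 where "locally_constant m0 Q" using almost_invariant_locally_constant[OF Q(1)] by blast
  then have lc: "locally_constant (max k m0) Q" by (rule locally_constant_mono) simp
  define m where "m = max k m0"
  have QG: "Q \<subseteq> carrier G" using Q(1) by (rule almost_invariant_subset)
  have "\<exists>g\<in>beyond m \<inter> Q. \<not> finite_over H (cluster m g)"
  proof (rule ccontr)
    assume none: "\<not> ?thesis"
    from finite_over_level obtain F where F: "finite F" "F \<subseteq> carrier G"
      "\<And>p. p \<in> level (Suc m) \<Longrightarrow> \<exists>h\<in>H. \<exists>x\<in>F. p = h \<otimes> x" by (rule finite_overE) blast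
    define F' where "F' = {b \<in> F. finite_over H (cluster m b)}"
    have "Q \<subseteq> level m \<union> (\<Union>b\<in>F'. {h \<otimes> y | h y. h \<in> H \<and> y \<in> cluster m b})" (is "_ \<subseteq> _ \<union> ?U")
    proof
      fix g assume g: "g \<in> Q"
      show "g \<in> level m \<union> ?U"
      proof (cases "g \<in> level m")
        case False
        then have gb: "g \<in> beyond m" using g QG by (auto simp: beyond_def)
        obtain b where b: "b \<in> cluster m g" "b \<in> level (Suc m)" using cluster_meets_level[OF gb] by blast
        obtain h x where hx: "h \<in> H" "x \<in> F" "b = h \<otimes> x" using F(3)[OF b(2)] by blast
        have hG: "h \<in> carrier G" and xG: "x \<in> carrier G" using hx H_carrier F(2) by auto
        have ih: "inv h \<in> H" by (rule subgroup.m_inv_closed[OF H hx(1)])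
        have x_eq: "inv h \<otimes> b = x" unfolding hx(3) using hG xG by (simp add: inv_cancel_left)
        have sub: "cluster m b \<subseteq> cluster m g" using cluster_eq[OF b(1)] by simp
        have "finite_over H (cluster m x)"
        proof -
          have fin: "finite_over H (cluster m g)" using none gb g by blast
          have "y \<in> (\<otimes>) (inv h) ` cluster m g" if y: "y \<in> cluster m x" for y
          proof -
            have "h \<otimes> y \<in> cluster m g" using cluster_left[OF hx(1) y] sub unfolding hx(3) by blast
            moreover have "y \<in> carrier G"
            proof -
              have "b \<in> beyond m" using cluster_beyond[OF gb] b(1) by blast
              then have "x \<in> beyond m"
                using level_left[OF hx(1), of x m] xG unfolding hx(3) beyond_def by auto
              then show ?thesis using cluster_beyond y beyond_carrier by blast
            qed
            ultimately show ?thesis using hG by (intro image_eqI[of _ _ "h \<otimes> y"]) (simp_all add: inv_cancel_left)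
          qed
          then show ?thesis
            using finite_over_subset[OF finite_over_left[OF H fin ih]] by blast
        qed
        then have "x \<in> F'" using hx(2) by (simp add: F'_def)
        moreover have "g \<in> cluster m b" using cluster_eq[OF b(1)] cluster_refl by simp
        then have "inv h \<otimes> g \<in> cluster m x" using cluster_left[OF ih] x_eq by force
        moreover have "g = h \<otimes> (inv h \<otimes> g)" using hG gb beyond_carrier by (simp add: inv_cancel_left)
        ultimately show ?thesis using hx(1) by blast
      qed blast
    qed
    moreover have "finite_over H ?U"
    proof (rule finite_over_UN)
      show "finite F'" using F(1) by (simp add: F'_def)
      fix b assume "b \<in> F'"
      then obtain n where n: "cluster m b \<subseteq> level n" using finite_over_iff_level by (auto simp: F'_def)
      have "{h \<otimes> y |h y. h \<in> H \<and> y \<in> cluster m b} \<subseteq> level n" using n level_left by blast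
      then show "finite_over H {h \<otimes> y |h y. h \<in> H \<and> y \<in> cluster m b}" using finite_over_iff_level by blast
    qed
    ultimately show False using Q(2) finite_over_Un[OF finite_over_level] finite_over_subset by blast
  qed
  then obtain g where g: "g \<in> beyond m" "g \<in> Q" "\<not> finite_over H (cluster m g)" by blast
  have "cluster m g \<subseteq> Q" using cluster_constant[OF lc] g(2) unfolding m_def by blast
  moreover have "cluster m g \<subseteq> cluster k g" by (rule cluster_mono) (simp add: m_def)
  ultimately have "cluster m g \<subseteq> cluster k g \<inter> Q" by blast
  then have "\<not> finite_over H (cluster k g \<inter> Q)" using g(3) finite_over_subset by blast
  moreover have "g \<in> beyond k" using g(1) beyond_mono[of k m] by (auto simp: m_def)
  ultimately show ?thesis by blast
qed

text \<open>Inside of a component, the previous lemma applies to its intersection with \<open>Q\<close> and the next radius.\<close>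

lemma ex_deep_chain:
  assumes Q: "almost_invariant H Q" "\<not> finite_over H Q"
  shows "\<exists>g. (\<forall>k. g k \<in> beyond k \<and> \<not> finite_over H (cluster k (g k) \<inter> Q) \<and> g (Suc k) \<in> cluster k (g k))"
proof -
  let ?P = "\<lambda>k g. g \<in> beyond k \<and> \<not> finite_over H (cluster k g \<inter> Q)"
  have "\<exists>g. \<forall>k. ?P k (g k) \<and> g (Suc k) \<in> cluster k (g k)"
  proof (rule dependent_nat_choice)
    show "\<exists>g. ?P 0 g" using ex_deep_cluster[OF Q] by blast
    fix g k assume g: "?P k g"
    have "almost_invariant H (cluster k g \<inter> Q)"
      using cluster_almost_invariant g Q(1) by (intro almost_invariant_Int) auto
    then obtain g' where g': "g' \<in> beyond (Suc k)" "\<not> finite_over H (cluster (Suc k) g' \<inter> (cluster k g \<inter> Q))"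
      using ex_deep_cluster g by blast
    have "cluster (Suc k) g' \<inter> (cluster k g \<inter> Q) \<noteq> {}" using g'(2) by fastforce
    then obtain y where "y \<in> cluster (Suc k) g'" "y \<in> cluster k g" by blast
    then have "cluster k g' = cluster k g" using cluster_mono[of k "Suc k" g'] cluster_eq[of y k g] cluster_eq[of y k g'] by auto
    then have "g' \<in> cluster k g" using cluster_refl by blast
    moreover have "\<not> finite_over H (cluster (Suc k) g' \<inter> Q)"
      using g'(2) finite_over_subset by blast
    ultimately show "\<exists>g'. ?P (Suc k) g' \<and> g' \<in> cluster k g" using g'(1) by blast
  qed
  then show ?thesis by blast
qed

end

section \<open>The geometric realization of a Cayley graph\<close>

lemma closed_edge_coords:
  assumes "x \<in> closed_edge {g, h}" "g \<noteq> h"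
  shows "0 \<le> x g" "0 \<le> x h" "x g + x h = 1" "x v \<noteq> 0 \<Longrightarrow> v = g \<or> v = h"
  using assms by (auto simp: closed_edge_def)

context cayley_pair
begin

abbreviation edge_path :: "('a \<Rightarrow> real) \<Rightarrow> ('a \<Rightarrow> real) \<Rightarrow> real \<Rightarrow> bool" where
  "edge_path \<equiv> polygonal_path (carrier G) (cayley_edges G A)"

lemma edge_cases:
  assumes "e \<in> cayley_edges G A"
  obtains g h where "e = {g, h}" "adj g h"
proof -
  obtain g a where "e = {g, g \<otimes> a}" "g \<in> carrier G" "a \<in> A" "a \<noteq> \<one>"
    using assms unfolding cayley_edges_def by blast
  then show thesis using that adj_gen by blast
qed

lemma vertex_in_space: "g \<in> carrier G \<Longrightarrow> vertex_point g \<in> cayley_space G A"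
  by (simp add: cayley_space_def realization_def)

lemma edge_subset_space: "adj g h \<Longrightarrow> closed_edge {g, h} \<subseteq> cayley_space G A"
  unfolding adj_def cayley_space_def by (rule closed_edge_subset_realization)

lemma vertex_in_edge: "vertex_point g \<in> closed_edge {g, h}" "vertex_point h \<in> closed_edge {g, h}"
  by (rule vertex_point_in_closed_edge; simp)+

lemma space_cases:
  assumes "x \<in> cayley_space G A"
  obtains g where "g \<in> carrier G" "x = vertex_point g"
    | g h where "adj g h" "x \<in> closed_edge {g, h}" "0 < x g" "0 < x h"
proof -
  consider g where "g \<in> carrier G" "x = vertex_point g" | e where "e \<in> cayley_edges G A" "x \<in> closed_edge e"
    using assms unfolding cayley_space_def realization_def by blast
  then show thesis
  proof cases
    case (2 e)
    from 2(1) obtain g h where e: "e = {g, h}" and gh: "adj g h" by (rule edge_cases)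
    note x = closed_edge_coords[OF 2(2)[unfolded e] adj_neq[OF gh]]
    note gh' = adj_neq[OF gh]
    have "x = vertex_point h" if "x g = 0"
    proof
      fix v show "x v = vertex_point h v"
        using x(3) x(4)[of v] that by (auto simp: vertex_point_def)
    qed
    moreover have "x = vertex_point g" if "x h = 0"
    proof
      fix v show "x v = vertex_point g v"
        using x(3) x(4)[of v] that by (auto simp: vertex_point_def)
    qed
    ultimately show thesis
      using that adj_carrier[OF gh] gh 2(2) e x(1,2) by (metis less_le)
  qed (rule that(1))
qed

lemma space_coords:
  assumes x: "x \<in> cayley_space G A"
  shows "\<exists>v\<in>carrier G. 0 < x v"
    and "0 < x v \<Longrightarrow> v \<in> carrier G"
    and "0 < x v \<Longrightarrow> x = vertex_point v \<or> (\<exists>w. adj v w \<and> x \<in> closed_edge {v, w} \<and> 0 < x w)"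
    and "0 < x v \<Longrightarrow> 0 < x w \<Longrightarrow> v = w \<or> adj v w"
proof -
  from x show "\<exists>v\<in>carrier G. 0 < x v"
    by (cases rule: space_cases) (auto simp: vertex_point_def dest: adj_carrier)
  from x show "v \<in> carrier G" if "0 < x v"
  proof (cases rule: space_cases)
    case (2 g h)
    then show ?thesis using closed_edge_coords(4)[OF 2(2) adj_neq[OF 2(1)], of v] that adj_carrier[OF 2(1)] by auto
  qed (use that in \<open>auto simp: vertex_point_def split: if_splits\<close>)
  from x show "x = vertex_point v \<or> (\<exists>w. adj v w \<and> x \<in> closed_edge {v, w} \<and> 0 < x w)" if "0 < x v"
  proof (cases rule: space_cases)
    case (2 g h)
    have "v = g \<or> v = h" using closed_edge_coords(4)[OF 2(2) adj_neq[OF 2(1)], of v] that by auto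
    then show ?thesis using 2 adj_sym[OF 2(1)] insert_commute[of g h "{}"] by auto
  qed (use that in \<open>auto simp: vertex_point_def split: if_splits\<close>)
  from x show "v = w \<or> adj v w" if "0 < x v" "0 < x w"
  proof (cases rule: space_cases)
    case (2 g h)
    have "v = g \<or> v = h" "w = g \<or> w = h"
      using closed_edge_coords(4)[OF 2(2) adj_neq[OF 2(1)]] that by auto
    then show ?thesis using 2(1) adj_sym[OF 2(1)] by auto
  qed (use that in \<open>auto simp: vertex_point_def split: if_splits\<close>)
qed

lemma path_in_edge:
  assumes gh: "adj g h" and xy: "x \<in> closed_edge {g, h}" "y \<in> closed_edge {g, h}"
  shows "edge_path x y \<bar>x g - y g\<bar>"
proof -
  note x = closed_edge_coords[OF xy(1) adj_neq[OF gh]] and y = closed_edge_coords[OF xy(2) adj_neq[OF gh]]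
  have "x h - y h = - (x g - y g)" using x(3) y(3) by linarith
  then have "\<bar>x h - y h\<bar> = \<bar>x g - y g\<bar>" by simp
  then have "(\<Sum>v\<in>{g, h}. \<bar>x v - y v\<bar>) / 2 = \<bar>x g - y g\<bar>" using adj_neq[OF gh] by simp
  then show ?thesis using polygonal_path_segment[OF gh[unfolded adj_def] xy, of "carrier G"] by simp
qed

lemma path_to_vertex:
  assumes x: "x \<in> cayley_space G A" "0 < x v"
  shows "\<exists>l\<le>1. edge_path x (vertex_point v) l"
  using space_coords(3)[OF x]
proof
  assume "x = vertex_point v"
  then have "edge_path x (vertex_point v) 0"
    using x(1) polygonal_path.trivial unfolding cayley_space_def by metis
  then show ?thesis using zero_le_one by blast
next
  assume "\<exists>w. adj v w \<and> x \<in> closed_edge {v, w} \<and> 0 < x w"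
  then obtain w where w: "adj v w" "x \<in> closed_edge {v, w}" by blast
  note c = closed_edge_coords[OF w(2) adj_neq[OF w(1)]]
  have "\<bar>x v - vertex_point v v\<bar> \<le> 1" using c(1-3) by (simp add: vertex_point_def)
  then show ?thesis using path_in_edge[OF w vertex_in_edge(1)] by blast
qed

lemma path_to_base:
  "g \<in> level n \<Longrightarrow> \<exists>h\<in>H. \<exists>l\<le>real n. edge_path (vertex_point g) (vertex_point h) l"
proof (induction n arbitrary: g)
  case 0
  then have "edge_path (vertex_point g) (vertex_point g) 0"
    using H_carrier by (intro polygonal_path.trivial) (auto simp: realization_def)
  then show ?case using 0 by auto
next
  case (Suc n)
  show ?case
  proof (cases "g \<in> level n")
    case True
    from Suc.IH[OF this] obtain h l
      where "h \<in> H" "l \<le> real n" "edge_path (vertex_point g) (vertex_point h) l" by blast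
    moreover from this have "l \<le> real (Suc n)" by simp
    ultimately show ?thesis by blast
  next
    case False
    then obtain g' where g': "g' \<in> level n" "adj g' g" using Suc.prems by auto
    then obtain h l where h: "h \<in> H" "l \<le> real n" "edge_path (vertex_point g') (vertex_point h) l"
      using Suc.IH by blast
    have "edge_path (vertex_point g) (vertex_point g') 1"
      using path_in_edge[OF adj_sym[OF g'(2)] vertex_in_edge] adj_neq[OF g'(2)] by (simp add: vertex_point_def)
    from polygonal_path_trans[OF this h(3)]
    have "edge_path (vertex_point g) (vertex_point h) (1 + l)" .
    moreover have "1 + l \<le> real (Suc n)" using h(2) by simp
    ultimately show ?thesis using h(1) by blast
  qed
qed

end

text \<open>Every point is joined to the vertex \<open>\<one>\<close>; this uses the levels around the trivial subgroup.\<close>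

lemma (in group) path_exists:
  assumes A: "finite_generating_set G A" and x: "x \<in> cayley_space G A" and y: "y \<in> cayley_space G A"
  shows "\<exists>l. polygonal_path (carrier G) (cayley_edges G A) x y l"
proof -
  interpret T: cayley_pair G A "{\<one>}"
    by unfold_locales (use A triv_subgroup in auto)
  have one: "\<exists>l. T.edge_path z (vertex_point \<one>) l" if z: "z \<in> cayley_space G A" for z
  proof -
    obtain v where v: "v \<in> carrier G" "0 < z v" using T.space_coords(1)[OF z] by blast
    obtain l where l: "T.edge_path z (vertex_point v) l" using T.path_to_vertex[OF z v(2)] by blast
    obtain n where "v \<in> T.level n" using T.ex_level[OF v(1)] by blast
    from T.path_to_base[OF this] obtain l' where "T.edge_path (vertex_point v) (vertex_point \<one>) l'" by blast
    from polygonal_path_trans[OF l this] show ?thesis by blast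
  qed
  obtain l l' where "T.edge_path x (vertex_point \<one>) l" "T.edge_path y (vertex_point \<one>) l'" using one x y by blast
  from polygonal_path_trans[OF this(1) polygonal_path_sym[OF this(2)]] show ?thesis by blast
qed

context cayley_pair
begin

interpretation M: Metric_space "cayley_space G A" "cayley_dist G A"
  using Metric_space_cayley[OF A_carrier gen_A] .

lemma edges_finite: "\<forall>e\<in>cayley_edges G A. finite e"
  by (auto simp: cayley_edges_def)

lemma path_nonneg: "edge_path x y l \<Longrightarrow> 0 \<le> l"
  using polygonal_path_ge[OF _ edges_finite, of "carrier G" x y l undefined] by linarith

lemma dist_le:
  assumes "edge_path x y l" shows "cayley_dist G A x y \<le> l"
proof -
  have "bdd_below {l. edge_path x y l}" using path_nonneg by (intro bdd_belowI[of _ 0]) auto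
  then have "Inf {l. edge_path x y l} \<le> l" using assms by (intro cInf_lower) auto
  then show ?thesis using polygonal_path_mem[OF assms] by (simp add: cayley_dist_def path_metric_def)
qed

lemma dist_ge:
  assumes "x \<in> cayley_space G A" "y \<in> cayley_space G A" "\<And>l. edge_path x y l \<Longrightarrow> c \<le> l"
  shows "c \<le> cayley_dist G A x y"
proof -
  have "c \<le> Inf {l. edge_path x y l}"
    using path_exists[OF gens assms(1,2)] assms(3) by (intro cInf_greatest) auto
  then show ?thesis using assms(1,2) by (simp add: cayley_dist_def path_metric_def cayley_space_def)
qed

text \<open>Barycentric coordinates are continuous; therefore open stars of vertices are open sets.\<close>

lemma coordinate_dist:
  assumes "x \<in> cayley_space G A" "y \<in> cayley_space G A"
  shows "\<bar>x v - y v\<bar> \<le> 2 * cayley_dist G A x y"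
proof -
  have "\<bar>x v - y v\<bar> / 2 \<le> cayley_dist G A x y"
  proof (rule dist_ge[OF assms])
    fix l assume "edge_path x y l"
    from polygonal_path_ge[OF this edges_finite, of v] show "\<bar>x v - y v\<bar> / 2 \<le> l" by simp
  qed
  then show ?thesis by simp
qed

lemma open_star: "openin (cayley_topology G A) {x \<in> cayley_space G A. 0 < x v}"
  unfolding cayley_topology_def M.openin_mtopology
proof (intro conjI allI impI)
  fix x assume x: "x \<in> {x \<in> cayley_space G A. 0 < x v}"
  have "M.mball x (x v / 2) \<subseteq> {x \<in> cayley_space G A. 0 < x v}"
  proof
    fix y assume "y \<in> M.mball x (x v / 2)"
    then have y: "y \<in> cayley_space G A" "cayley_dist G A x y < x v / 2" by auto
    have "\<bar>x v - y v\<bar> < x v" using coordinate_dist[of x y v] x y by simp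
    then show "y \<in> {x \<in> cayley_space G A. 0 < x v}" using y(1) by auto
  qed
  then show "\<exists>r>0. M.mball x r \<subseteq> {x \<in> cayley_space G A. 0 < x v}"
    using x by (intro exI[of _ "x v / 2"]) auto
qed auto

lemma connectedin_edge:
  assumes gh: "adj g h" shows "connectedin (cayley_topology G A) (closed_edge {g, h})"
proof -
  note neq = adj_neq[OF gh]
  define c :: "real \<Rightarrow> 'a \<Rightarrow> real" where "c s = (\<lambda>v. if v = g then s else if v = h then 1 - s else 0)" for s
  have c_edge: "c s \<in> closed_edge {g, h}" if "s \<in> {0..1}" for s
    using that neq by (auto simp: c_def closed_edge_def)
  have "continuous_map (top_of_set {0..1}) (cayley_topology G A) c"
    unfolding cayley_topology_def M.continuous_map_to_metric
  proof (intro ballI allI impI)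
    fix s e :: real assume s: "s \<in> topspace (top_of_set {0..1})" and e: "0 < e"
    have "c s' \<in> M.mball (c s) e" if s': "s' \<in> {0..1} \<inter> ball s e" for s'
    proof -
      have in_edge: "c s \<in> closed_edge {g, h}" "c s' \<in> closed_edge {g, h}" using c_edge s s' by auto
      have "cayley_dist G A (c s) (c s') \<le> \<bar>c s g - c s' g\<bar>"
        using dist_le path_in_edge[OF gh in_edge] by blast
      also have "\<dots> < e" using s' by (simp add: c_def dist_real_def)
      finally show ?thesis using in_edge edge_subset_space[OF gh] by auto
    qed
    moreover have "openin (top_of_set {0..1}) ({0..1} \<inter> ball s e)" by (simp add: openin_open_Int)
    moreover have "s \<in> {0..1} \<inter> ball s e" using s e by simp
    ultimately show "\<exists>U. openin (top_of_set {0..1}) U \<and> s \<in> U \<and> (\<forall>s'\<in>U. c s' \<in> M.mball (c s) e)"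
      by blast
  qed
  then have "connectedin (cayley_topology G A) (c ` {0..1})"
    by (rule connectedin_continuous_map_image) (simp add: connectedin_subtopology)
  moreover have "c ` {0..1} = closed_edge {g, h}"
  proof
    show "c ` {0..1} \<subseteq> closed_edge {g, h}" using c_edge by blast
    show "closed_edge {g, h} \<subseteq> c ` {0..1}"
    proof
      fix x assume "x \<in> closed_edge {g, h}"
      note x = closed_edge_coords[OF this neq]
      have "x = c (x g)"
      proof
        fix v show "x v = c (x g) v" using x(3) x(4)[of v] neq by (auto simp: c_def)
      qed
      moreover have "x g \<in> {0..1}" using x(1-3) by simp
      ultimately show "x \<in> c ` {0..1}" by blast
    qed
  qed
  ultimately show ?thesis by simp
qed

definition depth :: "'a \<Rightarrow> nat" where
  "depth g = (LEAST n. g \<in> level n)"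

lemma depth_le: "g \<in> level n \<Longrightarrow> depth g \<le> n"
  unfolding depth_def by (rule Least_le)

lemma depth_level: "g \<in> carrier G \<Longrightarrow> g \<in> level (depth g)"
  unfolding depth_def using ex_level by (rule LeastI_ex)

lemma depth_adj:
  assumes "adj g h" shows "\<bar>real (depth g) - real (depth h)\<bar> \<le> 1"
proof -
  have "depth h \<le> Suc (depth g)"
    by (rule depth_le[OF level_adj[OF depth_level[OF adj_carrier(1)[OF assms]] assms]])
  moreover have "depth g \<le> Suc (depth h)"
    by (rule depth_le[OF level_adj[OF depth_level[OF adj_carrier(2)[OF assms]] adj_sym[OF assms]]])
  ultimately show ?thesis by linarith
qed

text \<open>The affine extension of the distance from \<open>H\<close> to the edges. It is bounded above by the distance in the
path metric, as it changes along a path at most by its length.\<close>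

definition height :: "('a \<Rightarrow> real) \<Rightarrow> real" where
  "height x = (\<Sum>v | x v \<noteq> 0. x v * real (depth v))"

lemma height_vertex [simp]: "height (vertex_point g) = real (depth g)"
proof -
  have "{v. vertex_point g v \<noteq> 0} = {g}" by (auto simp: vertex_point_def)
  then show ?thesis by (simp add: height_def vertex_point_def)
qed

lemma height_edge:
  assumes "x \<in> closed_edge {g, h}" "g \<noteq> h"
  shows "height x = x g * real (depth g) + x h * real (depth h)"
proof -
  have "height x = (\<Sum>v\<in>{g, h}. x v * real (depth v))"
    unfolding height_def using closed_edge_coords(4)[OF assms]
    by (intro sum.mono_neutral_left) auto
  then show ?thesis using assms(2) by simp
qed

lemma height_path: "edge_path x y l \<Longrightarrow> \<bar>height x - height y\<bar> \<le> l"
proof (induction rule: polygonal_path.induct)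
  case (segment x y l e z)
  from segment.hyps(2) obtain g h where e: "e = {g, h}" and gh: "adj g h" by (rule edge_cases)
  note neq = adj_neq[OF gh]
  note y = closed_edge_coords[OF segment.hyps(3)[unfolded e] neq]
  note z = closed_edge_coords[OF segment.hyps(4)[unfolded e] neq]
  have h_eq: "y h = 1 - y g" "z h = 1 - z g" using y(3) z(3) by linarith+
  have "height y - height z = (y g - z g) * (real (depth g) - real (depth h))"
    using height_edge[OF segment.hyps(3)[unfolded e] neq] height_edge[OF segment.hyps(4)[unfolded e] neq]
    unfolding h_eq by (simp add: algebra_simps)
  then have "\<bar>height y - height z\<bar> = \<bar>y g - z g\<bar> * \<bar>real (depth g) - real (depth h)\<bar>"
    by (simp add: abs_mult)
  also have "\<dots> \<le> \<bar>y g - z g\<bar>" using depth_adj[OF gh] mult_left_le by fastforce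
  also have "\<dots> = (\<Sum>v\<in>e. \<bar>y v - z v\<bar>) / 2" unfolding e using neq h_eq by simp
  finally show ?case using segment.IH by linarith
qed simp

abbreviation nbhd :: "nat \<Rightarrow> ('a \<Rightarrow> real) set" where
  "nbhd k \<equiv> cayley_nbhd G A k (vertex_point ` H)"

abbreviation outside :: "nat \<Rightarrow> ('a \<Rightarrow> real) topology" where
  "outside k \<equiv> subtopology (cayley_topology G A) (cayley_space G A - nbhd k)"

lemma nbhd_iff:
  "x \<in> nbhd k \<longleftrightarrow> x \<in> cayley_space G A \<and> (INF h\<in>vertex_point ` H. cayley_dist G A x h) \<le> real k"
  using subgroup.one_closed[OF H]
  by (auto simp: cayley_nbhd_def graph_nbhd_def cayley_space_def cayley_dist_def)

lemma not_in_nbhd: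
  assumes x: "x \<in> cayley_space G A" and beyond: "\<And>v. 0 < x v \<Longrightarrow> v \<in> beyond k"
  shows "x \<notin> nbhd k"
proof
  assume "x \<in> nbhd k"
  then have le: "(INF h\<in>vertex_point ` H. cayley_dist G A x h) \<le> real k" by (simp add: nbhd_iff)
  have depth: "real k + 1 \<le> real (depth v)" if "0 < x v" for v
  proof -
    have "v \<in> carrier G" "v \<notin> level k" using beyond[OF that] by (auto simp: beyond_def)
    then have "\<not> depth v \<le> k" using depth_level level_mono by blast
    then show ?thesis by simp
  qed
  have "real k + 1 \<le> height x"
    using x
  proof (cases rule: space_cases)
    case (1 g)
    have "0 < x g" by (simp add: 1(2) vertex_point_def)
    from depth[OF this] show ?thesis by (simp add: 1(2))
  next
    case (2 g h)
    note c = closed_edge_coords[OF 2(2) adj_neq[OF 2(1)]]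
    have "x g * (real k + 1) + x h * (real k + 1) \<le> x g * real (depth g) + x h * real (depth h)"
      using c(1,2) depth[OF 2(3)] depth[OF 2(4)] by (intro add_mono mult_left_mono) auto
    also have "x g * (real k + 1) + x h * (real k + 1) = real k + 1"
      using c(3) by (simp flip: distrib_right)
    finally show ?thesis using height_edge[OF 2(2) adj_neq[OF 2(1)]] by simp
  qed
  also have "height x \<le> (INF h\<in>vertex_point ` H. cayley_dist G A x h)"
  proof (rule cINF_greatest)
    show "vertex_point ` H \<noteq> {}" using subgroup.one_closed[OF H] by auto
    fix p assume "p \<in> vertex_point ` H"
    then obtain h where h: "h \<in> H" "p = vertex_point h" by blast
    have "depth h = 0" using depth_le[of h 0] h(1) by simp
    then have "height x \<le> l" if "edge_path x p l" for l
      using height_path[OF that] path_nonneg[OF that] unfolding h(2) by simp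
    then show "height x \<le> cayley_dist G A x p"
      using x h H_carrier vertex_in_space by (intro dist_ge) auto
  qed
  finally show False using le by simp
qed

lemma in_nbhd:
  assumes x: "x \<in> cayley_space G A" and v: "0 < x v" "v \<in> level k"
  shows "x \<in> nbhd (Suc k)"
proof -
  obtain l where l: "l \<le> 1" "edge_path x (vertex_point v) l" using path_to_vertex[OF x v(1)] by blast
  obtain h l' where h: "h \<in> H" "l' \<le> real k" "edge_path (vertex_point v) (vertex_point h) l'"
    using path_to_base[OF v(2)] by blast
  have "(INF h\<in>vertex_point ` H. cayley_dist G A x h) \<le> cayley_dist G A x (vertex_point h)"
    using h(1) by (intro cINF_lower bdd_belowI2[of _ 0]) auto
  also have "\<dots> \<le> l + l'" by (rule dist_le[OF polygonal_path_trans[OF l(2) h(3)]])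
  also have "\<dots> \<le> real (Suc k)" using l(1) h(2) by simp
  finally show ?thesis using x by (simp add: nbhd_iff)
qed

lemma nbhd_mono: "k \<le> m \<Longrightarrow> nbhd k \<subseteq> nbhd m"
  by (auto simp: nbhd_iff)

lemma topspace_outside: "topspace (outside k) = cayley_space G A - nbhd k"
  by (auto simp: cayley_topology_def)

end

section \<open>Poles and almost invariant sets\<close>

lemma (in group) almost_invariant_sym_diff:
  assumes P: "almost_invariant H P" and Q: "almost_invariant H Q"
  shows "almost_invariant H (sym_diff P Q)"
proof (rule almost_invariantI)
  fix a assume a: "a \<in> carrier G"
  have "boundary (sym_diff P Q) a \<subseteq> boundary P a \<union> boundary Q a"
    by (auto simp: boundary_def)
  with finite_over_Un[OF almost_invariantD[OF P a] almost_invariantD[OF Q a]]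
  show "finite_over H (boundary (sym_diff P Q) a)" by (rule finite_over_subset)
qed (use almost_invariant_subset[OF P] almost_invariant_subset[OF Q] in blast)

context cayley_pair
begin

lemma edge_outside:
  assumes gh: "adj g h" "g \<in> beyond k" "h \<in> beyond k"
  shows "connectedin (outside k) (closed_edge {g, h})"
proof -
  have "closed_edge {g, h} \<subseteq> cayley_space G A - nbhd k"
  proof
    fix x assume x: "x \<in> closed_edge {g, h}"
    then have xS: "x \<in> cayley_space G A" using edge_subset_space[OF gh(1)] by blast
    moreover have "x \<notin> nbhd k"
    proof (rule not_in_nbhd[OF xS])
      fix v assume "0 < x v"
      then show "v \<in> beyond k"
        using closed_edge_coords(4)[OF x adj_neq[OF gh(1)], of v] gh(2,3) by auto
    qed
    ultimately show "x \<in> cayley_space G A - nbhd k" by blast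
  qed
  then show ?thesis using connectedin_edge[OF gh(1)] by (simp add: connectedin_subtopology)
qed

lemma vertex_outside:
  assumes "g \<in> beyond k" shows "vertex_point g \<in> topspace (outside k)"
proof -
  have S: "vertex_point g \<in> cayley_space G A"
    by (rule vertex_in_space[OF beyond_carrier[OF assms]])
  have "vertex_point g \<notin> nbhd k"
  proof (rule not_in_nbhd[OF S])
    fix v assume "0 < vertex_point g v"
    then show "v \<in> beyond k" using assms by (simp add: vertex_point_def split: if_splits)
  qed
  with S show ?thesis unfolding topspace_outside by blast
qed

text \<open>A point at distance more than \<open>k + 1\<close> from \<open>H\<close> is at distance at most \<open>1\<close> from the end points of its edge.
The loss of \<open>1\<close> is harmless since poles involve all radii.\<close>

lemma outside_support:
  assumes "x \<in> topspace (outside (Suc k))" "0 < x v" shows "v \<in> beyond k"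
proof -
  have x: "x \<in> cayley_space G A" "x \<notin> nbhd (Suc k)" using assms(1) unfolding topspace_outside by blast+
  then show ?thesis using in_nbhd[OF x(1) assms(2)] space_coords(2)[OF x(1) assms(2)] by (auto simp: beyond_def)
qed

lemma cluster_connected:
  assumes g: "g \<in> beyond k" and h: "h \<in> cluster k g"
  shows "connected_component_of (outside k) (vertex_point g) (vertex_point h)"
  using h
proof (induction rule: cluster_induct)
  case refl
  show ?case using vertex_outside[OF g] by (simp add: connected_component_of_refl)
next
  case (step x y)
  have "connected_component_of (outside k) (vertex_point x) (vertex_point y)"
    unfolding connected_component_of_def
    by (intro exI[of _ "closed_edge {x, y}"] conjI edge_outside[OF step(4,2,3)] vertex_in_edge)
  with step(5) show ?case by (rule connected_component_of_trans)
qed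

text \<open>The open stars of the vertices of one component and the open stars of all other vertices cover
the complement of the neighbourhood and are disjoint there, since the end points of an edge that
contains a point far away from \<open>H\<close> belong to the same component.\<close>

lemma connected_in_cluster:
  assumes K: "connectedin (outside (Suc k)) K" and g: "vertex_point g \<in> K" and h: "vertex_point h \<in> K"
  shows "h \<in> cluster k g"
proof (rule ccontr)
  assume not: "h \<notin> cluster k g"
  have K': "connectedin (cayley_topology G A) K" "K \<subseteq> cayley_space G A - nbhd (Suc k)"
    using K by (auto simp: connectedin_subtopology)
  have supp: "v \<in> beyond k" if "x \<in> K" "0 < x v" for x v
    using outside_support[of x k v] that K'(2) unfolding topspace_outside by blast
  define star where "star C = (\<Union>v\<in>C. {x \<in> cayley_space G A. 0 < x v})" for C :: "'a set"
  have star_open: "openin (cayley_topology G A) (star C)" for C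
    unfolding star_def by (rule openin_Union) (auto intro: open_star)
  let ?C = "cluster k g"
  have starI: "x \<in> star C" if "x \<in> K" "v \<in> C" "0 < x v" for x v C
    using that K'(2) unfolding star_def by blast
  have cover: "K \<subseteq> star ?C \<union> star (- ?C)"
  proof
    fix x assume x: "x \<in> K"
    then have "x \<in> cayley_space G A" using K'(2) by blast
    from space_coords(1)[OF this] obtain v where "0 < x v" by blast
    then show "x \<in> star ?C \<union> star (- ?C)" using starI[OF x, of v] by (cases "v \<in> ?C") auto
  qed
  have disj: "star ?C \<inter> star (- ?C) \<inter> K = {}"
  proof (rule equals0I)
    fix x assume "x \<in> star ?C \<inter> star (- ?C) \<inter> K"
    then have x: "x \<in> K" "x \<in> star ?C" "x \<in> star (- ?C)" by simp_all
    from x(2) obtain v where v: "v \<in> ?C" "0 < x v" "x \<in> cayley_space G A" unfolding star_def by blast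
    from x(3) obtain w where w: "w \<notin> ?C" "0 < x w" unfolding star_def by blast
    have "v \<noteq> w" using v(1) w(1) by blast
    then have "adj v w" using space_coords(4)[OF v(3,2) w(2)] by blast
    then have "w \<in> ?C" by (rule cluster_step[OF v(1) _ supp[OF x(1) v(2)] supp[OF x(1) w(2)]])
    with w(1) show False by contradiction
  qed
  have "0 < vertex_point v v" for v :: 'a by (simp add: vertex_point_def)
  then have "vertex_point g \<in> star ?C" "vertex_point h \<in> star (- ?C)"
    using starI[OF g cluster_refl] starI[OF h, of h "- ?C"] not by simp_all
  then have ne: "star ?C \<inter> K \<noteq> {}" "star (- ?C) \<inter> K \<noteq> {}" using g h by auto
  show False
    using K'(1) unfolding connectedin
    by (elim conjE notE) (intro exI[of _ "star ?C"] exI[of _ "star (- ?C)"] conjI star_open cover disj ne)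
qed

definition vertices :: "('a \<Rightarrow> real) set \<Rightarrow> 'a set" where
  "vertices K = {g \<in> carrier G. vertex_point g \<in> K}"

lemma vertices_mono: "K \<subseteq> L \<Longrightarrow> vertices K \<subseteq> vertices L"
  by (auto simp: vertices_def)

text \<open>Poles are decreasing, so one member of the chain suffices.\<close>

definition eventually_in :: "(nat \<Rightarrow> ('a \<Rightarrow> real) set) \<Rightarrow> 'a set \<Rightarrow> bool" where
  "eventually_in U P \<longleftrightarrow> (\<exists>k. vertices (U k) \<subseteq> P)"

lemma poles_iff:
  "U \<in> poles G A H \<longleftrightarrow> decseq U \<and> (\<forall>k. U k \<in> connected_components_of (outside (Suc k)))"
  by (simp add: poles_def)

lemma pole_component: "U \<in> poles G A H \<Longrightarrow> U k \<in> connected_components_of (outside (Suc k))"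
  by (simp add: poles_iff)

lemma pole_decseq: "U \<in> poles G A H \<Longrightarrow> k \<le> m \<Longrightarrow> U m \<subseteq> U k"
  by (auto simp: poles_iff decseq_def)

lemma pole_edge:
  assumes U: "U \<in> poles G A H" and gh: "adj g h" "g \<in> beyond (Suc k)" "h \<in> beyond (Suc k)"
    and x: "x \<in> closed_edge {g, h}" "x \<in> U k"
  shows "closed_edge {g, h} \<subseteq> U k"
proof (rule connected_components_of_maximal[OF pole_component[OF U] edge_outside[OF gh]])
  show "\<not> disjnt (U k) (closed_edge {g, h})" using x by (auto simp: disjnt_def)
qed

text \<open>A point of the next member of the chain lies on an edge whose end points are outside of the smaller
neighbourhood. The whole edge then belongs to the present member.\<close>

lemma pole_vertex_beyond:
  assumes U: "U \<in> poles G A H"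
  shows "\<exists>v\<in>vertices (U k). v \<in> beyond (Suc k)"
proof -
  obtain x where x: "x \<in> U (Suc k)"
    using nonempty_connected_components_of[OF pole_component[OF U, of "Suc k"]] by blast
  have top: "x \<in> topspace (outside (Suc (Suc k)))"
    using connectedin_subset_topspace[OF connectedin_connected_components_of[OF pole_component[OF U, of "Suc k"]]] x
    by (rule subsetD)
  then have xS: "x \<in> cayley_space G A" unfolding topspace_outside by blast
  have xk: "x \<in> U k" using x pole_decseq[OF U, of k "Suc k"] by auto
  obtain v where v: "v \<in> carrier G" "0 < x v" using space_coords(1)[OF xS] by blast
  have vb: "v \<in> beyond (Suc k)" by (rule outside_support[OF top v(2)])
  have "vertex_point v \<in> U k"
    using space_coords(3)[OF xS v(2)]
  proof
    assume "x = vertex_point v"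
    then show ?thesis using xk by simp
  next
    assume "\<exists>w. adj v w \<and> x \<in> closed_edge {v, w} \<and> 0 < x w"
    then obtain w where w: "adj v w" "x \<in> closed_edge {v, w}" "0 < x w" by blast
    have "closed_edge {v, w} \<subseteq> U k"
      by (rule pole_edge[OF U w(1) vb outside_support[OF top w(3)] w(2) xk])
    then show ?thesis using vertex_in_edge(1)[of v w] by (rule subsetD)
  qed
  then have "v \<in> vertices (U k)" using v(1) by (simp add: vertices_def)
  then show ?thesis using vb by (rule bexI[rotated])
qed

lemma eventually_in_not_finite:
  assumes U: "U \<in> poles G A H" and P: "eventually_in U P"
  shows "\<not> finite_over H P"
proof
  assume "finite_over H P"
  then obtain n where n: "P \<subseteq> level n" using finite_over_iff_level by blast
  obtain k where k: "vertices (U k) \<subseteq> P" using P by (auto simp: eventually_in_def)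
  obtain v where v: "v \<in> vertices (U (max k n))" "v \<in> beyond (Suc (max k n))"
    using pole_vertex_beyond[OF U, of "max k n"] by (elim bexE)
  have "vertices (U (max k n)) \<subseteq> vertices (U k)"
    by (rule vertices_mono[OF pole_decseq[OF U]]) simp
  then have "v \<in> level n" using v(1) k n by blast
  moreover have "level n \<subseteq> level (Suc (max k n))" by (rule level_mono) simp
  ultimately have "v \<in> level (Suc (max k n))" by blast
  then show False using v(2) by (simp add: beyond_def)
qed

lemma eventually_in_mono: "eventually_in U P \<Longrightarrow> P \<subseteq> Q \<Longrightarrow> eventually_in U Q"
  unfolding eventually_in_def by blast

lemma eventually_in_Int:
  assumes U: "U \<in> poles G A H" and PQ: "eventually_in U P" "eventually_in U Q"
  shows "eventually_in U (P \<inter> Q)"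
proof -
  obtain k m where km: "vertices (U k) \<subseteq> P" "vertices (U m) \<subseteq> Q"
    using PQ by (auto simp: eventually_in_def)
  have "vertices (U (max k m)) \<subseteq> vertices (U k)" "vertices (U (max k m)) \<subseteq> vertices (U m)"
    by (rule vertices_mono[OF pole_decseq[OF U]], simp)+
  then show ?thesis using km unfolding eventually_in_def by blast
qed

lemma eventually_in_disjoint:
  assumes "U \<in> poles G A H" "eventually_in U P" "eventually_in U Q" shows "P \<inter> Q \<noteq> {}"
proof
  assume "P \<inter> Q = {}"
  with eventually_in_Int[OF assms] have "eventually_in U {}" by simp
  from eventually_in_not_finite[OF assms(1) this] show False by simp
qed

text \<open>If two chains differ at \<open>k\<close>, their members at \<open>k\<close> are different components, hence disjoint. The set of
vertices of a component is almost invariant.\<close>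

lemma poles_separated:
  assumes U: "U \<in> poles G A H" and V: "V \<in> poles G A H" and neq: "U \<noteq> V"
  shows "\<exists>P. almost_invariant H P \<and> eventually_in U P \<and> eventually_in V (carrier G - P)"
proof -
  obtain k where k: "U k \<noteq> V k" using neq by blast
  let ?P = "vertices (U k)"
  have "locally_constant (Suc k) ?P"
    unfolding locally_constant_def
  proof (intro allI impI)
    have *: "h \<in> ?P" if "adj g h" "g \<in> beyond (Suc k)" "h \<in> beyond (Suc k)" "g \<in> ?P" for g h
    proof -
      have "closed_edge {g, h} \<subseteq> U k"
        using pole_edge[OF U that(1-3) vertex_in_edge(1)] that(4) by (simp add: vertices_def)
      then show ?thesis
        using vertex_in_edge(2)[of h g] adj_carrier(2)[OF that(1)] unfolding vertices_def by blast
    qed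
    fix g h assume "adj g h" "g \<in> beyond (Suc k)" "h \<in> beyond (Suc k)"
    then show "g \<in> ?P \<longleftrightarrow> h \<in> ?P" using * adj_sym by blast
  qed
  then have "almost_invariant H ?P"
    by (intro locally_constant_almost_invariant) (auto simp: vertices_def)
  moreover have "U k \<inter> V k = {}"
    using connected_components_of_maximal[OF pole_component[OF U] connectedin_connected_components_of[OF pole_component[OF V]]]
      connected_components_of_maximal[OF pole_component[OF V] connectedin_connected_components_of[OF pole_component[OF U]]] k
    by (auto simp: disjnt_def)
  then have "vertices (V k) \<subseteq> carrier G - ?P" by (auto simp: vertices_def)
  ultimately show ?thesis unfolding eventually_in_def by blast
qed

text \<open>The components of the realization which contain a decreasing chain of components of the graph form a
pole. The components of the graph are chosen such that none of them meets \<open>Q\<close> in an \<open>H\<close>-finite set.\<close>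

lemma ex_pole:
  assumes Q: "almost_invariant H Q" "\<not> finite_over H Q"
  shows "\<exists>U\<in>poles G A H. eventually_in U Q"
proof -
  obtain g where g: "\<And>k. g k \<in> beyond k" "\<And>k. \<not> finite_over H (cluster k (g k) \<inter> Q)"
    "\<And>k. g (Suc k) \<in> cluster k (g k)"
    using ex_deep_chain[OF Q] by blast
  define p where "p k = vertex_point (g k)" for k
  define U where "U k = connected_component_of_set (outside (Suc k)) (p (Suc k))" for k
  have p_top: "p k \<in> topspace (outside k)" for k
    unfolding p_def by (rule vertex_outside[OF g(1)])
  have con: "connectedin (outside (Suc k)) (U k)" for k
    unfolding U_def by (rule connectedin_connected_component_of)
  have pU: "p (Suc k) \<in> U k" for k
    unfolding U_def using p_top by (simp add: connected_component_of_refl)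
  have "U (Suc k) \<subseteq> U k" for k
  proof -
    have "connectedin (outside (Suc k)) (U (Suc k))"
      using con[of "Suc k"] nbhd_mono[of "Suc k" "Suc (Suc k)"] by (auto simp: connectedin_subtopology)
    from connected_component_of_maximal[OF this pU]
    have "U (Suc k) \<subseteq> connected_component_of_set (outside (Suc k)) (p (Suc (Suc k)))" .
    also have "connected_component_of (outside (Suc k)) (p (Suc k)) (p (Suc (Suc k)))"
      unfolding p_def by (rule cluster_connected[OF g(1,3)])
    then have "connected_component_of_set (outside (Suc k)) (p (Suc (Suc k))) = U k"
      unfolding U_def using connected_component_of_equiv[of "outside (Suc k)"] by metis
    finally show ?thesis .
  qed
  then have dec: "decseq U" by (rule decseq_SucI)
  have "U k \<in> connected_components_of (outside (Suc k))" for k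
    unfolding U_def connected_components_of_def using p_top by blast
  with dec have pole: "U \<in> poles G A H" by (simp add: poles_iff)
  obtain k where k: "locally_constant k Q" using almost_invariant_locally_constant[OF Q(1)] by blast
  have "cluster k (g k) \<inter> Q \<noteq> {}" using g(2)[of k] by fastforce
  then have gQ: "g k \<in> Q" using cluster_constant[OF k] by blast
  have "vertices (U k) \<subseteq> Q"
  proof
    fix h assume "h \<in> vertices (U k)"
    then have "h \<in> cluster k (g (Suc k))"
      using connected_in_cluster[OF con] pU[of k] by (simp add: vertices_def p_def)
    then have "h \<in> cluster k (g k)" using cluster_eq[OF g(3)[of k]] by simp
    then show "h \<in> Q" using cluster_constant[OF k] gQ by blast
  qed
  then show ?thesis using pole unfolding eventually_in_def by blast
qed

text \<open>Two poles separated by \<open>P\<close> leave no room for a pole in at least one of the sets \<open>Q\<close>, its complement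
and their symmetric differences with \<open>P\<close>, so this set is \<open>H\<close>-finite. Conversely \<open>P\<close> and its complement
contain a pole each, and a set \<open>Q\<close> separating a third pole from these two would not be in any of the
four classes.\<close>

lemma card_poles_two_iff: "card (poles G A H) = 2 \<longleftrightarrow> two_ended H"
proof
  assume "card (poles G A H) = 2"
  then obtain U V where UV: "poles G A H = {U, V}" "U \<noteq> V" unfolding card_2_iff by blast
  then have U: "U \<in> poles G A H" and V: "V \<in> poles G A H" by auto
  obtain P where P: "almost_invariant H P" "eventually_in U P" "eventually_in V (carrier G - P)"
    using poles_separated[OF U V UV(2)] by blast
  have PG: "P \<subseteq> carrier G" using P(1) by (rule almost_invariant_subset)
  have "finite_over H Q \<or> finite_over H (carrier G - Q) \<or>
        finite_over H (sym_diff P Q) \<or> finite_over H (sym_diff P (carrier G - Q))"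
    if Q: "almost_invariant H Q" for Q
  proof (rule ccontr)
    assume none: "\<not> ?thesis"
    have ex: "eventually_in U R \<or> eventually_in V R"
      if "almost_invariant H R" "\<not> finite_over H R" for R
      using ex_pole[OF that] unfolding UV(1) by blast
    let ?Q' = "carrier G - Q"
    have Q': "almost_invariant H ?Q'" by (rule almost_invariant_compl[OF Q])
    have R: "eventually_in U Q \<or> eventually_in V Q" "eventually_in U ?Q' \<or> eventually_in V ?Q'"
      "eventually_in U (sym_diff P Q) \<or> eventually_in V (sym_diff P Q)"
      "eventually_in U (sym_diff P ?Q') \<or> eventually_in V (sym_diff P ?Q')"
      by (rule ex[OF Q] ex[OF Q'] ex[OF almost_invariant_sym_diff[OF P(1) Q]]
        ex[OF almost_invariant_sym_diff[OF P(1) Q']], use none in blast)+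
    have disj: "\<not> (eventually_in X Q \<and> eventually_in X ?Q')" if "X \<in> poles G A H" for X
      using eventually_in_disjoint[OF that, of Q ?Q'] by blast
    show False
    proof (cases "eventually_in U Q")
      case True
      then have VQ': "eventually_in V ?Q'" using R(2) disj[OF U] disj[OF V] by blast
      have "\<not> eventually_in U (sym_diff P Q)"
        using eventually_in_disjoint[OF U eventually_in_Int[OF U P(2) True], of "sym_diff P Q"] by blast
      moreover have "\<not> eventually_in V (sym_diff P Q)"
        using eventually_in_disjoint[OF V eventually_in_Int[OF V P(3) VQ'], of "sym_diff P Q"] by blast
      ultimately show False using R(3) by blast
    next
      case False
      then have VQ: "eventually_in V Q" using R(1) by blast
      then have UQ': "eventually_in U ?Q'" using R(2) disj[OF U] disj[OF V] by blast
      have "\<not> eventually_in U (sym_diff P ?Q')"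
        using eventually_in_disjoint[OF U eventually_in_Int[OF U P(2) UQ'], of "sym_diff P ?Q'"] by blast
      moreover have "\<not> eventually_in V (sym_diff P ?Q')"
        using eventually_in_disjoint[OF V eventually_in_Int[OF V P(3) VQ], of "sym_diff P ?Q'"] by blast
      ultimately show False using R(4) by blast
    qed
  qed
  then show "two_ended H"
    unfolding two_ended_def
    by (intro exI[of _ P] conjI allI impI P(1) eventually_in_not_finite[OF U P(2)]
        eventually_in_not_finite[OF V P(3)])
next
  assume "two_ended H"
  then obtain P where P: "almost_invariant H P" "\<not> finite_over H P" "\<not> finite_over H (carrier G - P)"
    and cases: "\<And>Q. almost_invariant H Q \<Longrightarrow> finite_over H Q \<or> finite_over H (carrier G - Q) \<or>
        finite_over H (sym_diff P Q) \<or> finite_over H (sym_diff P (carrier G - Q))"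
    unfolding two_ended_def by blast
  obtain U where U: "U \<in> poles G A H" "eventually_in U P" using ex_pole[OF P(1,2)] by blast
  obtain V where V: "V \<in> poles G A H" "eventually_in V (carrier G - P)"
    using ex_pole[OF almost_invariant_compl[OF P(1)] P(3)] by blast
  have "U \<noteq> V" using eventually_in_disjoint[OF U(1,2), of "carrier G - P"] V(2) by blast
  moreover have "poles G A H = {U, V}"
  proof (rule ccontr)
    assume "poles G A H \<noteq> {U, V}"
    moreover have "{U, V} \<subseteq> poles G A H" using U(1) V(1) by simp
    ultimately obtain X where X: "X \<in> poles G A H" "X \<noteq> U" "X \<noteq> V" by blast
    obtain Q1 where Q1: "almost_invariant H Q1" "eventually_in X Q1" "eventually_in U (carrier G - Q1)"
      using poles_separated[OF X(1) U(1) X(2)] by blast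
    obtain Q2 where Q2: "almost_invariant H Q2" "eventually_in X Q2" "eventually_in V (carrier G - Q2)"
      using poles_separated[OF X(1) V(1) X(3)] by blast
    let ?Q = "Q1 \<inter> Q2"
    have UQ: "eventually_in U (carrier G - ?Q)" and VQ: "eventually_in V (carrier G - ?Q)"
      by (rule eventually_in_mono[OF Q1(3)], blast, rule eventually_in_mono[OF Q2(3)], blast)
    have "\<not> finite_over H ?Q"
      by (rule eventually_in_not_finite[OF X(1) eventually_in_Int[OF X(1) Q1(2) Q2(2)]])
    moreover have "\<not> finite_over H (carrier G - ?Q)" by (rule eventually_in_not_finite[OF U(1) UQ])
    moreover have "\<not> finite_over H (sym_diff P ?Q)"
      by (rule eventually_in_not_finite[OF U(1) eventually_in_mono[OF eventually_in_Int[OF U(1,2) UQ]]]) blast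
    moreover have "\<not> finite_over H (sym_diff P (carrier G - ?Q))"
      by (rule eventually_in_not_finite[OF V(1) eventually_in_mono[OF eventually_in_Int[OF V(1,2) VQ]]]) blast
    ultimately show False using cases[OF almost_invariant_Int[OF Q1(1) Q2(1)]] by blast
  qed
  ultimately show "card (poles G A H) = 2" by simp
qed

end

lemma (in group) num_poles_two_iff:
  assumes "finitely_generated G" "subgroup H G"
  shows "num_poles G H = 2 \<longleftrightarrow> two_ended H"
proof -
  have "finite_generating_set G (SOME A. finite_generating_set G A)"
    using assms(1) unfolding finitely_generated_def by (rule someI_ex)
  then interpret cayley_pair G "SOME A. finite_generating_set G A" H
    using assms(2) by (intro cayley_pair.intro cayley_pair_axioms.intro is_group)
  show ?thesis unfolding num_poles_def by (rule card_poles_two_iff)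
qed

section \<open>Reflection-compatibility\<close>

theorem corollary3p7:
  fixes W :: "('a, 'b) monoid_scheme"
  assumes "group W"
    and "finitely_generated W"
    and "bipolar_group W"
  shows "(\<forall>S\<^sub>1 S\<^sub>2. coxeter_generating_set W S\<^sub>1 \<and> coxeter_generating_set W S\<^sub>2
            \<longrightarrow> reflection_compatible W S\<^sub>1 S\<^sub>2) \<and>
         (\<forall>S. coxeter_generating_set W S \<longrightarrow> (\<forall>s\<in>S. bipolar_element W s))"
proof -
  interpret group W by (rule assms(1))
  obtain R where R: "coxeter_generating_set W R" "\<And>s. s \<in> R \<Longrightarrow> bipolar_element W s"
    using assms(3) unfolding bipolar_group_def by blast
  have system: "coxeter_system W S" if "coxeter_generating_set W S" for S
    by (intro coxeter_system.intro coxeter_system_axioms.intro is_group that)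
  interpret R: coxeter_system W R by (rule system[OF R(1)])
  have bipolar: "bipolar_element W s \<longleftrightarrow> two_ended (centraliser W s)" if "s \<in> carrier W" for s
    unfolding bipolar_element_def
    by (rule num_poles_two_iff[OF assms(2) subgroup_centraliser[OF that]])
  have two: "two_ended (centraliser W q)" if q: "q \<in> R.reflections" for q
    using q
  proof (rule R.reflectionsE)
    fix g s assume q: "q = g \<otimes>\<^bsub>W\<^esub> s \<otimes>\<^bsub>W\<^esub> inv\<^bsub>W\<^esub> g" "g \<in> carrier W" "s \<in> R"
    then have "two_ended (centraliser W s)" using bipolar[of s] R(2)[of s] by simp
    then show ?thesis
      unfolding q(1) centraliser_conj[OF R.S_closed[OF q(3)] q(2)]
      by (rule two_ended_conj[OF centraliser_subset _ q(2)])
  qed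
  have to_S: "r \<in> coxeter_system.reflections W S" if "coxeter_generating_set W S" "r \<in> R" for S r
    by (rule bipolar_reflection_compatible[OF system[OF R(1)] system[OF that(1)] two R.S_reflections[OF that(2)]])
  have to_R: "\<exists>r\<in>R. \<exists>g\<in>carrier W. s = g \<otimes>\<^bsub>W\<^esub> r \<otimes>\<^bsub>W\<^esub> inv\<^bsub>W\<^esub> g"
    if S: "coxeter_generating_set W S" and s: "s \<in> S" for S s
  proof -
    have "R \<subseteq> coxeter_system.reflections W S" using to_S[OF S] by blast
    from coxeter_system.generating_reflections[OF system[OF S] this R.gen_S s] show ?thesis .
  qed
  show ?thesis
  proof (intro conjI allI impI ballI)
    fix S\<^sub>1 S\<^sub>2
    assume cox: "coxeter_generating_set W S\<^sub>1 \<and> coxeter_generating_set W S\<^sub>2"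
    show "reflection_compatible W S\<^sub>1 S\<^sub>2"
      unfolding reflection_compatible_def
    proof
      fix s assume "s \<in> S\<^sub>1"
      then obtain r g where r: "r \<in> R" "g \<in> carrier W" "s = g \<otimes>\<^bsub>W\<^esub> r \<otimes>\<^bsub>W\<^esub> inv\<^bsub>W\<^esub> g"
        using to_R cox by blast
      interpret S2: coxeter_system W S\<^sub>2 using cox by (intro system) simp
      have "r \<in> S2.reflections" using to_S cox r(1) by blast
      then have "s \<in> S2.reflections" unfolding r(3) using r(2) by (rule S2.reflections_conj)
      then show "\<exists>t\<in>S\<^sub>2. \<exists>g\<in>carrier W. s = g \<otimes>\<^bsub>W\<^esub> t \<otimes>\<^bsub>W\<^esub> inv\<^bsub>W\<^esub> g"
        by (rule S2.reflectionsE) blast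
    qed
  next
    fix S s assume "coxeter_generating_set W S" "s \<in> S"
    then obtain r g where r: "r \<in> R" "g \<in> carrier W" "s = g \<otimes>\<^bsub>W\<^esub> r \<otimes>\<^bsub>W\<^esub> inv\<^bsub>W\<^esub> g"
      using to_R by blast
    then have "s \<in> R.reflections" using R.reflectionsI by blast
    then show "bipolar_element W s" using two bipolar R.reflections_closed by blast
  qed
qed

end
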